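(* For $1\le\alpha\le d=\dim\mathsf{H}_{\mathbb{R}}$, let $\xi_\alpha=D_\alpha^*\Omega$ be the conjugate variables corresponding to $(D_1,\dots,D_d)$. Then $\xi_\alpha=\sum_{m=1}^\infty(-1)^{m-1}\xi_{m,\alpha}$, where for $m\ge1$ $$\xi_{m,\alpha}=\sum_{\beta=1}^d\ \sum_{|w|=m-1}\ \prod_{1\le v<u\le m-1}q\bigl(i^{(w)}_v,i^{(w)}_u\bigr)\prod_{t=1}^{m-1}q\bigl(i_\alpha,i^{(w)}_t\bigr)\,\langle e_\alpha,\bar e_\beta\rangle_U\,L_{w\beta}^*(\bar e_w),$$ the inner sum being over words $w$ of length $m-1$ in $\{1,\dots,d\}$. Moreover the sum $\sum_{m=1}^\infty(-1)^{m-1}W(\xi_{m,\alpha})$ converges in operator norm, i.e. $\xi_\alpha\in\mathsf{M}_T\Omega$.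
   Context: Inner products are linear in the second variable. Construction. Let $\mathsf{H}_{\mathbb{R}}=\bigoplus_{i\in N}\mathsf{H}_{\mathbb{R}}^{(i)}$ be a finite-dimensional real Hilbert space of dimension $d$, $N$ finite. Let $(U_t)_{t\in\mathbb{R}}$ be a strongly continuous one-parameter orthogonal group leaving each $\mathsf{H}_{\mathbb{R}}^{(i)}$ invariant, and let $-1<q(i,j)=q(j,i)<1$ for $i,j\in N$. Let $\mathsf{H}_{\mathbb{C}}$ and $\mathsf{H}_{\mathbb{C}}^{(i)}$ be the complexifications, with conjugation $\overline{\xi_1+i\xi_2}=\xi_1-i\xi_2$ ($\xi_1,\xi_2\in\mathsf{H}_{\mathbb{R}}$). Let $A>0$ satisfy $U_t=A^{it}$ on $\mathsf{H}_{\mathbb{C}}$, put $\langle\xi,\zeta\rangle_U=\langle\xi,2(1+A^{-1})^{-1}\zeta\rangle_{\mathsf{H}_{\mathbb{C}}}$, and let $\mathsf{H}_U$ be $\mathsf{H}_{\mathbb{C}}$ with this inner product. Let $T$ on $\mathsf{H}_U\otimes\mathsf{H}_U$ be given by $T(\xi\otimes\eta)=q(i,j)\,\eta\otimes\xi$ for $\xi\in\mathsf{H}_{\mathbb{C}}^{(i)},\eta\in\mathsf{H}_{\mathbb{C}}^{(j)}$. Let $T_k$ be $T$ acting on legs $k,k+1$ of $\mathsf{H}_U^{\otimes n}$. Put $P^{(n)}=\sum_{\sigma\in S_n}\Phi(\sigma)$, where $\Phi(\sigma)=T_{k_1}\cdots T_{k_r}$ for any reduced expression $\sigma=\tau_{k_1}\cdots\tau_{k_r}$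 in adjacent transpositions $\tau_k=(k\ k+1)$ (and $\Phi(1)=I$); $P^{(n)}$ is strictly positive. Put $\langle\xi,\eta\rangle_T=\langle\xi,P^{(n)}\eta\rangle_{\mathsf{H}_U^{\otimes n}}$. The Fock space $\mathcal{F}_T(\mathsf{H}_U)$ is the Hilbert space direct sum over $n\ge0$ of $\mathsf{H}_U^{\otimes n}$ with $\langle\cdot,\cdot\rangle_T$ (degree $0$ is $\mathbb{C}\Omega$, $\|\Omega\|=1$). $\mathcal{F}_T(\mathsf{H}_U)_{\mathrm{alg}}$ is the span of $\Omega$ and all finite simple tensors. For $\xi\in\mathsf{H}_U$, $a^*(\xi)$ is the bounded operator of left tensoring by $\xi$ ($a^*(\xi)\Omega=\xi$), $a(\xi)$ is its adjoint, and $\mathsf{M}_T=\Gamma_T(\mathsf{H}_{\mathbb{R}},U_t)$ is the von Neumann algebra generated by $\{a(\xi)+a^*(\xi):\xi\in\mathsf{H}_{\mathbb{R}}\}$. The vacuum $\Omega$ is cyclic and separating, $\varphi=\langle\Omega,\cdot\,\Omega\rangle_T$, and $L^2(\mathsf{M}_T)=L^2(\mathsf{M}_T,\varphi)$ is identified with $\mathcal{F}_T(\mathsf{H}_U)$ via $x\mapsto x\Omega$. For $\xi\in\mathcal{F}_T(\mathsf{H}_U)_{\mathrm{alg}}$, $W(\xi)\in\mathsf{M}_T$ is the unique operator with $W(\xi)\Omega=\xi$. Free annihilation operators. For $\xi\in\mathsf{H}_U$, $l(\xi)$ is the bounded operator on $\mathcal{F}_T(\mathsf{H}_U)$ with $l(\xi)\Omega=0$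 and $l(\xi)(\xi_1\otimes\cdots\otimes\xi_n)=\langle\xi,\xi_1\rangle_U\,\xi_2\otimes\cdots\otimes\xi_n$. Basis and words. Fix an orthonormal basis $\{e_1,\dots,e_d\}$ of $\mathsf{H}_U$ such that each $e_k$ lies in some $\mathsf{H}_{\mathbb{C}}^{(j_k)}$, $j_k\in N$. Put $A_k=W(e_k)=a^*(e_k)+a(\bar e_k)$. For a word $w=\alpha_n\cdots\alpha_1$ in $\{1,\dots,d\}$ write $e_w=e_{\alpha_n}\otimes\cdots\otimes e_{\alpha_1}$ and $\bar e_w=\bar e_{\alpha_n}\otimes\cdots\otimes\bar e_{\alpha_1}$ (both equal to $\Omega$ for the empty word). Let $i^{(w)}_t\in N$ be the index with $e_{\alpha_t}\in\mathsf{H}_{\mathbb{C}}^{(i_t^{(w)})}$, and let $i_\alpha\in N$ be the index with $e_\alpha\in\mathsf{H}_{\mathbb{C}}^{(i_\alpha)}$. For such $w$ and $\beta\in\{1,\dots,d\}$ put $L_{w\beta}=l(e_\beta)\,l(e_{\alpha_1})\cdots l(e_{\alpha_n})$, and let $L_{w\beta}^*$ be its adjoint on $\mathcal{F}_T(\mathsf{H}_U)$. Empty products equal $1$. Conjugate variables. $\partial_k:\mathbb{C}[A_1,\dots,A_d]\to\mathsf{M}_T\overline{\otimes}\mathsf{M}_T^{\mathrm{op}}$ is the unique derivation (linear, $\partial_k(ab)=(a\otimes1)\partial_k(b)+(1\otimes b^{\mathrm{op}})\partial_k(a)$) with $\partial_k(A_\ell)=\varphi(A_\ell A_k)\,1\otimes1$.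 Vectors $\xi_1,\dots,\xi_d\in L^2(\mathsf{M}_T)$ are conjugate variables for $(A_1,\dots,A_d)$ if $\langle\xi_k,x1\rangle_{L^2(\mathsf{M}_T)}=\langle1\otimes1,\partial_k(x)(1\otimes1)\rangle_{L^2(\mathsf{M}_T\overline\otimes\mathsf{M}_T^{\mathrm{op}})}$ for all $x\in\mathbb{C}[A_1,\dots,A_d]$ and all $k$. Here $\mathsf{M}_T^{\mathrm{op}}$ carries the state $\varphi^{\mathrm{op}}$. Partitions $B(n+1)$. $B(n+1)$ is the set of partitions $\pi$ of $\{0,1,\dots,n\}$ into pairs and singletons such that: $0$ is paired with some $k\in\{1,\dots,n\}$; each $\ell\in\{1,\dots,k-1\}$ is paired with an element of $\{k+1,\dots,n\}$; all remaining elements are singletons. $p(\pi)$ and $s(\pi)$ denote the sets of pairs and singletons. $\pi(k)=\ell$ if $k,\ell$ are paired, and $\pi(k)=k$ if $k\in s(\pi)$. The operators $D_\alpha$. For $\alpha\in\{1,\dots,d\}$, $D_\alpha$ is the linear operator with domain $\mathcal{F}_T(\mathsf{H}_U)_{\mathrm{alg}}$ satisfying $D_\alpha\Omega=0$ and, for each word $\alpha_n\cdots\alpha_1$ with $n\ge1$, $$D_\alpha(e_{\alpha_n\cdots\alpha_1})=\sum_{\pi\in B(n+1)}(-1)^{\pi(0)-1}Q(\pi)E(\pi)e_{s(\pi)}.$$ Here $\alpha_0=\alpha$, $e_{\alpha_k}\in\mathsf{H}_{\mathbb{C}}^{(i_k)}$ for $0\le k\le n$, and $$Q(\pi)=\prod_{0\le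 v<u<\pi(0)}q(i_v,i_u)\cdot\prod_{\substack{0<v<u<\pi(0)\\ \pi(v)>\pi(u)}}q(i_{\pi(v)},i_{\pi(u)})\cdot\prod_{\substack{\pi(0)<v<u\le n\\ v\in s(\pi),\,u\notin s(\pi)}}q(i_v,i_u),$$ $$E(\pi)=\prod_{(k,\ell)\in p(\pi),\,k>\ell}\langle\bar e_{\alpha_k},e_{\alpha_\ell}\rangle_U,\qquad e_{s(\pi)}=e_{\alpha_{\ell_s}}\otimes\cdots\otimes e_{\alpha_{\ell_1}}\ \text{ for } s(\pi)=\{\ell_s>\cdots>\ell_1\},$$ with $e_{s(\pi)}=\Omega$ if $s(\pi)=\emptyset$. It is known that $\Omega\in\mathrm{Dom}(D_\alpha^* )$ for every $\alpha$ and that $(D_1^*\Omega,\dots,D_d^*\Omega)$ are conjugate variables for $(A_1,\dots,A_d)$. *)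

theory Defs
  imports "HOL-Analysis.Analysis"
begin

section \<open>Complexification\<close>

text \<open>The complexification of a real Hilbert space is modelled on pairs:
  \<open>(x, y)\<close> stands for \<open>x + \<i> y\<close>, and \<open>x\<close> in the real space is identified with \<open>(x, 0)\<close>.\<close>

definition cscale :: "complex \<Rightarrow> 'a::real_vector \<times> 'a \<Rightarrow> 'a \<times> 'a" where
  "cscale c v = (Re c *\<^sub>R fst v - Im c *\<^sub>R snd v, Re c *\<^sub>R snd v + Im c *\<^sub>R fst v)"

definition cconj :: "'a::real_vector \<times> 'a \<Rightarrow> 'a \<times> 'a" where
  "cconj v = (fst v, - snd v)"

text \<open>Linear in the second variable.\<close>

definition cip :: "'a::real_inner \<times> 'a \<Rightarrow> 'a \<times> 'a \<Rightarrow> complex" where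
  "cip v w = Complex (fst v \<bullet> fst w + snd v \<bullet> snd w) (fst v \<bullet> snd w - snd v \<bullet> fst w)"

definition clin :: "('a::real_vector \<times> 'a \<Rightarrow> 'a \<times> 'a) \<Rightarrow> bool" where
  "clin B \<longleftrightarrow> (\<forall>v w. B (v + w) = B v + B w) \<and> (\<forall>c v. B (cscale c v) = cscale c (B v))"

definition pos_op :: "('a::real_inner \<times> 'a \<Rightarrow> 'a \<times> 'a) \<Rightarrow> bool" where
  "pos_op B \<longleftrightarrow> clin B \<and> (\<forall>v w. cip (B v) w = cip v (B w))
     \<and> (\<forall>v. v \<noteq> 0 \<longrightarrow> 0 < Re (cip v (B v)))"

definition eigenspace :: "('a::real_vector \<times> 'a \<Rightarrow> 'a \<times> 'a) \<Rightarrow> real \<Rightarrow> ('a \<times> 'a) set" where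
  "eigenspace B r = {v. B v = cscale (of_real r) v}"

text \<open>Functional calculus \<open>f(B) = \<Sum>\<^sub>r f(r) E\<^sub>r\<close> of a self-adjoint operator on a finite-dimensional
  space.  The real part of \<^const>\<open>cip\<close> is the inner product of the product space \<open>'a \<times> 'a\<close>, so the
  nearest point of the eigenspace is the orthogonal projection \<open>E\<^sub>r\<close> onto it.\<close>

definition fun_calc ::
    "(real \<Rightarrow> complex) \<Rightarrow> ('a::euclidean_space \<times> 'a \<Rightarrow> 'a \<times> 'a) \<Rightarrow> 'a \<times> 'a \<Rightarrow> 'a \<times> 'a" where
  "fun_calc f B v =
     (\<Sum>r\<in>{r. eigenspace B r \<noteq> {0}}. cscale (f r) (closest_point (eigenspace B r) v))"

definition imag_power ::
    "('a::euclidean_space \<times> 'a \<Rightarrow> 'a \<times> 'a) \<Rightarrow> real \<Rightarrow> 'a \<times> 'a \<Rightarrow> 'a \<times> 'a" where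
  "imag_power B t = fun_calc (\<lambda>r. exp (\<i> * of_real (t * ln r))) B"


section \<open>The data of the construction\<close>

text \<open>Besides the real decomposition \<open>HR\<close> over the index set \<open>inds\<close>, the group, the matrix \<open>q\<close> and
  the generator, the data contains the orthonormal basis \<open>bas 1, \<dots>, bas d\<close> and the function \<open>dg\<close>
  with \<open>bas k\<close> in the complexification of \<open>HR (dg k)\<close>.\<close>

record ('a, 'i) aw_data =
  inds :: "'i set"
  HR :: "'i \<Rightarrow> 'a set"
  grp :: "real \<Rightarrow> 'a \<Rightarrow> 'a"
  qm :: "'i \<Rightarrow> 'i \<Rightarrow> real"
  gen :: "'a \<times> 'a \<Rightarrow> 'a \<times> 'a"
  bas :: "nat \<Rightarrow> 'a \<times> 'a"
  dg :: "nat \<Rightarrow> 'i"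

definition ipU :: "('a::euclidean_space, 'i) aw_data \<Rightarrow> 'a \<times> 'a \<Rightarrow> 'a \<times> 'a \<Rightarrow> complex" where
  "ipU D v w = cip v (cscale 2 (inv (\<lambda>u. u + inv (gen D) u) w))"

definition aw_setup :: "('a::euclidean_space, 'i) aw_data \<Rightarrow> bool" where
  "aw_setup D \<longleftrightarrow>
     \<comment> \<open>orthogonal direct sum decomposition\<close>
     finite (inds D)
     \<and> (\<forall>i\<in>inds D. subspace (HR D i))
     \<and> (\<forall>i\<in>inds D. \<forall>j\<in>inds D. i \<noteq> j \<longrightarrow> (\<forall>x\<in>HR D i. \<forall>y\<in>HR D j. x \<bullet> y = 0))
     \<and> span (\<Union>i\<in>inds D. HR D i) = UNIV
     \<comment> \<open>strongly continuous one-parameter orthogonal group preserving the decomposition\<close>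
     \<and> (\<forall>t. orthogonal_transformation (grp D t))
     \<and> grp D 0 = id
     \<and> (\<forall>s t. grp D (s + t) = grp D s \<circ> grp D t)
     \<and> (\<forall>x. continuous_on UNIV (\<lambda>t. grp D t x))
     \<and> (\<forall>t. \<forall>i\<in>inds D. grp D t ` HR D i \<subseteq> HR D i)
     \<comment> \<open>the deformation parameters\<close>
     \<and> (\<forall>i\<in>inds D. \<forall>j\<in>inds D. -1 < qm D i j \<and> qm D i j < 1 \<and> qm D i j = qm D j i)
     \<comment> \<open>the positive generator\<close>
     \<and> pos_op (gen D)
     \<and> (\<forall>t x y. (grp D t x, grp D t y) = imag_power (gen D) t (x, y))
     \<comment> \<open>the homogeneous orthonormal basis\<close>
     \<and> (\<forall>k\<in>{1..DIM('a)}. \<forall>l\<in>{1..DIM('a)}.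
          ipU D (bas D k) (bas D l) = (if k = l then 1 else 0))
     \<and> (\<forall>v. \<exists>c. v = (\<Sum>k=1..DIM('a). cscale (c k) (bas D k)))
     \<and> (\<forall>k\<in>{1..DIM('a)}. dg D k \<in> inds D \<and> bas D k \<in> HR D (dg D k) \<times> HR D (dg D k))"


section \<open>Twisted Fock space\<close>

text \<open>Words are written as lists: \<open>\<alpha>\<^sub>n\<cdots>\<alpha>\<^sub>1\<close> is \<open>[\<alpha>\<^sub>n, \<dots>, \<alpha>\<^sub>1]\<close>.  Since the space of \<open>n\<close>-tensors has the
  orthonormal basis \<open>e\<^sub>w\<close>, \<open>|w| = n\<close>, a vector of the (completed) Fock space is represented by its
  family of coordinates \<open>nat list \<Rightarrow> complex\<close> with respect to the \<open>e\<^sub>w\<close>.\<close>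

type_synonym fvec = "nat list \<Rightarrow> complex"

definition words :: "('a::euclidean_space, 'i) aw_data \<Rightarrow> nat \<Rightarrow> nat list set" where
  "words D n = {w. length w = n \<and> set w \<subseteq> {1..DIM('a)}}"

definition letter :: "nat list \<Rightarrow> nat \<Rightarrow> nat" where
  "letter w t = w ! (length w - t)"

text \<open>The simple tensor \<open>\<xi>\<^sub>1 \<otimes> \<cdots> \<otimes> \<xi>\<^sub>n\<close>; the empty one is the vacuum.\<close>

definition tens :: "('a::euclidean_space, 'i) aw_data \<Rightarrow> ('a \<times> 'a) list \<Rightarrow> fvec" where
  "tens D \<xi>s = (\<lambda>w. if w \<in> words D (length \<xi>s)
     then \<Prod>p<length \<xi>s. ipU D (bas D (w ! p)) (\<xi>s ! p) else 0)"

definition vac :: "('a::euclidean_space, 'i) aw_data \<Rightarrow> fvec" where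
  "vac D = tens D []"

definition e_word :: "('a::euclidean_space, 'i) aw_data \<Rightarrow> nat list \<Rightarrow> fvec" where
  "e_word D w = tens D (map (bas D) w)"

definition ebar_word :: "('a::euclidean_space, 'i) aw_data \<Rightarrow> nat list \<Rightarrow> fvec" where
  "ebar_word D w = tens D (map (\<lambda>k. cconj (bas D k)) w)"

text \<open>\<open>swap_legs k\<close> exchanges the legs \<open>k\<close>, \<open>k + 1\<close>, which are the list positions \<open>k - 1\<close>, \<open>k\<close>.
  \<open>T\<^sub>k\<close> is the linear extension of \<open>e\<^sub>v \<mapsto> q(i, j) e\<^bsub>swap v\<^esub>\<close>, where \<open>i\<close> and \<open>j\<close> are the indices
  of the letters at legs \<open>k\<close> and \<open>k + 1\<close> of \<open>v\<close>; see \<open>Tleg_e_word\<close> below.\<close>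

definition swap_legs :: "nat \<Rightarrow> 'b list \<Rightarrow> 'b list" where
  "swap_legs k w = w[k - 1 := w ! k, k := w ! (k - 1)]"

definition Tleg :: "('a, 'i) aw_data \<Rightarrow> nat \<Rightarrow> fvec \<Rightarrow> fvec" where
  "Tleg D k f = (\<lambda>w. let v = swap_legs k w in
     of_real (qm D (dg D (v ! (k - 1))) (dg D (v ! k))) * f v)"

lemma ipU_bas:
  assumes "aw_setup (D :: ('a::euclidean_space, 'i) aw_data)" "k \<in> {1..DIM('a)}" "l \<in> {1..DIM('a)}"
  shows "ipU D (bas D k) (bas D l) = (if k = l then 1 else 0)"
  using assms by (simp add: aw_setup_def)

lemma e_word_eq:
  assumes "aw_setup D" "w \<in> words D n"
  shows "e_word D w = (\<lambda>v. if v = w then 1 else 0)"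
proof
  fix v
  have w: "length w = n" "set w \<subseteq> {1..DIM('a)}"
    using assms(2) by (auto simp: words_def)
  show "e_word D w v = (if v = w then 1 else 0)"
  proof (cases "v \<in> words D n")
    case True
    then have v: "length v = n" "set v \<subseteq> {1..DIM('a)}" by (auto simp: words_def)
    have "e_word D w v = (\<Prod>p<n. ipU D (bas D (v ! p)) (bas D (w ! p)))"
      using True w by (simp add: e_word_def tens_def)
    also have "\<dots> = (\<Prod>p<n. if v ! p = w ! p then 1 else 0)"
    proof (rule prod.cong)
      fix p assume "p \<in> {..<n}"
      then have "v ! p \<in> {1..DIM('a)}" "w ! p \<in> {1..DIM('a)}"
        using v w by (auto intro!: nth_mem dest!: subsetD)
      then show "ipU D (bas D (v ! p)) (bas D (w ! p)) = (if v ! p = w ! p then 1 else 0)"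
        using ipU_bas[OF assms(1)] by simp
    qed simp
    also have "\<dots> = (if v = w then 1 else 0)"
      using v w by (auto simp: list_eq_iff_nth_eq)
    finally show ?thesis .
  next
    case False
    then show ?thesis using assms w by (auto simp: e_word_def tens_def)
  qed
qed

lemma swap_legs_twice:
  "1 \<le> k \<Longrightarrow> k < length w \<Longrightarrow> swap_legs k (swap_legs k w) = w"
  by (auto simp: swap_legs_def list_eq_iff_nth_eq nth_list_update)

lemma swap_legs_words:
  "w \<in> words D n \<Longrightarrow> 1 \<le> k \<Longrightarrow> k < n \<Longrightarrow> swap_legs k w \<in> words D n"
  by (auto simp: swap_legs_def words_def dest!: set_update_subset_insert[THEN subsetD]
      intro: nth_mem dest: subsetD)

lemma Tleg_e_word:
  assumes "aw_setup D" "w \<in> words D n" "1 \<le> k" "k < n"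
  shows "Tleg D k (e_word D w) =
    (\<lambda>v. of_real (qm D (dg D (w ! (k - 1))) (dg D (w ! k))) * e_word D (swap_legs k w) v)"
proof
  fix v
  have lw: "length w = n" using assms(2) by (simp add: words_def)
  have len: "length (swap_legs k v) = length v" for v :: "nat list" by (simp add: swap_legs_def)
  have iff: "swap_legs k v = w \<longleftrightarrow> v = swap_legs k w"
    using swap_legs_twice[of k] assms(3,4) lw len by metis
  have "e_word D (swap_legs k w) v = (if v = swap_legs k w then 1 else 0)"
    using e_word_eq[OF assms(1) swap_legs_words[OF assms(2-4)]] by simp
  then show "Tleg D k (e_word D w) v =
      of_real (qm D (dg D (w ! (k - 1))) (dg D (w ! k))) * e_word D (swap_legs k w) v"
    using iff by (auto simp: Tleg_def e_word_eq[OF assms(1,2)] Let_def)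
qed

definition adj_prod :: "nat list \<Rightarrow> nat \<Rightarrow> nat" where
  "adj_prod ks = foldr (\<lambda>k \<tau>. Transposition.transpose k (Suc k) \<circ> \<tau>) ks id"

definition reduced_expr :: "nat \<Rightarrow> (nat \<Rightarrow> nat) \<Rightarrow> nat list \<Rightarrow> bool" where
  "reduced_expr n \<sigma> ks \<longleftrightarrow> set ks \<subseteq> {1..<n} \<and> adj_prod ks = \<sigma>
     \<and> (\<forall>ks'. set ks' \<subseteq> {1..<n} \<and> adj_prod ks' = \<sigma> \<longrightarrow> length ks \<le> length ks')"

definition Phi :: "('a, 'i) aw_data \<Rightarrow> nat \<Rightarrow> (nat \<Rightarrow> nat) \<Rightarrow> fvec \<Rightarrow> fvec" where
  "Phi D n \<sigma> f = foldr (Tleg D) (SOME ks. reduced_expr n \<sigma> ks) f"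

definition Pn :: "('a, 'i) aw_data \<Rightarrow> nat \<Rightarrow> fvec \<Rightarrow> fvec" where
  "Pn D n f = (\<lambda>w. \<Sum>\<sigma>\<in>{\<sigma>. \<sigma> permutes {1..n}}. Phi D n \<sigma> f w)"

definition ipT_deg :: "('a::euclidean_space, 'i) aw_data \<Rightarrow> nat \<Rightarrow> fvec \<Rightarrow> fvec \<Rightarrow> complex" where
  "ipT_deg D n f g = (\<Sum>w\<in>words D n. cnj (f w) * Pn D n g w)"

definition Fock :: "('a::euclidean_space, 'i) aw_data \<Rightarrow> fvec set" where
  "Fock D = {f. (\<forall>w. f w \<noteq> 0 \<longrightarrow> w \<in> words D (length w))
     \<and> summable (\<lambda>n. Re (ipT_deg D n f f))}"

definition ipT :: "('a::euclidean_space, 'i) aw_data \<Rightarrow> fvec \<Rightarrow> fvec \<Rightarrow> complex" where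
  "ipT D f g = (\<Sum>n. ipT_deg D n f g)"

definition normT :: "('a::euclidean_space, 'i) aw_data \<Rightarrow> fvec \<Rightarrow> real" where
  "normT D f = sqrt (Re (ipT D f f))"

definition Fock_alg :: "('a::euclidean_space, 'i) aw_data \<Rightarrow> fvec set" where
  "Fock_alg D = {f. \<exists>S c. finite S \<and> f = (\<lambda>w. \<Sum>\<xi>s\<in>S. c \<xi>s * tens D \<xi>s w)}"


section \<open>Operators on Fock space\<close>

text \<open>Operators on Fock space are total functions taking the value \<open>0\<close> outside of it, so that
  equality of operators is equality of functions.\<close>

definition bops :: "('a::euclidean_space, 'i) aw_data \<Rightarrow> (fvec \<Rightarrow> fvec) set" where
  "bops D = {X. (\<forall>f\<in>Fock D. X f \<in> Fock D)
     \<and> (\<forall>f\<in>Fock D. \<forall>g\<in>Fock D. \<forall>c. X (\<lambda>w. f w + c * g w) = (\<lambda>w. X f w + c * X g w))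
     \<and> (\<exists>K. \<forall>f\<in>Fock D. normT D (X f) \<le> K * normT D f)
     \<and> (\<forall>f. f \<notin> Fock D \<longrightarrow> X f = (\<lambda>w. 0))}"

definition opnorm :: "('a::euclidean_space, 'i) aw_data \<Rightarrow> (fvec \<Rightarrow> fvec) \<Rightarrow> real" where
  "opnorm D X = Sup {normT D (X f) | f. f \<in> Fock D \<and> normT D f \<le> 1}"

text \<open>The adjoint of an operator \<open>X\<close> with dense domain \<open>S\<close>; the value is meaningful for vectors
  \<open>g\<close> in the domain of the adjoint.\<close>

definition adjoint_on ::
    "('a::euclidean_space, 'i) aw_data \<Rightarrow> fvec set \<Rightarrow> (fvec \<Rightarrow> fvec) \<Rightarrow> fvec \<Rightarrow> fvec" where
  "adjoint_on D S X g = (if g \<in> Fock D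
     then THE h. h \<in> Fock D \<and> (\<forall>f\<in>S. ipT D h f = ipT D g (X f)) else (\<lambda>w. 0))"

abbreviation adj :: "('a::euclidean_space, 'i) aw_data \<Rightarrow> (fvec \<Rightarrow> fvec) \<Rightarrow> fvec \<Rightarrow> fvec" where
  "adj D \<equiv> adjoint_on D (Fock D)"

definition crea :: "('a::euclidean_space, 'i) aw_data \<Rightarrow> 'a \<times> 'a \<Rightarrow> fvec \<Rightarrow> fvec" where
  "crea D \<xi> f = (\<lambda>w. if f \<in> Fock D
     then (case w of [] \<Rightarrow> 0
           | k # v \<Rightarrow> if k \<in> {1..DIM('a)} then ipU D (bas D k) \<xi> * f v else 0)
     else 0)"

definition anni :: "('a::euclidean_space, 'i) aw_data \<Rightarrow> 'a \<times> 'a \<Rightarrow> fvec \<Rightarrow> fvec" where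
  "anni D \<xi> = adj D (crea D \<xi>)"

text \<open>Free annihilation: the coordinates of
  \<open>\<langle>\<xi>, \<xi>\<^sub>1\<rangle>\<^sub>U \<xi>\<^sub>2 \<otimes> \<cdots> \<otimes> \<xi>\<^sub>n\<close> are obtained by expanding \<open>\<xi>\<^sub>1\<close> in the basis; see \<open>lann_tens\<close> below.\<close>

definition lann :: "('a::euclidean_space, 'i) aw_data \<Rightarrow> 'a \<times> 'a \<Rightarrow> fvec \<Rightarrow> fvec" where
  "lann D \<xi> f = (\<lambda>w. if f \<in> Fock D
     then \<Sum>k=1..DIM('a). ipU D \<xi> (bas D k) * f (k # w) else 0)"

lemma tens_Fock: "tens D \<xi>s \<in> Fock D"
proof -
  have "ipT_deg D n (tens D \<xi>s) (tens D \<xi>s) = 0" if "n \<notin> {length \<xi>s}" for n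
    using that by (auto simp: ipT_deg_def tens_def words_def intro!: sum.neutral)
  then have "summable (\<lambda>n. Re (ipT_deg D n (tens D \<xi>s) (tens D \<xi>s)))"
    by (intro summable_finite[of "{length \<xi>s}"]) auto
  then show ?thesis by (auto simp: Fock_def tens_def words_def split: if_splits)
qed

lemma crea_tens: "crea D \<xi> (tens D \<xi>s) = tens D (\<xi> # \<xi>s)"
proof
  fix w
  show "crea D \<xi> (tens D \<xi>s) w = tens D (\<xi> # \<xi>s) w"
    using tens_Fock[of D \<xi>s] unfolding crea_def
    by (cases w) (auto simp: tens_def[of D "\<xi> # \<xi>s"] tens_def[of D \<xi>s, THEN fun_cong] words_def
        prod.lessThan_Suc_shift simp del: prod.lessThan_Suc)
qed

lemma cip_cscale: "cip v (cscale c w) = c * cip v w"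
  by (auto simp: cip_def cscale_def complex_eq_iff inner_simps algebra_simps)

lemma cip_add: "cip v (w + x) = cip v w + cip v x"
  by (auto simp: cip_def complex_eq_iff inner_simps)

lemma cip_sum: "cip v (\<Sum>k\<in>S. f k) = (\<Sum>k\<in>S. cip v (f k))"
  by (induction S rule: infinite_finite_induct) (simp_all add: cip_add, simp_all add: cip_def complex_eq_iff)

lemma cscale_add: "cscale c (v + w) = cscale c v + cscale c w"
  by (simp add: cscale_def prod_eq_iff algebra_simps)

lemma cscale_cscale: "cscale c (cscale d v) = cscale (c * d) v"
  by (simp add: cscale_def prod_eq_iff algebra_simps)

lemma cscale_of_real: "cscale (of_real r) v = r *\<^sub>R v"
  by (simp add: cscale_def prod_eq_iff)

lemma clin_linear: "clin B \<Longrightarrow> linear B"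
  unfolding clin_def by (metis linearI cscale_of_real)

lemma clin_inv:
  assumes "clin (B :: 'a::euclidean_space \<times> 'a \<Rightarrow> _)" "\<And>v. v \<noteq> 0 \<Longrightarrow> B v \<noteq> 0"
  shows "bij B" "clin (inv B)"
proof -
  have lin: "linear B" by (rule clin_linear[OF assms(1)])
  have "inj B" using assms(2) linear_injective_0[OF lin] by blast
  then show "bij B" using linear_injective_imp_surjective[OF lin] by (simp add: bij_def)
  then have BI: "B (inv B x) = x" "inv B (B x) = x" for x
    by (simp_all add: bij_is_surj surj_f_inv_f bij_is_inj)
  have "inv B (v + w) = inv B v + inv B w" for v w
    using assms(1) BI unfolding clin_def by metis
  moreover have "inv B (cscale c v) = cscale c (inv B v)" for c v
    using assms(1) BI unfolding clin_def by metis
  ultimately show "clin (inv B)" by (simp add: clin_def)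
qed

lemma ipU_eq:
  assumes "pos_op (gen D)"
  obtains B where "clin B" "\<And>v w. ipU D v w = cip v (B w)"
proof -
  let ?A = "gen D"
  have A: "clin ?A" "\<And>v. v \<noteq> 0 \<Longrightarrow> 0 < Re (cip v (?A v))"
    using assms by (auto simp: pos_op_def)
  have "?A v \<noteq> 0" if "v \<noteq> 0" for v using A(2)[OF that] by (auto simp: cip_def)
  note I = clin_inv[OF A(1) this]
  have AI: "?A (inv ?A x) = x" for x using I by (simp add: bij_is_surj surj_f_inv_f)
  define C where "C = (\<lambda>u. u + inv ?A u)"
  have C: "clin C" using I(2) unfolding C_def clin_def by (simp add: cscale_add)
  have "C v \<noteq> 0" if v: "v \<noteq> 0" for v
  proof
    assume "C v = 0"
    then have "inv ?A v = - v" unfolding C_def by (rule add.inverse_unique[symmetric])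
    then have "v = - ?A v" using AI[of v] linear_neg[OF clin_linear[OF A(1)], of v] by simp
    then have "?A v = - v" by (metis minus_minus)
    then have "Re (cip v (?A v)) = - (fst v \<bullet> fst v) - snd v \<bullet> snd v" by (simp add: cip_def)
    then have "Re (cip v (?A v)) \<le> 0"
      using inner_ge_zero[of "fst v"] inner_ge_zero[of "snd v"] by linarith
    then show False using A(2)[OF v] by linarith
  qed
  note J = clin_inv[OF C this]
  have "clin (\<lambda>w. cscale 2 (inv C w))"
    using J(2) unfolding clin_def by (simp add: cscale_add cscale_cscale mult.commute)
  then show ?thesis by (rule that) (simp add: ipU_def C_def)
qed

lemma ipU_parseval:
  assumes "aw_setup (D :: ('a::euclidean_space, 'i) aw_data)"
  shows "(\<Sum>k=1..DIM('a). ipU D v (bas D k) * ipU D (bas D k) w) = ipU D v w"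
proof -
  have "pos_op (gen D)" using assms by (simp add: aw_setup_def)
  then obtain B where B: "clin B" "\<And>v w. ipU D v w = cip v (B w)" by (rule ipU_eq) blast
  have lin: "ipU D v (\<Sum>k\<in>S. cscale (c k) (f k)) = (\<Sum>k\<in>S. c k * ipU D v (f k))"
    for v c f and S :: "nat set"
  proof -
    have "B (cscale c v) = cscale c (B v)" for c v using B(1) by (auto simp only: clin_def)
    then show ?thesis
      unfolding B(2) linear_sum[OF clin_linear[OF B(1)]] cip_sum by (simp only: cip_cscale)
  qed
  have "\<forall>v. \<exists>c. v = (\<Sum>k=1..DIM('a). cscale (c k) (bas D k))"
    using assms unfolding aw_setup_def by (elim conjE) assumption
  then obtain c where w: "w = (\<Sum>k=1..DIM('a). cscale (c k) (bas D k))" by blast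
  have "ipU D (bas D k) w = c k" if "k \<in> {1..DIM('a)}" for k
  proof -
    have "ipU D (bas D k) w = (\<Sum>l=1..DIM('a). if k = l then c l else 0)"
      unfolding w lin using ipU_bas[OF assms that] by (intro sum.cong) auto
    then show ?thesis using that by simp
  qed
  then have "(\<Sum>k=1..DIM('a). ipU D v (bas D k) * ipU D (bas D k) w)
      = (\<Sum>k=1..DIM('a). c k * ipU D v (bas D k))"
    by (intro sum.cong) auto
  also have "\<dots> = ipU D v w" unfolding w lin ..
  finally show ?thesis .
qed

lemma lann_vac: "lann D \<xi> (vac D) = (\<lambda>w. 0)"
  by (auto simp: lann_def vac_def tens_def words_def fun_eq_iff intro!: sum.neutral)

lemma lann_tens:
  assumes "aw_setup D"
  shows "lann D \<xi> (tens D (\<xi>\<^sub>1 # \<xi>s)) = (\<lambda>w. ipU D \<xi> \<xi>\<^sub>1 * tens D \<xi>s w)"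
proof
  fix w
  have "tens D (\<xi>\<^sub>1 # \<xi>s) (k # w) = ipU D (bas D k) \<xi>\<^sub>1 * tens D \<xi>s w" if "k \<in> {1..DIM('a)}" for k
    using that by (auto simp: tens_def words_def prod.lessThan_Suc_shift simp del: prod.lessThan_Suc)
  then have "lann D \<xi> (tens D (\<xi>\<^sub>1 # \<xi>s)) w
      = (\<Sum>k=1..DIM('a). (ipU D \<xi> (bas D k) * ipU D (bas D k) \<xi>\<^sub>1) * tens D \<xi>s w)"
    by (auto simp: lann_def tens_Fock intro!: sum.cong)
  then show "lann D \<xi> (tens D (\<xi>\<^sub>1 # \<xi>s)) w = ipU D \<xi> \<xi>\<^sub>1 * tens D \<xi>s w"
    using ipU_parseval[OF assms, of \<xi> \<xi>\<^sub>1] by (simp only: flip: sum_distrib_right)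
qed

definition commutant ::
    "('a::euclidean_space, 'i) aw_data \<Rightarrow> (fvec \<Rightarrow> fvec) set \<Rightarrow> (fvec \<Rightarrow> fvec) set" where
  "commutant D S = {X \<in> bops D. \<forall>Y\<in>S. X \<circ> Y = Y \<circ> X}"

definition vN_gen ::
    "('a::euclidean_space, 'i) aw_data \<Rightarrow> (fvec \<Rightarrow> fvec) set \<Rightarrow> (fvec \<Rightarrow> fvec) set" where
  "vN_gen D S = commutant D (commutant D (S \<union> adj D ` S))"

definition MT :: "('a::euclidean_space, 'i) aw_data \<Rightarrow> (fvec \<Rightarrow> fvec) set" where
  "MT D = vN_gen D (range (\<lambda>x f w. anni D (x, 0) f w + crea D (x, 0) f w))"

definition Wick :: "('a::euclidean_space, 'i) aw_data \<Rightarrow> fvec \<Rightarrow> fvec \<Rightarrow> fvec" where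
  "Wick D \<xi> = (THE X. X \<in> MT D \<and> X (vac D) = \<xi>)"


section \<open>The operators \<open>D\<^sub>\<alpha>\<close>\<close>

text \<open>The set \<open>B(n + 1)\<close> of partitions of \<open>{0..n}\<close>.  The last clause says that every block of two
  elements is one of the prescribed pairs, i.e. that all remaining elements are singletons.\<close>

definition Bpart :: "nat \<Rightarrow> nat set set set" where
  "Bpart n = {P. partition_on {0..n} P \<and> (\<forall>b\<in>P. card b = 1 \<or> card b = 2)
     \<and> (\<exists>k\<in>{1..n}. {0, k} \<in> P
          \<and> (\<forall>l\<in>{1..<k}. \<exists>m\<in>{k<..n}. {l, m} \<in> P)
          \<and> (\<forall>b\<in>P. card b = 2 \<longrightarrow> b = {0, k} \<or> (\<exists>l\<in>{1..<k}. l \<in> b)))}"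

definition singles :: "nat set set \<Rightarrow> nat set" where
  "singles P = {k. {k} \<in> P}"

definition partner :: "nat set set \<Rightarrow> nat \<Rightarrow> nat" where
  "partner P k = (if k \<in> singles P then k else THE l. l \<noteq> k \<and> {k, l} \<in> P)"

text \<open>In the following, \<open>a t = \<alpha>\<^sub>t\<close> for \<open>0 \<le> t \<le> n\<close>.\<close>

definition Qpart :: "('a, 'i) aw_data \<Rightarrow> nat \<Rightarrow> (nat \<Rightarrow> nat) \<Rightarrow> nat set set \<Rightarrow> real" where
  "Qpart D n a P =
     (\<Prod>(v, u)\<in>{(v, u). 0 \<le> v \<and> v < u \<and> u < partner P 0}. qm D (dg D (a v)) (dg D (a u)))
   * (\<Prod>(v, u)\<in>{(v, u). 0 < v \<and> v < u \<and> u < partner P 0 \<and> partner P v > partner P u}.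
        qm D (dg D (a (partner P v))) (dg D (a (partner P u))))
   * (\<Prod>(v, u)\<in>{(v, u). partner P 0 < v \<and> v < u \<and> u \<le> n \<and> v \<in> singles P \<and> u \<notin> singles P}.
        qm D (dg D (a v)) (dg D (a u)))"

definition Epart ::
    "('a::euclidean_space, 'i) aw_data \<Rightarrow> (nat \<Rightarrow> nat) \<Rightarrow> nat set set \<Rightarrow> complex" where
  "Epart D a P = (\<Prod>(k, l)\<in>{(k, l). {k, l} \<in> P \<and> k > l}.
     ipU D (cconj (bas D (a k))) (bas D (a l)))"

definition e_singles ::
    "('a::euclidean_space, 'i) aw_data \<Rightarrow> (nat \<Rightarrow> nat) \<Rightarrow> nat set set \<Rightarrow> fvec" where
  "e_singles D a P = e_word D (map a (rev (sorted_list_of_set (singles P))))"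

definition D_basis :: "('a::euclidean_space, 'i) aw_data \<Rightarrow> nat \<Rightarrow> nat list \<Rightarrow> fvec" where
  "D_basis D \<alpha> w = (if w = [] then (\<lambda>v. 0) else
     (let n = length w; a = (\<lambda>t. if t = 0 then \<alpha> else letter w t) in
      (\<lambda>v. \<Sum>P\<in>Bpart n. (-1) ^ (partner P 0 - 1) * of_real (Qpart D n a P) * Epart D a P
             * e_singles D a P v)))"

definition D_op :: "('a::euclidean_space, 'i) aw_data \<Rightarrow> nat \<Rightarrow> fvec \<Rightarrow> fvec" where
  "D_op D \<alpha> f = (\<lambda>v. \<Sum>w\<in>{w. f w \<noteq> 0}. f w * D_basis D \<alpha> w v)"

definition conj_var :: "('a::euclidean_space, 'i) aw_data \<Rightarrow> nat \<Rightarrow> fvec" where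
  "conj_var D \<alpha> = adjoint_on D (Fock_alg D) (D_op D \<alpha>) (vac D)"


section \<open>The vectors \<open>\<xi>\<^bsub>m,\<alpha>\<^esub>\<close>\<close>

definition Lop :: "('a::euclidean_space, 'i) aw_data \<Rightarrow> nat list \<Rightarrow> nat \<Rightarrow> fvec \<Rightarrow> fvec" where
  "Lop D w \<beta> = foldr (\<lambda>k X. lann D (bas D k) \<circ> X) (\<beta> # rev w) id"

definition xi :: "('a::euclidean_space, 'i) aw_data \<Rightarrow> nat \<Rightarrow> nat \<Rightarrow> fvec" where
  "xi D m \<alpha> = (\<lambda>x. \<Sum>\<beta>=1..DIM('a). \<Sum>w\<in>words D (m - 1).
     of_real (\<Prod>(v, u)\<in>{(v, u). 1 \<le> v \<and> v < u \<and> u \<le> m - 1}.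
        qm D (dg D (letter w v)) (dg D (letter w u)))
   * of_real (\<Prod>t=1..m - 1. qm D (dg D \<alpha>) (dg D (letter w t)))
   * ipU D (bas D \<alpha>) (cconj (bas D \<beta>))
   * adj D (Lop D w \<beta>) (ebar_word D w) x)"

end

theory Submission
  imports Defs
begin

text \<open>In the coordinates \<open>f w\<close> of a tensor along the basis words, \<open>P\<^bsup>(n)\<^esup>\<close> is a sum over permutations
  weighted by the \<open>q\<close>-values of their inversions, and its form is a Schur product of positive
  \<open>2 \<times> 2\<close> kernels, one for each pair of legs; hence it is strictly positive.  In the factorization
  \<open>P\<^bsup>(n+1)\<^esup> = (1 \<otimes> P\<^bsup>(n)\<^esup>) R\<close>, both \<open>R\<close> and \<open>R\<^sup>-\<^sup>1\<close> are bounded in the sup norm of the coordinates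
  uniformly in \<open>n\<close>, and iterating a symmetric operator transfers such bounds to the twisted
  norm.  So creation, annihilation and Wick operators are bounded, with
  \<open>\<parallel>W(e\<^sub>w)\<parallel> \<le> n! K\<^bsup>n\<^esup>\<close> for \<open>|w| = n\<close>.  The reversed, right-hand field operators of \<open>B\<^sup>-\<^sup>1 H\<^sub>\<real>\<close>,
  \<open>B = 2(1 + A\<^sup>-\<^sup>1)\<^sup>-\<^sup>1\<close>, commute with the algebra, so the vacuum is separating.

  The vacuum coefficient of \<open>D\<^sub>\<alpha> e\<^sub>u\<close> is carried by the partitions without singletons, which
  exist only for \<open>|u| = 2m - 1\<close> and are then the permutations of \<open>m - 1\<close> letters; up to sign and
  conjugation their sum is the coefficient of \<open>P\<^bsup>(2m-1)\<^esup> \<xi>\<^bsub>m,\<alpha>\<^esub>\<close> at \<open>u\<close>.  The \<open>q\<close>-factors of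
  \<open>\<xi>\<^bsub>m,\<alpha>\<^esub>\<close> decay like \<open>r\<^bsup>m(m-1)/2\<^esup>\<close> with \<open>r = max |q| < 1\<close>, which beats \<open>(2m)!\<^sup>2 K\<^bsup>m\<^esup>\<close>, so
  the series of Wick operators converges in norm.\<close>

section \<open>Inversions\<close>

text \<open>Comparing the twisted norm with that of the coordinates costs the factor (1 -
  r)^(n(n-1)/2) of strict positivity, so no bound uniform in n comes out of it. In the sup norm each
  product T_1 ... T_k is a weighted permutation of words with weight at most r^k, so geometric
  series are available; the growth rate of iterates does not see the constants lost between two
  norms. Operator limits are formed coordinate by coordinate, with lower semicontinuity of the norm
  in the part of completeness. Adjoints are definite descriptions, so each is found by exhibiting a
  vector h; since <h, f> is the sum of f(w) times the conjugate of (P h)(w), this means prescribing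
  P h, and solving P h = g also gives the size of h. The match of D_\<alpha> with \<xi>_m needs an
  argument of its own: the first product in Q takes its factors from the last m - 1 letters of u,
  \<xi>_m from the first m - 1. They agree because conjugation preserves the components, so a
  permutation pairing letters of different components contributes zero.\<close>

definition perm_word :: "(nat \<Rightarrow> nat) \<Rightarrow> 'b list \<Rightarrow> 'b list" where
  "perm_word \<sigma> w = map (\<lambda>i. w ! (\<sigma> (Suc i) - 1)) [0..<length w]"

definition invs :: "nat \<Rightarrow> (nat \<Rightarrow> nat) \<Rightarrow> (nat \<times> nat) set" where
  "invs n \<sigma> = {(i, j). 1 \<le> i \<and> i < j \<and> j \<le> n \<and> \<sigma> j < \<sigma> i}"

lemma length_perm_word [simp]: "length (perm_word \<sigma> w) = length w"
  by (simp add: perm_word_def)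

lemma nth_perm_word: "i < length w \<Longrightarrow> perm_word \<sigma> w ! i = w ! (\<sigma> (Suc i) - 1)"
  by (simp add: perm_word_def)

lemma nth_perm_word': "i \<in> {1..length w} \<Longrightarrow> perm_word \<sigma> w ! (i - 1) = w ! (\<sigma> i - 1)"
  by (auto simp: nth_perm_word)

lemma permutes_in_iff_atLeastAtMost:
  "\<sigma> permutes {1..n} \<Longrightarrow> i \<in> {1..n} \<Longrightarrow> \<sigma> i \<in> {1..n}"
  by (metis permutes_in_image)

text \<open>Words carry a right action: the new letter at place i is the old one at place
  \<open>\<sigma> i\<close>, so in a composite the left factor acts first.\<close>

lemma perm_word_comp:
  assumes "\<tau> permutes {1..length w}"
  shows "perm_word (\<sigma> \<circ> \<tau>) w = perm_word \<tau> (perm_word \<sigma> w)"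
proof (rule nth_equalityI)
  fix i assume "i < length (perm_word (\<sigma> \<circ> \<tau>) w)"
  then have i: "Suc i \<in> {1..length w}" by simp
  have "\<tau> (Suc i) \<in> {1..length w}" using permutes_in_iff_atLeastAtMost[OF assms i] .
  then show "perm_word (\<sigma> \<circ> \<tau>) w ! i = perm_word \<tau> (perm_word \<sigma> w) ! i"
    using i by (auto simp: nth_perm_word nth_perm_word')
qed auto

lemma perm_word_id [simp]: "perm_word id w = w"
  by (simp add: perm_word_def map_nth)

lemma invs_id [simp]: "invs n id = {}"
  by (auto simp: invs_def)

lemma finite_invs [simp]: "finite (invs n \<sigma>)"
  by (rule finite_subset[of _ "{1..n} \<times> {1..n}"]) (auto simp: invs_def)

text \<open>Composing on the left exchanges the values k and k + 1. No third value lies between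
  them, so only the pair of places carrying these two values changes its order.\<close>

lemma invs_transpose:
  assumes \<sigma>: "\<sigma> permutes {1..n}" and k: "k \<in> {1..<n}"
    and less: "inv \<sigma> k < inv \<sigma> (Suc k)"
  shows "invs n (Transposition.transpose k (Suc k) \<circ> \<sigma>) = insert (inv \<sigma> k, inv \<sigma> (Suc k)) (invs n \<sigma>)"
    and "(inv \<sigma> k, inv \<sigma> (Suc k)) \<notin> invs n \<sigma>"
proof -
  let ?s = "Transposition.transpose k (Suc k)"
  have key: "?s x < ?s y \<longleftrightarrow> x < y \<and> (x, y) \<noteq> (k, Suc k) \<or> (x, y) = (Suc k, k)" for x y
    by (auto simp: Transposition.transpose_def)
  have I: "\<sigma> i = x \<longleftrightarrow> i = inv \<sigma> x" for i x
    using permutes_inverses[OF \<sigma>] by metis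
  have J: "\<sigma> (inv \<sigma> x) = x" for x by (rule permutes_inverses[OF \<sigma>])
  have R: "inv \<sigma> k \<in> {1..n}" "inv \<sigma> (Suc k) \<in> {1..n}"
    using k permutes_in_iff_atLeastAtMost[OF permutes_inv[OF \<sigma>]] by auto
  show "invs n (?s \<circ> \<sigma>) = insert (inv \<sigma> k, inv \<sigma> (Suc k)) (invs n \<sigma>)"
    using R less by (auto simp: invs_def key I J)
  show "(inv \<sigma> k, inv \<sigma> (Suc k)) \<notin> invs n \<sigma>" by (simp add: invs_def J)
qed

lemma transpose_permutes: "k \<in> {1..<n} \<Longrightarrow> Transposition.transpose k (Suc k) permutes {1..n}"
  by (rule permutes_swap_id) auto

lemma card_invs_transpose:
  assumes \<sigma>: "\<sigma> permutes {1..n}" and k: "k \<in> {1..<n}"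
  shows "inv \<sigma> k < inv \<sigma> (Suc k) \<Longrightarrow>
      card (invs n (Transposition.transpose k (Suc k) \<circ> \<sigma>)) = Suc (card (invs n \<sigma>))"
    and "inv \<sigma> (Suc k) < inv \<sigma> k \<Longrightarrow>
      card (invs n \<sigma>) = Suc (card (invs n (Transposition.transpose k (Suc k) \<circ> \<sigma>)))"
proof -
  let ?s = "Transposition.transpose k (Suc k)"
  show "card (invs n (?s \<circ> \<sigma>)) = Suc (card (invs n \<sigma>))" if "inv \<sigma> k < inv \<sigma> (Suc k)"
    using invs_transpose[OF \<sigma> k that] by simp
  assume less: "inv \<sigma> (Suc k) < inv \<sigma> k"
  have p: "?s \<circ> \<sigma> permutes {1..n}" by (rule permutes_compose[OF \<sigma> transpose_permutes[OF k]])
  have "inv (?s \<circ> \<sigma>) x = inv \<sigma> (?s x)" for x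
  proof -
    have "inv (?s \<circ> \<sigma>) = inv \<sigma> \<circ> inv ?s"
      by (rule o_inv_distrib) (use \<sigma> in \<open>auto simp: permutes_bij\<close>)
    then show ?thesis by simp
  qed
  then have "inv (?s \<circ> \<sigma>) k < inv (?s \<circ> \<sigma>) (Suc k)" using less by simp
  from invs_transpose[OF p k this] have "card (invs n (?s \<circ> (?s \<circ> \<sigma>))) = Suc (card (invs n (?s \<circ> \<sigma>)))"
    by simp
  moreover have "?s \<circ> (?s \<circ> \<sigma>) = \<sigma>" by (simp add: fun_eq_iff)
  ultimately show "card (invs n \<sigma>) = Suc (card (invs n (?s \<circ> \<sigma>)))" by simp
qed

lemma adj_prod_simps:
  "adj_prod [] = id"
  "adj_prod (k # ks) = Transposition.transpose k (Suc k) \<circ> adj_prod ks"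
  by (simp_all add: adj_prod_def)

lemma adj_prod_permutes: "set ks \<subseteq> {1..<n} \<Longrightarrow> adj_prod ks permutes {1..n}"
proof (induction ks)
  case Nil
  show ?case unfolding adj_prod_simps by (rule permutes_id)
next
  case (Cons k ks)
  then have "k \<in> {1..<n}" "adj_prod ks permutes {1..n}" by auto
  then show ?case
    unfolding adj_prod_simps by (intro permutes_compose transpose_permutes)
qed

lemma inv_neq_Suc:
  assumes "\<sigma> permutes S" shows "inv \<sigma> k \<noteq> inv \<sigma> (Suc k)"
  by (metis assms n_not_Suc_n permutes_inverses(1))

text \<open>Each factor changes the number of inversions by exactly one. Together with
  \<open>ex_adj_prod\<close> this identifies the length of a reduced expression with the number of
  inversions.\<close>

lemma card_invs_adj_prod: "set ks \<subseteq> {1..<n} \<Longrightarrow> card (invs n (adj_prod ks)) \<le> length ks"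
proof (induction ks)
  case Nil
  show ?case unfolding adj_prod_simps invs_id by simp
next
  case (Cons k ks)
  then have k: "k \<in> {1..<n}" and ks: "set ks \<subseteq> {1..<n}" by auto
  note p = adj_prod_permutes[OF ks]
  from inv_neq_Suc[OF p, of k] consider "inv (adj_prod ks) k < inv (adj_prod ks) (Suc k)"
    | "inv (adj_prod ks) (Suc k) < inv (adj_prod ks) k" by linarith
  then show ?case
    unfolding adj_prod_simps(2) list.size
    using Cons.IH[OF ks] card_invs_transpose[OF p k] by cases linarith+
qed

lemma permutes_increasing_id:
  assumes "\<sigma> permutes {1..n}" and mono: "\<And>k. k \<in> {1..<n} \<Longrightarrow> \<sigma> k < \<sigma> (Suc k)"
  shows "\<sigma> = id"
proof (rule permutes_natset_ge[OF assms(1)], rule ballI)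
  fix i assume "i \<in> {1..n}"
  then have "1 \<le> i" "i \<le> n" by auto
  then show "\<sigma> i \<ge> i"
  proof (induction i rule: dec_induct)
    case base
    then show ?case using permutes_in_iff_atLeastAtMost[OF assms(1), of 1] by simp
  next
    case (step k)
    then show ?case using mono[of k] by simp
  qed
qed

text \<open>Bubble sort: while two consecutive values stand in the wrong order, exchanging them
  removes one inversion; without such a pair the inverse is increasing, hence the identity.\<close>

lemma ex_adj_prod:
  "\<sigma> permutes {1..n} \<Longrightarrow>
    \<exists>ks. set ks \<subseteq> {1..<n} \<and> adj_prod ks = \<sigma> \<and> length ks = card (invs n \<sigma>)"
proof (induction "card (invs n \<sigma>)" arbitrary: \<sigma> rule: less_induct)
  case less
  note p = less.prems
  show ?case
  proof (cases "\<exists>k\<in>{1..<n}. inv \<sigma> (Suc k) < inv \<sigma> k")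
    case True
    then obtain k where k: "k \<in> {1..<n}" "inv \<sigma> (Suc k) < inv \<sigma> k" by blast
    let ?s = "Transposition.transpose k (Suc k)"
    have c: "card (invs n \<sigma>) = Suc (card (invs n (?s \<circ> \<sigma>)))"
      by (rule card_invs_transpose(2)[OF p k])
    obtain ks where ks: "set ks \<subseteq> {1..<n}" "adj_prod ks = ?s \<circ> \<sigma>" "length ks = card (invs n (?s \<circ> \<sigma>))"
      using less.hyps[of "?s \<circ> \<sigma>"] c permutes_compose[OF p transpose_permutes[OF k(1)]] by auto
    then have "adj_prod (k # ks) = \<sigma>" by (simp add: fun_eq_iff adj_prod_simps(2))
    then show ?thesis using ks k c by (intro exI[of _ "k # ks"]) auto
  next
    case False
    then have "inv \<sigma> k < inv \<sigma> (Suc k)" if "k \<in> {1..<n}" for k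
      using inv_neq_Suc[OF p, of k] that by (meson linorder_neqE_nat)
    then have "inv \<sigma> = id" by (intro permutes_increasing_id[OF permutes_inv[OF p]]) auto
    then have "\<sigma> = id" using permutes_inv_inv[OF p] by simp
    then show ?thesis by (intro exI[of _ "[]"]) (simp add: adj_prod_simps(1))
  qed
qed

lemma reduced_expr_length:
  assumes "reduced_expr n \<sigma> ks"
  shows "length ks = card (invs n \<sigma>)"
proof -
  have ks: "set ks \<subseteq> {1..<n}" "adj_prod ks = \<sigma>"
    "\<And>ks'. set ks' \<subseteq> {1..<n} \<Longrightarrow> adj_prod ks' = \<sigma> \<Longrightarrow> length ks \<le> length ks'"
    using assms by (auto simp: reduced_expr_def)
  obtain ks' where "set ks' \<subseteq> {1..<n}" "adj_prod ks' = \<sigma>" "length ks' = card (invs n \<sigma>)"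
    using ex_adj_prod[of \<sigma> n] adj_prod_permutes[OF ks(1)] ks(2) by auto
  then show ?thesis using ks(3)[of ks'] card_invs_adj_prod[OF ks(1)] ks(2) by simp
qed

lemma ex_reduced_expr:
  assumes "\<sigma> permutes {1..n}" shows "\<exists>ks. reduced_expr n \<sigma> ks"
  using ex_adj_prod[OF assms] card_invs_adj_prod unfolding reduced_expr_def by metis

lemma swap_legs_perm_word:
  "k \<in> {1..<length w} \<Longrightarrow> swap_legs k w = perm_word (Transposition.transpose k (Suc k)) w"
  by (rule nth_equalityI)
    (auto simp: swap_legs_def nth_perm_word nth_list_update Transposition.transpose_def)

section \<open>Coordinates of P^(n) as a weighted sum over permutations\<close>

locale aw =
  fixes D :: "('a::euclidean_space, 'i) aw_data"
  assumes aw_setup: "aw_setup D"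
begin

definition qq :: "nat \<Rightarrow> nat \<Rightarrow> complex" where
  "qq a b = of_real (qm D (dg D a) (dg D b))"

text \<open>The entry of \<Phi>(\<sigma>) in the row of w, standing in the column of
  \<open>perm_word \<sigma> w\<close>: one factor q for every crossing.\<close>

definition inv_weight :: "nat \<Rightarrow> (nat \<Rightarrow> nat) \<Rightarrow> nat list \<Rightarrow> complex" where
  "inv_weight n \<sigma> w = (\<Prod>(i, j)\<in>invs n \<sigma>. qq (w ! (\<sigma> i - 1)) (w ! (\<sigma> j - 1)))"

text \<open>In a reduced expression every generator adds exactly one inversion, and the factor q
  that it brings is the weight of that inversion. The condition on the length expresses reducedness;
  cancelling generators would leave squares of q behind.\<close>

lemma foldr_Tleg:
  "set ks \<subseteq> {1..<n} \<Longrightarrow> length ks = card (invs n (adj_prod ks)) \<Longrightarrow> length w = n \<Longrightarrow>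
    foldr (Tleg D) ks f w = inv_weight n (adj_prod ks) w * f (perm_word (adj_prod ks) w)"
proof (induction ks arbitrary: w)
  case Nil
  show ?case unfolding adj_prod_simps invs_id inv_weight_def perm_word_id by simp
next
  case (Cons k ks)
  let ?\<sigma> = "adj_prod ks" and ?s = "Transposition.transpose k (Suc k)"
  have k: "k \<in> {1..<n}" and ks: "set ks \<subseteq> {1..<n}" using Cons.prems by auto
  note p = adj_prod_permutes[OF ks]
  have le: "card (invs n ?\<sigma>) \<le> length ks" by (rule card_invs_adj_prod[OF ks])
  \<comment> \<open>Otherwise prepending k would lower the number of inversions, and the expression
    would be longer than that number.\<close>
  have less: "inv ?\<sigma> k < inv ?\<sigma> (Suc k)"
  proof (rule ccontr)
    assume "\<not> ?thesis"
    then have "inv ?\<sigma> (Suc k) < inv ?\<sigma> k" using inv_neq_Suc[OF p, of k] by linarith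
    from card_invs_transpose(2)[OF p k this] show False
      using le Cons.prems(2) by (simp only: adj_prod_simps(2) list.size)
  qed
  note N = invs_transpose[OF p k less]
  have len: "length ks = card (invs n ?\<sigma>)" 
  proof -
    have "Suc (length ks) = card (invs n (?s \<circ> ?\<sigma>))"
      using Cons.prems(2) by (simp add: adj_prod_simps(2) comp_def)
    then show ?thesis using N by simp
  qed
  define v where "v = swap_legs k w"
  have v: "v = perm_word ?s w" using swap_legs_perm_word[of k w] k Cons.prems(3) by (simp add: v_def)
  then have lv: "length v = n" using Cons.prems by simp
  have vk: "v ! (k - 1) = w ! k" "v ! k = w ! (k - 1)"
    using k Cons.prems(3) by (auto simp: v nth_perm_word Transposition.transpose_def)
  have J: "?\<sigma> (inv ?\<sigma> x) = x" for x by (rule permutes_inverses[OF p])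
  have nth_v: "v ! (?\<sigma> i - 1) = w ! (?s (?\<sigma> i) - 1)" if "i \<in> {1..n}" for i
    using permutes_in_iff_atLeastAtMost[OF p that] unfolding v
    by (subst nth_perm_word') (auto simp: Cons.prems)
  have "inv_weight n (?s \<circ> ?\<sigma>) w = qq (w ! k) (w ! (k - 1)) *
      (\<Prod>(i, j)\<in>invs n ?\<sigma>. qq (w ! ((?s \<circ> ?\<sigma>) i - 1)) (w ! ((?s \<circ> ?\<sigma>) j - 1)))"
    unfolding inv_weight_def N(1) by (subst prod.insert) (use N(2) in \<open>auto simp: J\<close>)
  also have "(\<Prod>(i, j)\<in>invs n ?\<sigma>. qq (w ! ((?s \<circ> ?\<sigma>) i - 1)) (w ! ((?s \<circ> ?\<sigma>) j - 1))) = inv_weight n ?\<sigma> v"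
    unfolding inv_weight_def by (rule prod.cong) (auto simp: nth_v invs_def simp del: One_nat_def)
  finally have W: "inv_weight n (?s \<circ> ?\<sigma>) w = qq (w ! k) (w ! (k - 1)) * inv_weight n ?\<sigma> v" .
  have "foldr (Tleg D) (k # ks) f w = qq (v ! (k - 1)) (v ! k) * foldr (Tleg D) ks f v"
    by (simp add: Tleg_def v_def[symmetric] Let_def qq_def)
  also have "\<dots> = qq (w ! k) (w ! (k - 1)) * (inv_weight n ?\<sigma> v * f (perm_word ?\<sigma> v))"
    unfolding vk Cons.IH[OF ks len lv] ..
  also have "perm_word ?\<sigma> v = perm_word (?s \<circ> ?\<sigma>) w"
    unfolding v using perm_word_comp[of ?\<sigma> w] p Cons.prems(3) by simp
  finally show ?case unfolding adj_prod_simps W by (simp add: comp_def mult.assoc)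
qed

text \<open>The weight depends on \<sigma> alone, so it does not matter which reduced expression the
  choice in \<open>Phi\<close> picks.\<close>

lemma Pn_eq:
  assumes "length w = n"
  shows "Pn D n f w = (\<Sum>\<sigma> | \<sigma> permutes {1..n}. inv_weight n \<sigma> w * f (perm_word \<sigma> w))"
proof -
  have "Phi D n \<sigma> f w = inv_weight n \<sigma> w * f (perm_word \<sigma> w)" if "\<sigma> permutes {1..n}" for \<sigma>
  proof -
    define ks where "ks = (SOME ks. reduced_expr n \<sigma> ks)"
    have ks: "reduced_expr n \<sigma> ks"
      unfolding ks_def by (rule someI_ex) (rule ex_reduced_expr[OF that])
    then have "set ks \<subseteq> {1..<n}" "adj_prod ks = \<sigma>" by (auto simp: reduced_expr_def)
    then show ?thesis
      using foldr_Tleg[of ks n w f] reduced_expr_length[OF ks] assms by (simp add: Phi_def ks_def)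
  qed
  then show ?thesis by (simp add: Pn_def)
qed

end

section \<open>Strict positivity\<close>

text \<open>Each e contributes a 2 x 2 kernel whose rows and columns are labelled by the two values
  of \<open>\<epsilon> e\<close>; the product over E is the Schur product of their pullbacks to
  I.\<close>

definition kform :: "'e set \<Rightarrow> ('e \<Rightarrow> real) \<Rightarrow> ('e \<Rightarrow> 'j \<Rightarrow> bool) \<Rightarrow> 'j set \<Rightarrow> ('j \<Rightarrow> complex) \<Rightarrow> complex" where
  "kform E q \<epsilon> I F = (\<Sum>i\<in>I. \<Sum>j\<in>I. cnj (F i) * F j *
     (\<Prod>e\<in>E. if \<epsilon> e i \<noteq> \<epsilon> e j then of_real (q e) else 1))"

lemma kform_restrict:
  assumes "finite I"
  shows "kform E q \<epsilon> {i \<in> I. P i} F = (\<Sum>i\<in>I. \<Sum>j\<in>I. if P i \<and> P j then cnj (F i) * F j *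
     (\<Prod>e\<in>E. if \<epsilon> e i \<noteq> \<epsilon> e j then of_real (q e) else 1) else 0)"
  unfolding kform_def using assms
  by (simp add: sum.inter_filter if_distrib[of "\<lambda>x. sum x _"] cong: if_cong)
     (auto intro!: sum.cong)

text \<open>The kernel matrix of one pair splits as
  \<open>[[1, q], [q, 1]] = (1 - |q|) I + |q| s s\<^sup>T\<close> with \<open>s = (1, \<plusminus>1)\<close>.\<close>

lemma kform_insert:
  assumes "finite I" "finite E" "e \<notin> E"
  shows "kform (insert e E) q \<epsilon> I F =
    of_real (1 - \<bar>q e\<bar>) * (kform E q \<epsilon> {i \<in> I. \<epsilon> e i} F + kform E q \<epsilon> {i \<in> I. \<not> \<epsilon> e i} F)
    + of_real \<bar>q e\<bar> * kform E q \<epsilon> I (\<lambda>i. if \<epsilon> e i then F i else (if q e < 0 then - F i else F i))"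
  unfolding kform_restrict[OF assms(1)] unfolding kform_def sum_distrib_left distrib_left
    sum.distrib[symmetric]
  using assms(2,3) by (intro sum.cong refl; cases "q e < 0") (auto simp: algebra_simps)

lemma kform_nonneg:
  assumes "finite E" "finite I" "\<And>e. e \<in> E \<Longrightarrow> \<bar>q e\<bar> \<le> 1"
  shows "0 \<le> Re (kform E q \<epsilon> I F)"
  using assms
proof (induction E arbitrary: I F rule: finite_induct)
  case empty
  have "kform {} q \<epsilon> I F = cnj (\<Sum>i\<in>I. F i) * (\<Sum>j\<in>I. F j)"
    unfolding kform_def cnj_sum sum_product by simp
  also have "\<dots> = of_real ((cmod (\<Sum>i\<in>I. F i))\<^sup>2)"
    by (metis complex_norm_square mult.commute of_real_power)
  finally show ?case by simp
next
  case (insert e E)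
  have "0 \<le> Re (kform E q \<epsilon> J G)" if "J \<subseteq> I" for J G
    using insert.IH[of J G] insert.prems finite_subset[OF that] by auto
  moreover have "\<bar>q e\<bar> \<le> 1" using insert.prems by auto
  ultimately show ?case
    unfolding kform_insert[OF insert.prems(1) insert.hyps]
    by (auto intro!: add_nonneg_nonneg mult_nonneg_nonneg)
qed

text \<open>From each kernel only the diagonal part (1 - |q|) I is kept; the rest is nonnegative. It
  cuts the index set into the two classes of \<open>\<epsilon> e\<close>. As the family separates
  points, single points remain after all cuts, and there the form is |F|^2.\<close>

lemma kform_ge:
  assumes "finite E" "finite I" "\<And>e. e \<in> E \<Longrightarrow> \<bar>q e\<bar> \<le> r" "r < 1"
    and "\<And>i j. i \<in> I \<Longrightarrow> j \<in> I \<Longrightarrow> i \<noteq> j \<Longrightarrow> \<exists>e\<in>E. \<epsilon> e i \<noteq> \<epsilon> e j"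
  shows "(1 - r) ^ card E * (\<Sum>i\<in>I. (cmod (F i))\<^sup>2) \<le> Re (kform E q \<epsilon> I F)"
  using assms(1-3,5)
proof (induction E arbitrary: I rule: finite_induct)
  case empty
  have "I = {} \<or> (\<exists>i. I = {i})" using empty.prems(3) by blast
  then show ?case
    by (auto simp: kform_def cmod_power2) (simp add: power2_eq_square)
next
  case (insert e E)
  let ?I = "{i \<in> I. \<epsilon> e i}" and ?J = "{i \<in> I. \<not> \<epsilon> e i}"
  have q: "\<bar>q e\<bar> \<le> r" using insert.prems by auto
  have 1: "(1 - r) ^ card E * (\<Sum>i\<in>?I. (cmod (F i))\<^sup>2) \<le> Re (kform E q \<epsilon> ?I F)"
    using insert.prems by (intro insert.IH) fastforce+
  have 2: "(1 - r) ^ card E * (\<Sum>i\<in>?J. (cmod (F i))\<^sup>2) \<le> Re (kform E q \<epsilon> ?J F)"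
    using insert.prems by (intro insert.IH) fastforce+
  have 3: "0 \<le> Re (kform E q \<epsilon> I (\<lambda>i. if \<epsilon> e i then F i else (if q e < 0 then - F i else F i)))"
    using insert assms(4) by (intro kform_nonneg) fastforce+
  have "I = ?I \<union> ?J" "?I \<inter> ?J = {}" by auto
  then have split: "(\<Sum>i\<in>I. (cmod (F i))\<^sup>2) = (\<Sum>i\<in>?I. (cmod (F i))\<^sup>2) + (\<Sum>i\<in>?J. (cmod (F i))\<^sup>2)"
    using insert.prems(1) sum.union_disjoint[of ?I ?J "\<lambda>i. (cmod (F i))\<^sup>2"] by simp
  have "(1 - r) ^ card (insert e E) * (\<Sum>i\<in>I. (cmod (F i))\<^sup>2) =
      (1 - r) * ((1 - r) ^ card E * (\<Sum>i\<in>?I. (cmod (F i))\<^sup>2) + (1 - r) ^ card E * (\<Sum>i\<in>?J. (cmod (F i))\<^sup>2))"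
    using insert.hyps unfolding split by (simp add: algebra_simps)
  also have "\<dots> \<le> (1 - \<bar>q e\<bar>) * (Re (kform E q \<epsilon> ?I F) + Re (kform E q \<epsilon> ?J F))"
    using q assms(4) 1 2 by (intro mult_mono add_mono add_nonneg_nonneg mult_nonneg_nonneg sum_nonneg) auto
  also have "\<dots> \<le> Re (kform (insert e E) q \<epsilon> I F)"
    unfolding kform_insert[OF insert.prems(1) insert.hyps] using 3 by simp
  finally show ?case .
qed

section \<open>Permutations and the order they give to pairs\<close>

definition pairs :: "nat \<Rightarrow> (nat \<times> nat) set" where
  "pairs n = {(a, b). 1 \<le> a \<and> a < b \<and> b \<le> n}"

lemma finite_pairs [simp]: "finite (pairs n)"
  by (rule finite_subset[of _ "{1..n} \<times> {1..n}"]) (auto simp: pairs_def)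

text \<open>\<open>perm_word \<tau>\<close> moves the letter at place a to place
  \<open>inv \<tau> a\<close>, so this asks which of two places of the original word comes first
  after rearrangement.\<close>

definition before :: "nat \<times> nat \<Rightarrow> (nat \<Rightarrow> nat) \<Rightarrow> bool" where
  "before e \<tau> \<longleftrightarrow> inv \<tau> (fst e) < inv \<tau> (snd e)"

text \<open>If both permutations order all pairs of values alike,
  \<open>inv \<tau> \<circ> \<rho>\<close> is increasing, hence the identity.\<close>

lemma before_separates:
  assumes "\<tau> permutes {1..n}" "\<rho> permutes {1..n}"
    and same: "\<And>e. e \<in> pairs n \<Longrightarrow> before e \<tau> = before e \<rho>"
  shows "\<tau> = \<rho>"
proof -
  have "inv \<tau> \<circ> \<rho> = id"
  proof (rule permutes_increasing_id)
    show "inv \<tau> \<circ> \<rho> permutes {1..n}"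
      using assms(1,2) by (intro permutes_compose permutes_inv)
    fix k assume k: "k \<in> {1..<n}"
    have R: "\<rho> k \<in> {1..n}" "\<rho> (Suc k) \<in> {1..n}" 
      using k permutes_in_iff_atLeastAtMost[OF assms(2)] by auto
    have I: "inv \<rho> (\<rho> x) = x" for x using permutes_inverses[OF assms(2)] by simp
    have ne: "\<rho> k \<noteq> \<rho> (Suc k)" by (metis I n_not_Suc_n)
    have ne': "inv \<tau> (\<rho> k) \<noteq> inv \<tau> (\<rho> (Suc k))" using permutes_inverses[OF assms(1)] ne by metis
    show "(inv \<tau> \<circ> \<rho>) k < (inv \<tau> \<circ> \<rho>) (Suc k)"
    proof (cases "\<rho> k < \<rho> (Suc k)")
      case True
      then show ?thesis
        using same[of "(\<rho> k, \<rho> (Suc k))"] R by (simp add: pairs_def before_def I)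
    next
      case False
      then have "\<rho> (Suc k) < \<rho> k" using ne by simp
      then show ?thesis
        using same[of "(\<rho> (Suc k), \<rho> k)"] R ne' by (simp add: pairs_def before_def I)
    qed
  qed
  then have "\<tau> (inv \<tau> (\<rho> x)) = \<tau> x" for x by (metis comp_apply id_apply)
  then show ?thesis using permutes_inverses(1)[OF assms(1)] by auto
qed

lemma finite_permutes [simp]: "finite {\<sigma>. \<sigma> permutes {1..n::nat}}"
  by (simp add: finite_permutations)

lemma card_permutes: "card {\<sigma>. \<sigma> permutes {1..n::nat}} = fact n"
  using card_permutations[of "{1..n}" n] by simp

section \<open>The deformed form on n-tensors\<close>

abbreviation letters :: "('a::euclidean_space, 'i) aw_data \<Rightarrow> nat set" where
  "letters D \<equiv> {1..DIM('a)}"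

context aw begin


abbreviation fm :: "nat \<Rightarrow> fvec \<Rightarrow> fvec \<Rightarrow> complex" where "fm \<equiv> ipT_deg D"

lemma finite_words [simp]: "finite (words D n)"
  using finite_lists_length_eq[of "letters D" n] by (simp add: words_def conj_commute)

lemma words_0 [simp]: "words D 0 = {[]}"
  by (auto simp: words_def)

lemma words_length: "w \<in> words D n \<Longrightarrow> length w = n"
  by (simp add: words_def)

lemma Cons_words [simp]: "a # w \<in> words D (Suc n) \<longleftrightarrow> a \<in> letters D \<and> w \<in> words D n"
  by (auto simp: words_def)

lemma sum_words_Suc: "(\<Sum>w\<in>words D (Suc n). F w) = (\<Sum>a\<in>letters D. \<Sum>w\<in>words D n. F (a # w))"
proof -
  have "words D (Suc n) = (\<lambda>(a, w). a # w) ` (letters D \<times> words D n)"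
    by (auto simp: words_def length_Suc_conv image_iff)
  then have "(\<Sum>w\<in>words D (Suc n). F w) = (\<Sum>(a, w)\<in>letters D \<times> words D n. F (a # w))"
    by (simp add: sum.reindex inj_on_def split_def)
  then show ?thesis by (simp add: sum.cartesian_product)
qed

lemma perm_word_words:
  assumes "\<sigma> permutes {1..n}" "w \<in> words D n" shows "perm_word \<sigma> w \<in> words D n"
proof -
  have "set (perm_word \<sigma> w) \<subseteq> set w"
  proof
    fix x assume "x \<in> set (perm_word \<sigma> w)"
    then obtain i where i: "i < length w" "x = perm_word \<sigma> w ! i" by (auto simp: in_set_conv_nth)
    have "\<sigma> (Suc i) \<in> {1..n}"
      using permutes_in_iff_atLeastAtMost[OF assms(1), of "Suc i"] i words_length[OF assms(2)] by simp
    then show "x \<in> set w" using i words_length[OF assms(2)] by (auto simp: nth_perm_word)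
  qed
  then show ?thesis using assms(2) by (auto simp: words_def)
qed

lemma sum_perm_word:
  assumes "\<sigma> permutes {1..n}"
  shows "(\<Sum>w\<in>words D n. F (perm_word \<sigma> w)) = (\<Sum>w\<in>words D n. F w)"
proof (rule sum.reindex_bij_witness[of _ "perm_word (inv \<sigma>)" "perm_word \<sigma>"])
  note p = permutes_inv[OF assms]
  fix w assume w: "w \<in> words D n"
  show "perm_word (inv \<sigma>) (perm_word \<sigma> w) = w" "perm_word \<sigma> (perm_word (inv \<sigma>) w) = w"
    using perm_word_comp[of \<sigma> w "inv \<sigma>"] perm_word_comp[of "inv \<sigma>" w \<sigma>] assms p words_length[OF w]
    by (simp_all add: permutes_inv_o[OF assms])
  show "perm_word \<sigma> w \<in> words D n" "perm_word (inv \<sigma>) w \<in> words D n" using perm_word_words assms p w by auto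
qed auto

text \<open>The entry 1/2 makes the set nonempty and the maximum strictly positive; the cube root in
  \<open>cubic_geometric_tendsto_0\<close> relies on the latter.\<close>

definition qmax :: real where
  "qmax = Max (insert (1/2) ((\<lambda>(i, j). \<bar>qm D i j\<bar>) ` (inds D \<times> inds D)))"

lemma finite_inds: "finite (inds D)"
  using aw_setup by (simp add: aw_setup_def)

lemma dg_inds: "k \<in> letters D \<Longrightarrow> dg D k \<in> inds D"
  using aw_setup by (simp add: aw_setup_def)

lemma qm_bound: "i \<in> inds D \<Longrightarrow> j \<in> inds D \<Longrightarrow> \<bar>qm D i j\<bar> < 1"
  using aw_setup by (auto simp: aw_setup_def abs_less_iff)

lemma qm_sym: "i \<in> inds D \<Longrightarrow> j \<in> inds D \<Longrightarrow> qm D i j = qm D j i"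
  using aw_setup by (simp add: aw_setup_def)

lemma qmax_bounds: "0 < qmax" "qmax < 1"
proof -
  have fin: "finite (insert (1/2) ((\<lambda>(i, j). \<bar>qm D i j\<bar>) ` (inds D \<times> inds D)))"
    using finite_inds by simp
  show "0 < qmax" unfolding qmax_def using Max_ge[OF fin, of "1/2"] by simp
  show "qmax < 1" unfolding qmax_def by (subst Max_less_iff) (use fin qm_bound in auto)
qed

lemma qm_le_qmax: "a \<in> letters D \<Longrightarrow> b \<in> letters D \<Longrightarrow> \<bar>qm D (dg D a) (dg D b)\<bar> \<le> qmax"
  unfolding qmax_def using finite_inds dg_inds[of a] dg_inds[of b] by (intro Max_ge) auto

lemma norm_qq: "a \<in> letters D \<Longrightarrow> b \<in> letters D \<Longrightarrow> norm (qq a b) \<le> qmax"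
  using qm_le_qmax by (simp add: qq_def)

lemma qq_sym: "a \<in> letters D \<Longrightarrow> b \<in> letters D \<Longrightarrow> qq a b = qq b a"
  using qm_sym[OF dg_inds dg_inds] by (simp add: qq_def)

lemma cnj_qq [simp]: "cnj (qq a b) = qq a b"
  by (simp add: qq_def)

lemma nth_words: "w \<in> words D n \<Longrightarrow> i \<in> {1..n} \<Longrightarrow> w ! (i - 1) \<in> letters D"
  by (auto simp: words_def intro!: nth_mem dest!: subsetD)

definition ker :: "nat \<Rightarrow> nat list \<Rightarrow> (nat \<Rightarrow> nat) \<Rightarrow> (nat \<Rightarrow> nat) \<Rightarrow> complex" where
  "ker n w \<tau> \<rho> = (\<Prod>e\<in>pairs n. if before e \<tau> \<noteq> before e \<rho>
     then of_real (qm D (dg D (w ! (fst e - 1))) (dg D (w ! (snd e - 1)))) else 1)"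

lemma ker_sym: "ker n w \<tau> \<rho> = ker n w \<rho> \<tau>"
  unfolding ker_def by (intro prod.cong) auto

text \<open>With \<open>\<rho> = \<tau> \<circ> \<sigma>\<close>, an inversion (i, j) of \<sigma> is
  a pair of places \<open>\<rho> i\<close>, \<open>\<rho> j\<close> of w that \<tau> and \<rho> put
  in opposite orders. The bijection has to sort these two numbers, which is harmless since q is
  symmetric.\<close>

lemma inv_weight_perm_word:
  assumes \<tau>: "\<tau> permutes {1..n}" and \<sigma>: "\<sigma> permutes {1..n}" and w: "w \<in> words D n"
  shows "inv_weight n \<sigma> (perm_word \<tau> w) = ker n w \<tau> (\<tau> \<circ> \<sigma>)"
proof -
  define \<rho> where "\<rho> = \<tau> \<circ> \<sigma>"
  have \<rho>: "\<rho> permutes {1..n}" unfolding \<rho>_def by (rule permutes_compose[OF \<sigma> \<tau>])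
  have I: "inv \<rho> (\<rho> x) = x" "\<rho> (inv \<rho> x) = x" for x using permutes_inverses[OF \<rho>] by auto
  have I': "inv \<tau> (\<rho> x) = \<sigma> x" "inv \<tau> x = \<sigma> (inv \<rho> x)" for x
    using permutes_inverses[OF \<tau>] I unfolding \<rho>_def by (auto, metis comp_apply)
  have R: "\<rho> x \<in> {1..n}" "inv \<rho> x \<in> {1..n}" if "x \<in> {1..n}" for x
    using permutes_in_iff_atLeastAtMost[OF \<rho> that]
      permutes_in_iff_atLeastAtMost[OF permutes_inv[OF \<rho>] that] by auto
  have \<rho>eq: "\<rho> x = \<rho> y \<longleftrightarrow> x = y" for x y by (metis I(1))
  have nth: "perm_word \<tau> w ! (\<sigma> i - 1) = w ! (\<rho> i - 1)" if "i \<in> {1..n}" for i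
    using permutes_in_iff_atLeastAtMost[OF \<sigma> that] words_length[OF w] by (simp add: nth_perm_word' \<rho>_def del: One_nat_def)
  let ?M = "{e \<in> pairs n. before e \<tau> \<noteq> before e \<rho>}"
  have "ker n w \<tau> \<rho> = (\<Prod>e\<in>?M. qq (w ! (fst e - 1)) (w ! (snd e - 1)))"
    unfolding ker_def qq_def by (subst prod.inter_filter) simp_all
  also have "inv_weight n \<sigma> (perm_word \<tau> w) = \<dots>"
    unfolding inv_weight_def
  proof (rule prod.reindex_bij_witness[of _
        "\<lambda>(a, b). if inv \<rho> a < inv \<rho> b then (inv \<rho> a, inv \<rho> b) else (inv \<rho> b, inv \<rho> a)"
        "\<lambda>(i, j). if \<rho> i < \<rho> j then (\<rho> i, \<rho> j) else (\<rho> j, \<rho> i)"])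
    fix e assume e: "e \<in> invs n \<sigma>"
    obtain i j where ij: "e = (i, j)" by force
    with e have *: "i \<in> {1..n}" "j \<in> {1..n}" "i < j" "\<sigma> j < \<sigma> i" by (auto simp: invs_def)
    let ?f = "\<lambda>(i, j). if \<rho> i < \<rho> j then (\<rho> i, \<rho> j) else (\<rho> j, \<rho> i)"
    show "(\<lambda>(a, b). if inv \<rho> a < inv \<rho> b then (inv \<rho> a, inv \<rho> b) else (inv \<rho> b, inv \<rho> a)) (?f e) = e"
      using * by (simp add: ij I)
    show "?f e \<in> ?M"
      using * R[of i] R[of j] \<rho>eq[of i j] by (auto simp: ij pairs_def before_def I I' )
    have "qq (w ! (\<rho> i - 1)) (w ! (\<rho> j - 1)) = qq (w ! (\<rho> j - 1)) (w ! (\<rho> i - 1))"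
      using * R by (intro qq_sym nth_words[OF w]) auto
    then show "qq (w ! (fst (?f e) - 1)) (w ! (snd (?f e) - 1)) =
        (case e of (i, j) \<Rightarrow> qq (perm_word \<tau> w ! (\<sigma> i - 1)) (perm_word \<tau> w ! (\<sigma> j - 1)))"
      using * by (simp add: ij nth del: One_nat_def)
  next
    fix e assume e: "e \<in> ?M"
    obtain a b where ab: "e = (a, b)" by force
    with e have *: "a \<in> {1..n}" "b \<in> {1..n}" "a < b" 
      "(\<sigma> (inv \<rho> a) < \<sigma> (inv \<rho> b)) \<noteq> (inv \<rho> a < inv \<rho> b)"
      by (auto simp: pairs_def before_def I')
    let ?g = "\<lambda>(a, b). if inv \<rho> a < inv \<rho> b then (inv \<rho> a, inv \<rho> b) else (inv \<rho> b, inv \<rho> a)"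
    have ne: "inv \<rho> a \<noteq> inv \<rho> b" using * by (metis I(2) less_irrefl)
    show "(\<lambda>(i, j). if \<rho> i < \<rho> j then (\<rho> i, \<rho> j) else (\<rho> j, \<rho> i)) (?g e) = e"
      using * by (simp add: ab I)
    have ne': "\<sigma> (inv \<rho> a) \<noteq> \<sigma> (inv \<rho> b)" using ne by (metis I'(2) \<tau> permutes_inv_inv bij_betw_imp_inj_on bij_is_inj inj_def permutes_bij permutes_inv I(2) *(3) less_irrefl)
    show "?g e \<in> invs n \<sigma>"
      using * ne ne' R[of a] R[of b] by (auto simp: ab invs_def)
  qed
  finally show ?thesis by (simp add: \<rho>_def)
qed

text \<open>Every \<tau> permutes the words of length n, so the outer word may be replaced by each
  of its rearrangements. The n! copies together are symmetric in \<tau> and \<rho>, and for fixed w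
  they form a \<open>kform\<close> on the permutations.\<close>

lemma fm_sym:
  "fact n * fm n f g = (\<Sum>w\<in>words D n. \<Sum>\<tau> | \<tau> permutes {1..n}. \<Sum>\<rho> | \<rho> permutes {1..n}.
     cnj (f (perm_word \<tau> w)) * g (perm_word \<rho> w) * ker n w \<tau> \<rho>)"
proof -
  let ?S = "{\<sigma>. \<sigma> permutes {1..n}}"
  have "fact n * fm n f g = (\<Sum>\<tau>\<in>?S. \<Sum>w\<in>words D n. cnj (f w) * Pn D n g w)"
    by (simp add: ipT_deg_def card_permutes[simplified])
  also have "\<dots> = (\<Sum>\<tau>\<in>?S. \<Sum>w\<in>words D n. cnj (f (perm_word \<tau> w)) * Pn D n g (perm_word \<tau> w))"
    by (intro sum.cong refl sum_perm_word[symmetric]) auto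
  also have "\<dots> = (\<Sum>\<tau>\<in>?S. \<Sum>w\<in>words D n. \<Sum>\<rho>\<in>?S. cnj (f (perm_word \<tau> w)) * g (perm_word \<rho> w) * ker n w \<tau> \<rho>)"
  proof (intro sum.cong refl)
    fix \<tau> w assume "\<tau> \<in> ?S" and w: "w \<in> words D n"
    then have \<tau>: "\<tau> permutes {1..n}" by simp
    have "Pn D n g (perm_word \<tau> w) = (\<Sum>\<sigma>\<in>?S. inv_weight n \<sigma> (perm_word \<tau> w) * g (perm_word \<sigma> (perm_word \<tau> w)))"
      by (rule Pn_eq) (simp add: words_length[OF w])
    also have "\<dots> = (\<Sum>\<sigma>\<in>?S. ker n w \<tau> (\<tau> \<circ> \<sigma>) * g (perm_word (\<tau> \<circ> \<sigma>) w))"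
      using inv_weight_perm_word[OF \<tau> _ w] perm_word_comp[of _ w \<tau>] words_length[OF w] by (intro sum.cong) auto
    also have "\<dots> = (\<Sum>\<rho>\<in>?S. ker n w \<tau> \<rho> * g (perm_word \<rho> w))"
      by (rule setum_permutations_compose_left[OF \<tau>, symmetric])
    finally show "cnj (f (perm_word \<tau> w)) * Pn D n g (perm_word \<tau> w) =
        (\<Sum>\<rho>\<in>?S. cnj (f (perm_word \<tau> w)) * g (perm_word \<rho> w) * ker n w \<tau> \<rho>)"
      by (simp add: sum_distrib_left mult_ac)
  qed
  also have "\<dots> = (\<Sum>w\<in>words D n. \<Sum>\<tau>\<in>?S. \<Sum>\<rho>\<in>?S. cnj (f (perm_word \<tau> w)) * g (perm_word \<rho> w) * ker n w \<tau> \<rho>)"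
    by (rule sum.swap)
  finally show ?thesis .
qed

lemma fm_cnj: "fm n f g = cnj (fm n g f)"
proof -
  have "fact n * fm n f g = cnj (fact n * fm n g f)"
    unfolding fm_sym cnj_sum
  proof (rule sum.cong[OF refl])
    fix w
    have c: "cnj (ker n w \<tau> \<rho>) = ker n w \<rho> \<tau>" for \<tau> \<rho>
      unfolding ker_sym[of n w \<rho> \<tau>] unfolding ker_def cnj_prod by (intro prod.cong) auto
    show "(\<Sum>\<tau> | \<tau> permutes {1..n}. \<Sum>\<rho> | \<rho> permutes {1..n}. cnj (f (perm_word \<tau> w)) * g (perm_word \<rho> w) * ker n w \<tau> \<rho>) =
      (\<Sum>\<tau> | \<tau> permutes {1..n}. \<Sum>\<rho> | \<rho> permutes {1..n}. cnj (cnj (g (perm_word \<tau> w)) * f (perm_word \<rho> w) * ker n w \<tau> \<rho>))"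
      by (subst sum.swap) (simp add: c mult_ac)
  qed
  then show ?thesis by simp
qed

lemma fm_ge: "(1 - qmax) ^ card (pairs n) * (\<Sum>w\<in>words D n. (cmod (f w))\<^sup>2) \<le> Re (fm n f f)"
proof -
  let ?S = "{\<sigma>. \<sigma> permutes {1..n}}"
  let ?k = "\<lambda>w. kform (pairs n) (\<lambda>e. qm D (dg D (w ! (fst e - 1))) (dg D (w ! (snd e - 1)))) before ?S (\<lambda>\<tau>. f (perm_word \<tau> w))"
  let ?c = "(1 - qmax) ^ card (pairs n)"
  have "fact n * fm n f f = (\<Sum>w\<in>words D n. ?k w)"
    unfolding fm_sym kform_def ker_def ..
  then have "Re (complex_of_real (fact n) * fm n f f) = (\<Sum>w\<in>words D n. Re (?k w))"
    by (simp only: Re_sum of_real_fact)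
  then have "fact n * Re (fm n f f) = (\<Sum>w\<in>words D n. Re (?k w))"
    by (simp only: Re_complex_of_real Im_complex_of_real times_complex.simps mult_zero_left diff_zero)
  also have "\<dots> \<ge> (\<Sum>w\<in>words D n. ?c * (\<Sum>\<tau>\<in>?S. (cmod (f (perm_word \<tau> w)))\<^sup>2))"
  proof (intro sum_mono kform_ge)
    fix w e assume "w \<in> words D n" "e \<in> pairs n"
    then show "\<bar>qm D (dg D (w ! (fst e - 1))) (dg D (w ! (snd e - 1)))\<bar> \<le> qmax"
      by (intro qm_le_qmax nth_words) (auto simp: pairs_def)
  next
    fix \<tau> \<rho> assume "\<tau> \<in> ?S" "\<rho> \<in> ?S" "\<tau> \<noteq> \<rho>"
    then show "\<exists>e\<in>pairs n. before e \<tau> \<noteq> before e \<rho>" using before_separates[of \<tau> n \<rho>] by blast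
  qed (use qmax_bounds finite_permutes in \<open>simp_all del: One_nat_def\<close>)
  also have "(\<Sum>w\<in>words D n. ?c * (\<Sum>\<tau>\<in>?S. (cmod (f (perm_word \<tau> w)))\<^sup>2)) =
      ?c * (\<Sum>\<tau>\<in>?S. \<Sum>w\<in>words D n. (cmod (f (perm_word \<tau> w)))\<^sup>2)"
    by (simp add: sum_distrib_left) (rule sum.swap)
  also have "(\<Sum>\<tau>\<in>?S. \<Sum>w\<in>words D n. (cmod (f (perm_word \<tau> w)))\<^sup>2) = (\<Sum>\<tau>\<in>?S. \<Sum>w\<in>words D n. (cmod (f w))\<^sup>2)"
    by (intro sum.cong refl sum_perm_word) auto
  also have "\<dots> = fact n * (\<Sum>w\<in>words D n. (cmod (f w))\<^sup>2)"
    by (simp add: card_permutes del: One_nat_def)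
  finally show ?thesis by (simp add: mult.left_commute)
qed

end

section \<open>Recursion for \<open>P\<^bsup>(n)\<^esup>\<close>\<close>

definition skip :: "nat \<Rightarrow> nat \<Rightarrow> nat" where
  "skip p i = (if i < p then i else Suc i)"

text \<open>Coset decomposition of the symmetric group on n + 1 places: place p carries the value 1,
  and \<sigma> acts on the remaining places and values, renumbered by \<open>skip p\<close> and
  \<open>Suc\<close>.\<close>

definition ins_one :: "nat \<Rightarrow> nat \<Rightarrow> (nat \<Rightarrow> nat) \<Rightarrow> nat \<Rightarrow> nat" where
  "ins_one n p \<sigma> i = (if i \<in> {1..Suc n}
     then (if i < p then Suc (\<sigma> i) else if i = p then 1 else Suc (\<sigma> (i - 1))) else i)"

lemma ins_one_skip:
  "i \<in> {1..n} \<Longrightarrow> p \<in> {1..Suc n} \<Longrightarrow> ins_one n p \<sigma> (skip p i) = Suc (\<sigma> i)"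
  by (auto simp: ins_one_def skip_def)

lemma ins_one_p: "p \<in> {1..Suc n} \<Longrightarrow> ins_one n p \<sigma> p = 1"
  by (auto simp: ins_one_def)

lemma skip_cases:
  assumes "i \<in> {1..Suc n}" "p \<in> {1..Suc n}"
  obtains "i = p" | j where "j \<in> {1..n}" "i = skip p j"
proof (cases "i = p")
  case False
  show ?thesis
  proof (cases "i < p")
    case True
    then show ?thesis using that(2)[of i] assms by (auto simp: skip_def)
  next
    case f: False
    show ?thesis by (rule that(2)[of "i - 1"]) (use f assms False in \<open>auto simp: skip_def\<close>)
  qed
qed (rule that(1))

lemma skip_less [simp]: "skip p i < skip p j \<longleftrightarrow> i < j"
  by (auto simp: skip_def)

lemma skip_eq [simp]: "skip p i = skip p j \<longleftrightarrow> i = j"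
  by (auto simp: skip_def)

lemma skip_neq [simp]: "skip p i \<noteq> p" "p \<noteq> skip p i"
  by (auto simp: skip_def)

lemma skip_less_p [simp]: "skip p i < p \<longleftrightarrow> i < p" "p < skip p i \<longleftrightarrow> p \<le> i"
  by (auto simp: skip_def)

lemma skip_range: "i \<in> {1..n} \<Longrightarrow> skip p i \<in> {1..Suc n}"
  by (auto simp: skip_def)

lemma ins_one_permutes:
  assumes \<sigma>: "\<sigma> permutes {1..n}" and p: "p \<in> {1..Suc n}"
  shows "ins_one n p \<sigma> permutes {1..Suc n}"
proof (rule bij_imp_permutes)
  let ?f = "ins_one n p \<sigma>"
  have inj\<sigma>: "\<sigma> i = \<sigma> j \<longleftrightarrow> i = j" for i j
    using permutes_inj[OF \<sigma>] by (auto simp: inj_def)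
  have r: "\<sigma> j \<in> {1..n}" if "j \<in> {1..n}" for j by (rule permutes_in_iff_atLeastAtMost[OF \<sigma> that])
  have "inj_on ?f {1..Suc n}"
  proof (rule inj_onI)
    fix i j assume i: "i \<in> {1..Suc n}" and j: "j \<in> {1..Suc n}" and e: "?f i = ?f j"
    from i p show "i = j"
    proof (cases rule: skip_cases)
      case i: 1
      from j p show ?thesis
      proof (cases rule: skip_cases)
        case 1
        then show ?thesis using i by simp
      next
        case (2 j')
        then show ?thesis using e r[of j'] unfolding i 2 ins_one_p[OF p] ins_one_skip[OF 2(1) p] by simp
      qed
    next
      case i: (2 i')
      from j p show ?thesis
      proof (cases rule: skip_cases)
        case 1
        then show ?thesis using e r[OF i(1)] unfolding i(2) 1 ins_one_p[OF p] ins_one_skip[OF i(1) p] by simp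
      next
        case (2 j')
        then show ?thesis using e unfolding i(2) 2(2) ins_one_skip[OF i(1) p] ins_one_skip[OF 2(1) p] by (simp add: inj\<sigma>)
      qed
    qed
  qed
  moreover have "?f ` {1..Suc n} \<subseteq> {1..Suc n}"
  proof
    fix y assume "y \<in> ?f ` {1..Suc n}"
    then obtain i where i: "i \<in> {1..Suc n}" "y = ?f i" by blast
    from i(1) p show "y \<in> {1..Suc n}"
    proof (cases rule: skip_cases)
      case 1
      then show ?thesis using i(2) ins_one_p[OF p] by simp
    next
      case (2 j)
      then show ?thesis using i(2) ins_one_skip[OF 2(1) p] r[OF 2(1)] by simp
    qed
  qed
  ultimately show "bij_betw ?f {1..Suc n} {1..Suc n}"
    by (simp add: bij_betw_def endo_inj_surj)
qed (auto simp: ins_one_def)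

text \<open>Injectivity suffices, both sides having (n + 1) n! elements.\<close>

lemma bij_ins_one:
  "bij_betw (\<lambda>(p, \<sigma>). ins_one n p \<sigma>) ({1..Suc n} \<times> {\<sigma>. \<sigma> permutes {1..n}}) {\<sigma>. \<sigma> permutes {1..Suc n}}"
proof -
  let ?A = "{1..Suc n} \<times> {\<sigma>. \<sigma> permutes {1..n}}" and ?f = "\<lambda>(p, \<sigma>). ins_one n p \<sigma>"
  have inj: "inj_on ?f ?A"
  proof (rule inj_onI, clarify)
    fix p \<sigma> p' \<sigma>'
    assume p: "p \<in> {1..Suc n}" and p': "p' \<in> {1..Suc n}"
      and \<sigma>: "\<sigma> permutes {1..n}" and \<sigma>': "\<sigma>' permutes {1..n}"
      and e: "ins_one n p \<sigma> = ins_one n p' \<sigma>'"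
    have pp: "p = p'"
    proof -
      have "ins_one n p' \<sigma>' p = 1" using ins_one_p[OF p, of \<sigma>] e by simp
      with p p' show ?thesis
        by (cases rule: skip_cases[OF p p'])
          (use permutes_in_iff_atLeastAtMost[OF \<sigma>'] in \<open>force simp: ins_one_skip simp del: One_nat_def\<close>)+
    qed
    have "\<sigma> i = \<sigma>' i" for i
    proof (cases "i \<in> {1..n}")
      case True
      then show ?thesis using fun_cong[OF e, of "skip p i"] p p' by (simp add: ins_one_skip pp del: One_nat_def)
    next
      case False
      then show ?thesis using permutes_not_in[OF \<sigma> False] permutes_not_in[OF \<sigma>' False] by simp
    qed
    then show "p = p' \<and> \<sigma> = \<sigma>'" using pp by blast
  qed
  have "?f ` ?A \<subseteq> {\<sigma>. \<sigma> permutes {1..Suc n}}" using ins_one_permutes by auto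
  moreover have "card (?f ` ?A) = card {\<sigma>. \<sigma> permutes {1..Suc n}}"
    by (subst card_image[OF inj]) (simp add: card_cartesian_product card_permutes del: One_nat_def)
  ultimately have "?f ` ?A = {\<sigma>. \<sigma> permutes {1..Suc n}}"
    by (intro card_subset_eq finite_permutes)
  then show ?thesis using inj by (simp add: bij_betw_def)
qed

text \<open>The value 1 is the least, so it forms an inversion with exactly the places before p;
  every other inversion comes from \<sigma>.\<close>

lemma invs_ins_one:
  assumes \<sigma>: "\<sigma> permutes {1..n}" and p: "p \<in> {1..Suc n}"
  shows "invs (Suc n) (ins_one n p \<sigma>) =
    (\<lambda>i. (i, p)) ` {1..<p} \<union> (\<lambda>(i, j). (skip p i, skip p j)) ` invs n \<sigma>" (is "?L = ?A \<union> ?B")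
proof (intro set_eqI iffI)
  have r: "\<sigma> j \<in> {1..n}" if "j \<in> {1..n}" for j by (rule permutes_in_iff_atLeastAtMost[OF \<sigma> that])
  fix x
  {
    assume x: "x \<in> ?L"
    then obtain i j where ij: "x = (i, j)" "i \<in> {1..Suc n}" "j \<in> {1..Suc n}" "i < j"
      "ins_one n p \<sigma> j < ins_one n p \<sigma> i" by (auto simp: invs_def)
    from ij(2) p show "x \<in> ?A \<union> ?B"
    proof (cases rule: skip_cases)
      case 1
      from ij(3) p have False
        by (cases rule: skip_cases) (use 1 ij in \<open>auto simp: ins_one_p ins_one_skip simp del: One_nat_def\<close>)
      then show ?thesis ..
    next
      case (2 i')
      from ij(3) p show ?thesis
      proof (cases rule: skip_cases)
        case 1
        then show ?thesis using ij by auto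
      next
        case (2 j')
        have "(i', j') \<in> invs n \<sigma>"
          using ij p \<open>i' \<in> {1..n}\<close> \<open>i = skip p i'\<close> 2 by (auto simp: invs_def ins_one_skip simp del: One_nat_def)
        then show ?thesis using ij 2 \<open>i = skip p i'\<close> by auto
      qed
    qed
  }
  assume "x \<in> ?A \<union> ?B"
  then show "x \<in> ?L"
  proof
    assume "x \<in> ?A"
    then obtain i where i: "i \<in> {1..<p}" "x = (i, p)" by auto
    then have "i \<in> {1..n}" "skip p i = i" using p by (auto simp: skip_def)
    then have "ins_one n p \<sigma> i = Suc (\<sigma> i)" using ins_one_skip[of i n p \<sigma>] p by simp
    then show ?thesis using i r[OF \<open>i \<in> {1..n}\<close>] p by (auto simp: invs_def ins_one_p simp del: One_nat_def)
  next
    assume "x \<in> ?B"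
    then obtain i j where ij: "x = (skip p i, skip p j)" "(i, j) \<in> invs n \<sigma>" by auto
    then have *: "i \<in> {1..n}" "j \<in> {1..n}" "i < j" "\<sigma> j < \<sigma> i" by (auto simp: invs_def)
    then show ?thesis
      using ij skip_range[OF *(1), of p] skip_range[OF *(2), of p] p
      by (auto simp: invs_def ins_one_skip simp del: One_nat_def)
  qed
qed

lemma perm_word_ins_one:
  assumes \<sigma>: "\<sigma> permutes {1..n}" and p: "p \<in> {1..Suc n}" and w: "length w = n"
  shows "perm_word (ins_one n p \<sigma>) (a # w) = take (p - 1) (perm_word \<sigma> w) @ a # drop (p - 1) (perm_word \<sigma> w)"
proof (rule nth_equalityI)
  show "length (perm_word (ins_one n p \<sigma>) (a # w)) = length (take (p - 1) (perm_word \<sigma> w) @ a # drop (p - 1) (perm_word \<sigma> w))"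
    using p w by auto
  fix i assume "i < length (perm_word (ins_one n p \<sigma>) (a # w))"
  then have i: "Suc i \<in> {1..Suc n}" "i \<le> n" using w by auto
  have r: "\<sigma> j \<in> {1..n}" if "j \<in> {1..n}" for j by (rule permutes_in_iff_atLeastAtMost[OF \<sigma> that])
  have L: "perm_word (ins_one n p \<sigma>) (a # w) ! i = (a # w) ! (ins_one n p \<sigma> (Suc i) - 1)"
    using i w by (simp add: nth_perm_word)
  from i(1) p show "perm_word (ins_one n p \<sigma>) (a # w) ! i = (take (p - 1) (perm_word \<sigma> w) @ a # drop (p - 1) (perm_word \<sigma> w)) ! i"
  proof (cases rule: skip_cases)
    case 1
    then show ?thesis unfolding L using w i ins_one_p[OF p] by (auto simp: nth_append)
  next
    case (2 j)
    have "(a # w) ! (ins_one n p \<sigma> (Suc i) - 1) = w ! (\<sigma> j - 1)"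
      using r[OF 2(1)] unfolding 2(2) by (simp add: ins_one_skip[OF 2(1) p] nth_Cons')
    also have "\<dots> = perm_word \<sigma> w ! (j - 1)" using 2(1) w by (subst nth_perm_word') auto
    also have "\<dots> = (take (p - 1) (perm_word \<sigma> w) @ a # drop (p - 1) (perm_word \<sigma> w)) ! i"
    proof (cases "j < p")
      case True
      then have "i = j - 1" "i < p - 1" "i < n" using 2 by (auto simp: skip_def)
      then show ?thesis using w i by (simp add: nth_append)
    next
      case False
      then have "i = j" "p - 1 < i" "p - 1 \<le> n" using 2 p by (auto simp: skip_def)
      then obtain m where m: "i = Suc (p - 1 + m)" by (metis less_imp_Suc_add)
      then show ?thesis using w i \<open>i = j\<close> \<open>p - 1 \<le> n\<close> by (simp add: nth_append min_def)
    qed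
    finally show ?thesis unfolding L .
  qed
qed

section \<open>The operator R and bounds in the sup norm\<close>

context aw begin

definition q_word :: "nat \<Rightarrow> nat list \<Rightarrow> complex" where
  "q_word a u = prod_list (map (qq a) u)"

lemma q_word_simps [simp]: "q_word a [] = 1" "q_word a (b # u) = qq a b * q_word a u" "q_word a (u @ v) = q_word a u * q_word a v"
  by (simp_all add: q_word_def)

lemma q_word_rev [simp]: "q_word a (rev u) = q_word a u"
  by (induction u) simp_all

lemma cnj_q_word [simp]: "cnj (q_word a u) = q_word a u"
  by (induction u) simp_all

text \<open>This is 1 + T_1 + T_1 T_2 + ... in coordinates: the first letter moves past k others and
  collects its q-factors with them.\<close>

definition RR :: "fvec \<Rightarrow> fvec" where
  "RR f w = (case w of [] \<Rightarrow> f [] | a # v \<Rightarrow>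
     \<Sum>k\<le>length v. q_word a (take k v) * f (take k v @ a # drop k v))"

lemma RR_simps [simp]:
  "RR f [] = f []"
  "RR f (a # v) = (\<Sum>k\<le>length v. q_word a (take k v) * f (take k v @ a # drop k v))"
  by (simp_all add: RR_def)

lemma inv_weight_ins_one:
  assumes \<sigma>: "\<sigma> permutes {1..n}" and p: "p \<in> {1..Suc n}" and w: "a # w \<in> words D (Suc n)"
  shows "inv_weight (Suc n) (ins_one n p \<sigma>) (a # w) = q_word a (take (p - 1) (perm_word \<sigma> w)) * inv_weight n \<sigma> w"
proof -
  let ?\<rho> = "ins_one n p \<sigma>" and ?g = "\<lambda>(i, j). (skip p i, skip p j)"
  let ?F = "\<lambda>(i, j). qq ((a # w) ! (?\<rho> i - 1)) ((a # w) ! (?\<rho> j - 1))"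
  have a: "a \<in> letters D" and w': "w \<in> words D n" and lw: "length w = n"
    using w words_length by auto
  have r: "\<sigma> j \<in> {1..n}" if "j \<in> {1..n}" for j by (rule permutes_in_iff_atLeastAtMost[OF \<sigma> that])
  have nth: "(a # w) ! (?\<rho> (skip p i) - 1) = w ! (\<sigma> i - 1)" if "i \<in> {1..n}" for i
    using r[OF that] by (simp add: ins_one_skip[OF that p] nth_Cons')
  have "inj_on ?g (invs n \<sigma>)" by (auto simp: inj_on_def)
  then have B: "(\<Prod>e\<in>?g ` invs n \<sigma>. ?F e) = inv_weight n \<sigma> w"
    unfolding inv_weight_def by (subst prod.reindex) (auto intro!: prod.cong simp: nth invs_def simp del: One_nat_def)
  have "(\<Prod>e\<in>(\<lambda>i. (i, p)) ` {1..<p}. ?F e) = (\<Prod>i\<in>{1..<p}. ?F (i, p))"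
    by (subst prod.reindex) (auto simp: inj_on_def)
  also have "\<dots> = (\<Prod>i\<in>{1..<p}. qq a (perm_word \<sigma> w ! (i - 1)))"
  proof (rule prod.cong[OF refl])
    fix i assume i: "i \<in> {1..<p}"
    then have i': "i \<in> {1..n}" "skip p i = i" using p by (auto simp: skip_def)
    have "?F (i, p) = qq (w ! (\<sigma> i - 1)) a"
      using nth[OF i'(1)] i'(2) ins_one_p[OF p, of \<sigma>] by simp
    also have "\<dots> = qq a (w ! (\<sigma> i - 1))" by (intro qq_sym nth_words[OF w'] r i' a)
    finally show "?F (i, p) = qq a (perm_word \<sigma> w ! (i - 1))" using i' lw by (subst nth_perm_word') auto
  qed
  also have "\<dots> = (\<Prod>i\<in>{0..<p - 1}. qq a (perm_word \<sigma> w ! i))"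
    by (rule prod.reindex_bij_witness[of _ Suc "\<lambda>i. i - 1"]) auto
  also have "\<dots> = q_word a (take (p - 1) (perm_word \<sigma> w))"
    unfolding q_word_def using p lw by (subst prod.list_conv_set_nth) (auto intro!: prod.cong simp: min_def)
  finally have A: "(\<Prod>e\<in>(\<lambda>i. (i, p)) ` {1..<p}. ?F e) = q_word a (take (p - 1) (perm_word \<sigma> w))" .
  show ?thesis
    unfolding inv_weight_def[of "Suc n"] invs_ins_one[OF \<sigma> p]
    by (subst prod.union_disjoint) (auto simp: A[simplified] B[simplified])
qed

text \<open>A permutation of n + 1 places consists of the place of the value 1 and a permutation of
  the rest; summing over that place first produces R.\<close>

lemma Pn_Cons:
  assumes w: "a # w \<in> words D (Suc n)"
  shows "Pn D (Suc n) f (a # w) = Pn D n (\<lambda>v. RR f (a # v)) w"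
proof -
  let ?S = "\<lambda>n. {\<sigma>. \<sigma> permutes {1..n::nat}}"
  have lw: "length w = n" using w words_length by auto
  have "Pn D (Suc n) f (a # w) = (\<Sum>\<sigma>\<in>?S (Suc n). inv_weight (Suc n) \<sigma> (a # w) * f (perm_word \<sigma> (a # w)))"
    by (rule Pn_eq) (simp add: lw)
  also have "\<dots> = (\<Sum>(p, \<sigma>)\<in>{1..Suc n} \<times> ?S n. inv_weight (Suc n) (ins_one n p \<sigma>) (a # w) * f (perm_word (ins_one n p \<sigma>) (a # w)))"
    by (subst sum.reindex_bij_betw[OF bij_ins_one, symmetric]) (simp add: split_def)
  also have "\<dots> = (\<Sum>(p, \<sigma>)\<in>{1..Suc n} \<times> ?S n. inv_weight n \<sigma> w * (q_word a (take (p - 1) (perm_word \<sigma> w)) *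
      f (take (p - 1) (perm_word \<sigma> w) @ a # drop (p - 1) (perm_word \<sigma> w))))"
    by (rule sum.cong[OF refl]) (auto simp: inv_weight_ins_one[OF _ _ w] perm_word_ins_one lw mult_ac simp del: One_nat_def)
  also have "\<dots> = (\<Sum>\<sigma>\<in>?S n. \<Sum>p\<in>{1..Suc n}. inv_weight n \<sigma> w * (q_word a (take (p - 1) (perm_word \<sigma> w)) *
      f (take (p - 1) (perm_word \<sigma> w) @ a # drop (p - 1) (perm_word \<sigma> w))))"
    by (subst sum.cartesian_product[symmetric], rule sum.swap)
  also have "\<dots> = (\<Sum>\<sigma>\<in>?S n. inv_weight n \<sigma> w * RR f (a # perm_word \<sigma> w))"
  proof (rule sum.cong[OF refl])
    fix \<sigma>
    have "RR f (a # perm_word \<sigma> w) = (\<Sum>p\<in>{1..Suc n}. q_word a (take (p - 1) (perm_word \<sigma> w)) *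
      f (take (p - 1) (perm_word \<sigma> w) @ a # drop (p - 1) (perm_word \<sigma> w)))"
      unfolding RR_simps length_perm_word lw
      by (rule sum.reindex_bij_witness[of _ "\<lambda>i. i - 1" Suc]) auto
    then show "(\<Sum>p\<in>{1..Suc n}. inv_weight n \<sigma> w * (q_word a (take (p - 1) (perm_word \<sigma> w)) *
      f (take (p - 1) (perm_word \<sigma> w) @ a # drop (p - 1) (perm_word \<sigma> w)))) = inv_weight n \<sigma> w * RR f (a # perm_word \<sigma> w)"
      by (simp only: sum_distrib_left)
  qed
  also have "\<dots> = Pn D n (\<lambda>v. RR f (a # v)) w" by (rule Pn_eq[symmetric]) (rule lw)
  finally show ?thesis .
qed

lemma Pn_0: "Pn D 0 f [] = f []"
  by (subst Pn_eq) (simp_all add: inv_weight_def perm_word_def)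

lemma norm_q_word: "a \<in> letters D \<Longrightarrow> set u \<subseteq> letters D \<Longrightarrow> norm (q_word a u) \<le> qmax ^ length u"
proof (induction u)
  case (Cons b u)
  then show ?case
    using qmax_bounds norm_qq[of a b] by (auto simp: norm_mult intro!: mult_mono)
qed simp

lemma norm_inv_weight_le: 
  assumes "\<sigma> permutes {1..n}" "w \<in> words D n" shows "norm (inv_weight n \<sigma> w) \<le> 1"
  unfolding inv_weight_def prod_norm[symmetric] split_def
proof (rule prod_le_1, safe)
  fix i j assume "(i, j) \<in> invs n \<sigma>"
  then have "\<sigma> i \<in> {1..n}" "\<sigma> j \<in> {1..n}"
    using permutes_in_iff_atLeastAtMost[OF assms(1)] by (auto simp: invs_def)
  then show "norm (qq (w ! (\<sigma> (fst (i, j)) - 1)) (w ! (\<sigma> (snd (i, j)) - 1))) \<le> 1"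
    using norm_qq[OF nth_words[OF assms(2)] nth_words[OF assms(2)]] qmax_bounds by fastforce
qed simp

text \<open>The factorial is harmless: it enters either the constant C of
  \<open>symmetric_bound\<close>, which has no effect on the growth rate, or the size of \<xi>_m,
  where the decay in q absorbs it.\<close>

lemma norm_Pn_le:
  assumes "w \<in> words D n" "\<And>v. v \<in> words D n \<Longrightarrow> norm (f v) \<le> M"
  shows "norm (Pn D n f w) \<le> fact n * M"
proof -
  have "norm (Pn D n f w) \<le> (\<Sum>\<sigma> | \<sigma> permutes {1..n}. norm (inv_weight n \<sigma> w * f (perm_word \<sigma> w)))"
    by (subst Pn_eq[OF words_length[OF assms(1)]]) (rule norm_sum)
  also have "\<dots> \<le> (\<Sum>\<sigma> | \<sigma> permutes {1..n}. 1 * M)"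
    using norm_inv_weight_le[OF _ assms(1)] assms(2)[OF perm_word_words[OF _ assms(1)]]
    by (intro sum_mono, unfold norm_mult, intro mult_mono) auto
  also have "\<dots> = fact n * M" by (simp add: card_permutes del: One_nat_def)
  finally show ?thesis .
qed

text \<open>Passing k letters costs at most \<open>qmax ^ k\<close>, and the geometric series makes
  the bound independent of the length of the word.\<close>

lemma norm_RR_le:
  assumes "w \<in> words D n" "\<And>v. v \<in> words D n \<Longrightarrow> norm (f v) \<le> M"
  shows "norm (RR f w) \<le> M / (1 - qmax)"
proof (cases w)
  case Nil
  have "0 \<le> M" using assms norm_ge_zero order_trans by blast
  then have "M \<le> M / (1 - qmax)" using qmax_bounds by (simp add: field_simps)
  then show ?thesis using assms Nil by (auto simp: words_def intro: order_trans)
next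
  case (Cons a v)
  have a: "a \<in> letters D" and v: "set v \<subseteq> letters D" using assms(1) Cons by (auto simp: words_def)
  have M: "0 \<le> M" using assms norm_ge_zero order_trans by blast
  have "norm (RR f w) \<le> (\<Sum>k\<le>length v. norm (q_word a (take k v) * f (take k v @ a # drop k v)))"
    unfolding Cons RR_simps by (rule norm_sum)
  also have "\<dots> \<le> (\<Sum>k\<le>length v. qmax ^ k * M)"
  proof (rule sum_mono)
    fix k assume "k \<in> {..length v}"
    then have k: "k \<le> length v" by simp
    have "set (take k v) \<subseteq> letters D" "set (drop k v) \<subseteq> letters D" 
      using v set_take_subset set_drop_subset by fastforce+
    then have "take k v @ a # drop k v \<in> words D n" using assms(1) a k Cons by (auto simp: words_def)
    moreover have "norm (q_word a (take k v)) \<le> qmax ^ k"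
      using norm_q_word[OF a \<open>set (take k v) \<subseteq> letters D\<close>] k by (simp add: min_absorb2)
    ultimately show "norm (q_word a (take k v) * f (take k v @ a # drop k v)) \<le> qmax ^ k * M"
      using assms(2) qmax_bounds by (auto simp: norm_mult intro!: mult_mono)
  qed
  also have "\<dots> = (\<Sum>k\<le>length v. qmax ^ k) * M" by (simp add: sum_distrib_right)
  also have "\<dots> \<le> 1 / (1 - qmax) * M"
  proof (rule mult_right_mono[OF _ M])
    have "(\<Sum>k\<le>length v. qmax ^ k) = (1 - qmax ^ Suc (length v)) / (1 - qmax)"
      using qmax_bounds by (subst sum_gp0) auto
    also have "\<dots> \<le> 1 / (1 - qmax)" using qmax_bounds by (intro divide_right_mono) auto
    finally show "(\<Sum>k\<le>length v. qmax ^ k) \<le> 1 / (1 - qmax)" .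
  qed
  finally show ?thesis by simp
qed

text \<open>Conjugation by the longest permutation \<omega> carries inversions to inversions with
  the two places exchanged, and the symmetry of q preserves the weights. Reversal of words therefore
  preserves the form, which gives every left operator a right-hand twin.\<close>

lemma Pn_rev:
  assumes w: "w \<in> words D n"
  shows "Pn D n (\<lambda>x. f (rev x)) w = Pn D n f (rev w)"
proof -
  define \<omega> where "\<omega> i = (if i \<in> {1..n} then Suc n - i else i)" for i
  have \<omega>\<omega>: "\<omega> (\<omega> i) = i" for i by (auto simp: \<omega>_def)
  have \<omega>r: "\<omega> i \<in> {1..n} \<longleftrightarrow> i \<in> {1..n}" for i by (auto simp: \<omega>_def)
  have \<omega>: "\<omega> permutes {1..n}"
  proof (rule bij_imp_permutes)
    show "bij_betw \<omega> {1..n} {1..n}"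
      by (rule bij_betw_byWitness[of _ \<omega>]) (use \<omega>\<omega> \<omega>r in blast)+
    show "\<omega> i = i" if "i \<notin> {1..n}" for i using that by (auto simp: \<omega>_def)
  qed
  have lw: "length w = n" using words_length[OF w] .
  have rev_pw: "rev x = perm_word \<omega> x" if "length x = n" for x :: "nat list"
    by (rule nth_equalityI) (use that in \<open>auto simp: nth_perm_word rev_nth \<omega>_def\<close>)
  let ?c = "\<lambda>\<sigma>. \<omega> \<circ> \<sigma> \<circ> \<omega>"
  have cp: "?c \<sigma> permutes {1..n}" if "\<sigma> permutes {1..n}" for \<sigma>
    using that \<omega> by (intro permutes_compose)
  have cc: "?c (?c \<sigma>) = \<sigma>" for \<sigma> by (simp add: fun_eq_iff \<omega>\<omega>)
  have 1: "rev (perm_word (?c \<sigma>) w) = perm_word \<sigma> (rev w)" if \<sigma>: "\<sigma> permutes {1..n}" for \<sigma>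
  proof -
    have "rev (perm_word (?c \<sigma>) w) = perm_word (?c \<sigma> \<circ> \<omega>) w"
      using perm_word_comp[of \<omega> w "?c \<sigma>"] \<omega> lw by (simp add: rev_pw del: One_nat_def)
    also have "?c \<sigma> \<circ> \<omega> = \<omega> \<circ> \<sigma>" by (simp add: fun_eq_iff \<omega>\<omega>)
    also have "perm_word (\<omega> \<circ> \<sigma>) w = perm_word \<sigma> (rev w)" using perm_word_comp[of \<sigma> w \<omega>] \<sigma> lw by (simp add: rev_pw del: One_nat_def)
    finally show ?thesis .
  qed
  have 2: "inv_weight n (?c \<sigma>) w = inv_weight n \<sigma> (rev w)" if \<sigma>: "\<sigma> permutes {1..n}" for \<sigma>
    unfolding inv_weight_def
  proof (rule prod.reindex_bij_witness[of _ "\<lambda>(i, j). (\<omega> j, \<omega> i)" "\<lambda>(i, j). (\<omega> j, \<omega> i)"])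
    have less: "\<omega> i < \<omega> j \<longleftrightarrow> j < i" if "i \<in> {1..n}" "j \<in> {1..n}" for i j
      using that by (auto simp: \<omega>_def)
    have r: "\<sigma> j \<in> {1..n}" if "j \<in> {1..n}" for j by (rule permutes_in_iff_atLeastAtMost[OF \<sigma> that])
    have nth: "rev w ! (i - 1) = w ! (\<omega> i - 1)" if "i \<in> {1..n}" for i
      using that lw by (simp add: rev_pw nth_perm_word' del: One_nat_def)
    fix e assume e: "e \<in> invs n (?c \<sigma>)"
    obtain i j where ij: "e = (i, j)" by force
    have *: "i \<in> {1..n}" "j \<in> {1..n}" "i < j" "\<omega> (\<sigma> (\<omega> j)) < \<omega> (\<sigma> (\<omega> i))"
      using e by (auto simp: ij invs_def)
    have R: "\<omega> i \<in> {1..n}" "\<omega> j \<in> {1..n}" using *(1,2) by (simp_all only: \<omega>r)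
    have **: "\<sigma> (\<omega> i) < \<sigma> (\<omega> j)" "\<omega> j < \<omega> i"
      using less[OF r[OF R(2)] r[OF R(1)]] less[OF *(2,1)] *(3,4) by simp_all
    show "(case e of (i, j) \<Rightarrow> (\<omega> j, \<omega> i)) \<in> invs n \<sigma>"
      using R ** by (auto simp: ij invs_def)
    show "(\<lambda>(i, j). (\<omega> j, \<omega> i)) (case e of (i, j) \<Rightarrow> (\<omega> j, \<omega> i)) = e" by (simp add: ij \<omega>\<omega>)
    have "qq (w ! (\<omega> (\<sigma> (\<omega> j)) - 1)) (w ! (\<omega> (\<sigma> (\<omega> i)) - 1)) =
        qq (w ! (\<omega> (\<sigma> (\<omega> i)) - 1)) (w ! (\<omega> (\<sigma> (\<omega> j)) - 1))"
      by (intro qq_sym nth_words[OF w] \<omega>r[THEN iffD2] r R)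
    then show "(case (case e of (i, j) \<Rightarrow> (\<omega> j, \<omega> i)) of (i, j) \<Rightarrow> qq (rev w ! (\<sigma> i - 1)) (rev w ! (\<sigma> j - 1))) =
        (case e of (i, j) \<Rightarrow> qq (w ! (?c \<sigma> i - 1)) (w ! (?c \<sigma> j - 1)))"
      using R r by (simp add: ij nth del: One_nat_def)
  next
    have less: "\<omega> i < \<omega> j \<longleftrightarrow> j < i" if "i \<in> {1..n}" "j \<in> {1..n}" for i j
      using that by (auto simp: \<omega>_def)
    have r: "\<sigma> j \<in> {1..n}" if "j \<in> {1..n}" for j by (rule permutes_in_iff_atLeastAtMost[OF \<sigma> that])
    fix e assume e: "e \<in> invs n \<sigma>"
    obtain i j where ij: "e = (i, j)" by force
    have *: "i \<in> {1..n}" "j \<in> {1..n}" "i < j" "\<sigma> j < \<sigma> i" using e by (auto simp: ij invs_def)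
    have "\<omega> j < \<omega> i" "\<omega> (\<sigma> i) < \<omega> (\<sigma> j)"
      using less[OF *(2,1)] less[OF r[OF *(1)] r[OF *(2)]] *(3,4) by simp_all
    then show "(case e of (i, j) \<Rightarrow> (\<omega> j, \<omega> i)) \<in> invs n (?c \<sigma>)"
      using *(1,2)[THEN \<omega>r[THEN iffD2]] by (auto simp: ij invs_def \<omega>\<omega>)
    show "(\<lambda>(i, j). (\<omega> j, \<omega> i)) (case e of (i, j) \<Rightarrow> (\<omega> j, \<omega> i)) = e" by (simp add: ij \<omega>\<omega>)
  qed
  have "Pn D n (\<lambda>x. f (rev x)) w = (\<Sum>\<sigma> | \<sigma> permutes {1..n}. inv_weight n \<sigma> w * f (rev (perm_word \<sigma> w)))"
    by (rule Pn_eq[OF lw])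
  also have "\<dots> = (\<Sum>\<sigma> | \<sigma> permutes {1..n}. inv_weight n \<sigma> (rev w) * f (perm_word \<sigma> (rev w)))"
    by (rule sum.reindex_bij_witness[of _ ?c ?c]) (use cp in \<open>auto simp: cc 2[symmetric] 1[symmetric] simp del: One_nat_def\<close>)
  also have "\<dots> = Pn D n f (rev w)" by (rule Pn_eq[symmetric]) (simp add: lw)
  finally show ?thesis .
qed

end

section \<open>Symmetric operators for a positive form\<close>

text \<open>Vectors are functions and closure is stated for f + c g alone, so that the same axioms
  serve the forms on single degrees, the tail forms and the whole Fock space.\<close>

locale sesq =
  fixes V :: "('x \<Rightarrow> complex) set" and B :: "('x \<Rightarrow> complex) \<Rightarrow> ('x \<Rightarrow> complex) \<Rightarrow> complex"
  assumes V_lin: "f \<in> V \<Longrightarrow> g \<in> V \<Longrightarrow> (\<lambda>w. f w + c * g w) \<in> V"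
    and B_lin: "f \<in> V \<Longrightarrow> g \<in> V \<Longrightarrow> h \<in> V \<Longrightarrow> B f (\<lambda>w. g w + c * h w) = B f g + c * B f h"
    and B_cnj: "f \<in> V \<Longrightarrow> g \<in> V \<Longrightarrow> B f g = cnj (B g f)"
    and B_nonneg: "f \<in> V \<Longrightarrow> 0 \<le> Re (B f f)"
begin

lemma B_lin_left:
  assumes "f \<in> V" "g \<in> V" "h \<in> V"
  shows "B (\<lambda>w. f w + c * g w) h = B f h + cnj c * B g h"
  using B_cnj[OF V_lin[OF assms(1,2), of c] assms(3)] B_lin[OF assms(3,1,2), of c]
    B_cnj[OF assms(1,3)] B_cnj[OF assms(2,3)] by simp

lemma B_Re: "f \<in> V \<Longrightarrow> B f f = of_real (Re (B f f))"
  using B_cnj[of f f] by (auto simp: complex_eq_iff)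

lemma B_expand:
  assumes "f \<in> V" "g \<in> V"
  shows "Re (B (\<lambda>w. f w + c * g w) (\<lambda>w. f w + c * g w)) =
    Re (B f f) + 2 * Re (c * B f g) + (cmod c)\<^sup>2 * Re (B g g)"
proof -
  let ?h = "\<lambda>w. f w + c * g w"
  have h: "?h \<in> V" by (rule V_lin[OF assms])
  have "B ?h ?h = B f f + c * B f g + cnj c * (B g f + c * B g g)"
    by (simp add: B_lin_left[OF assms h] B_lin[OF assms(1) assms] B_lin[OF assms(2) assms])
  also have "B g f = cnj (B f g)" by (rule B_cnj[OF assms(2,1)])
  also have "B g g = of_real (Re (B g g))" by (rule B_Re[OF assms(2)])
  finally show ?thesis unfolding cmod_power2 by (simp add: algebra_simps power2_eq_square)
qed

lemma cauchy_schwarz: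
  assumes "f \<in> V" "g \<in> V"
  shows "(cmod (B f g))\<^sup>2 \<le> Re (B f f) * Re (B g g)"
proof -
  let ?z = "B f g" and ?a = "Re (B f f)" and ?b = "Re (B g g)"
  have ineq: "0 \<le> ?a - 2 * t * (cmod ?z)\<^sup>2 + t\<^sup>2 * (cmod ?z)\<^sup>2 * ?b" for t :: real
  proof -
    let ?c = "- of_real t * cnj ?z"
    have "Re (?c * ?z) = - t * (cmod ?z)\<^sup>2" unfolding cmod_power2 by (simp add: power2_eq_square algebra_simps)
    moreover have "(cmod ?c)\<^sup>2 = t\<^sup>2 * (cmod ?z)\<^sup>2" by (simp add: norm_mult power_mult_distrib)
    ultimately show ?thesis
      using B_expand[OF assms, of ?c] B_nonneg[OF V_lin[OF assms, of ?c]] by simp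
  qed
  show ?thesis
  proof (cases "?b = 0")
    case True
    have "(cmod ?z)\<^sup>2 = 0"
    proof (rule ccontr)
      assume "(cmod ?z)\<^sup>2 \<noteq> 0"
      then have "0 < (cmod ?z)\<^sup>2" by simp
      \<comment> \<open>For b = 0 the inequality is affine in t with slope -2 |z|^2; at this t its
        right side equals -a - 2.\<close>
      define t where "t = (?a + 1) / (cmod ?z)\<^sup>2"
      have "t * (cmod ?z)\<^sup>2 = ?a + 1" using \<open>0 < (cmod ?z)\<^sup>2\<close> by (simp add: t_def)
      then show False using ineq[of t] True B_nonneg[OF assms(1)] by (simp add: mult.assoc)
    qed
    then show ?thesis using True by simp
  next
    case False
    then have "0 < ?b" using B_nonneg[OF assms(2)] by simp
    then show ?thesis using ineq[of "1 / ?b"] by (simp add: field_simps power2_eq_square)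
  qed
qed

definition nrm :: "('x \<Rightarrow> complex) \<Rightarrow> real" where
  "nrm f = sqrt (Re (B f f))"

lemma nrm_ge_0: "f \<in> V \<Longrightarrow> 0 \<le> nrm f"
  using B_nonneg by (simp add: nrm_def)

lemma nrm_sq: "f \<in> V \<Longrightarrow> (nrm f)\<^sup>2 = Re (B f f)"
  using B_nonneg by (simp add: nrm_def)

lemma norm_B_le:
  assumes "f \<in> V" "g \<in> V" shows "cmod (B f g) \<le> nrm f * nrm g"
proof (rule power2_le_imp_le)
  show "(cmod (B f g))\<^sup>2 \<le> (nrm f * nrm g)\<^sup>2"
    unfolding power_mult_distrib nrm_sq[OF assms(1)] nrm_sq[OF assms(2)] by (rule cauchy_schwarz[OF assms])
  show "0 \<le> nrm f * nrm g" by (intro mult_nonneg_nonneg nrm_ge_0 assms)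
qed

lemma nrm_triangle:
  assumes "f \<in> V" "g \<in> V"
  shows "nrm (\<lambda>w. f w + c * g w) \<le> nrm f + cmod c * nrm g"
proof (rule power2_le_imp_le)
  have "Re (c * B f g) \<le> cmod c * (nrm f * nrm g)"
    using complex_Re_le_cmod[of "c * B f g"] mult_left_mono[OF norm_B_le[OF assms], of "cmod c"]
    by (simp add: norm_mult)
  then show "(nrm (\<lambda>w. f w + c * g w))\<^sup>2 \<le> (nrm f + cmod c * nrm g)\<^sup>2"
    unfolding nrm_sq[OF V_lin[OF assms]] B_expand[OF assms]
    by (simp add: power2_sum power_mult_distrib nrm_sq assms algebra_simps)
  show "0 \<le> nrm f + cmod c * nrm g"
    by (intro add_nonneg_nonneg mult_nonneg_nonneg nrm_ge_0 assms) simp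
qed

text \<open>A symmetric operator is bounded for the form by any constant that bounds the growth of its
  iterates, in whatever norm these are measured: iterate the Cauchy-Schwarz inequality along powers of two.\<close>

lemma symmetric_bound:
  assumes S: "\<And>f. f \<in> V \<Longrightarrow> S f \<in> V"
    and sym: "\<And>f g. f \<in> V \<Longrightarrow> g \<in> V \<Longrightarrow> B (S f) g = B f (S g)"
    and x: "x \<in> V" and M: "0 < M"
    and bound: "\<And>k. cmod (B x ((S ^^ k) x)) \<le> C * M ^ k"
  shows "Re (B x (S x)) \<le> M * Re (B x x)"
proof -
  define a where "a k = cmod (B x ((S ^^ k) x))" for k
  have Sk: "(S ^^ k) x \<in> V" for k by (induction k) (auto simp: x S)
  have move: "B ((S ^^ k) f) g = B f ((S ^^ k) g)" if "f \<in> V" "g \<in> V" for f g k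
    using that
  proof (induction k arbitrary: f g)
    case (Suc k)
    have Sf: "(S ^^ k) f \<in> V" using Suc.prems by (induction k) (auto simp: S)
    show ?case using Suc sym[OF Sf] S by (simp add: funpow_swap1)
  qed simp
  have a0: "a 0 = Re (B x x)" using B_Re[OF x] B_nonneg[OF x] by (simp add: a_def) (metis abs_of_nonneg norm_of_real)
  have CS: "(a k)\<^sup>2 \<le> a 0 * a (2 * k)" for k
  proof -
    have "Re (B ((S ^^ k) x) ((S ^^ k) x)) \<le> a (2 * k)"
      unfolding a_def using move[OF x Sk] complex_Re_le_cmod by (simp add: mult_2 funpow_add)
    then show ?thesis
      using cauchy_schwarz[OF x Sk[of k]] B_nonneg[OF x]
      by (simp add: a0 a_def[of k]) (meson mult_left_mono order_trans)
  qed
  have ann: "0 \<le> a k" for k by (simp add: a_def)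
  have "a 1 \<le> M * a 0"
  proof (cases "a 0 = 0")
    case True
    then show ?thesis using CS[of 1] by simp
  next
    case False
    then have pos: "0 < a 0" using ann[of 0] by simp
    define b where "b = a 1 / a 0"
    \<comment> \<open>Each use of Cauchy-Schwarz doubles the exponent, so a ratio b > M would
      outgrow C M^k along the powers of two.\<close>
    have iter: "b ^ (2 ^ k) \<le> a (2 ^ k) / a 0" for k
    proof (induction k)
      case (Suc k)
      have "b ^ (2 ^ Suc k) = (b ^ (2 ^ k))\<^sup>2" by (simp add: power_mult[symmetric] mult.commute)
      also have "\<dots> \<le> (a (2 ^ k) / a 0)\<^sup>2"
        using Suc ann[of 1] pos by (intro power_mono) (auto simp: b_def)
      also have "\<dots> \<le> a (2 ^ Suc k) / a 0"
        using CS[of "2 ^ k"] pos by (simp add: field_simps power2_eq_square)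
      finally show ?case .
    qed (simp add: b_def)
    have "b \<le> M"
    proof (rule ccontr)
      assume "\<not> b \<le> M"
      then have gt: "1 < b / M" using M by simp
      obtain N where N: "C / a 0 < (b / M) ^ N" using real_arch_pow[OF gt] by blast
      have "(b / M) ^ N \<le> (b / M) ^ (2 ^ N)" using gt by (intro power_increasing) auto
      also have "\<dots> = b ^ (2 ^ N) / M ^ (2 ^ N)" by (simp add: power_divide)
      also have "\<dots> \<le> (a (2 ^ N) / a 0) / M ^ (2 ^ N)" using iter[of N] M by (intro divide_right_mono) auto
      also have "\<dots> \<le> (C * M ^ (2 ^ N) / a 0) / M ^ (2 ^ N)"
        using bound[of "2 ^ N"] pos M by (intro divide_right_mono) (auto simp: a_def)
      also have "\<dots> = C / a 0" using M by simp
      finally show False using N by simp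
    qed
    then show ?thesis using pos by (simp add: b_def field_simps)
  qed
  then have "cmod (B x (S x)) \<le> M * Re (B x x)" unfolding a0 by (simp add: a_def)
  then show ?thesis using complex_Re_le_cmod[of "B x (S x)"] by linarith
qed

end

context aw begin

section \<open>Creation and annihilation\<close>

lemma Pn_lin: "length w = n \<Longrightarrow> Pn D n (\<lambda>w. g w + c * h w) w = Pn D n g w + c * Pn D n h w"
  by (simp add: Pn_eq sum.distrib sum_distrib_left algebra_simps)

lemma Pn_cong:
  "w \<in> words D n \<Longrightarrow> (\<And>v. v \<in> words D n \<Longrightarrow> f v = g v) \<Longrightarrow> Pn D n f w = Pn D n g w"
  unfolding Pn_eq[OF words_length] using perm_word_words by (intro sum.cong refl) simp

lemma fm_cong:
  "(\<And>v. v \<in> words D n \<Longrightarrow> f v = f' v) \<Longrightarrow> (\<And>v. v \<in> words D n \<Longrightarrow> g v = g' v) \<Longrightarrow> fm n f g = fm n f' g'"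
  unfolding ipT_deg_def by (intro sum.cong refl arg_cong2[of _ _ _ _ "(*)"] Pn_cong) auto

lemma fm_lin: "fm n f (\<lambda>w. g w + c * h w) = fm n f g + c * fm n f h"
  by (simp add: ipT_deg_def Pn_lin words_length sum.distrib sum_distrib_left algebra_simps)

lemma fm_nonneg: "0 \<le> Re (fm n f f)"
proof -
  have "0 \<le> (1 - qmax) ^ card (pairs n) * (\<Sum>w\<in>words D n. (cmod (f w))\<^sup>2)"
    using qmax_bounds by (intro mult_nonneg_nonneg sum_nonneg) auto
  then show ?thesis using fm_ge[of n f] by linarith
qed

sublocale fms: sesq UNIV "ipT_deg D n" for n
  by unfold_locales (simp, rule fm_lin, rule fm_cnj, rule fm_nonneg)

text \<open>The form of \<open>1 \<otimes> P\<^bsup>(n)\<^esup>\<close> on \<open>n + 1\<close> legs.\<close>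

definition fm_tail :: "nat \<Rightarrow> fvec \<Rightarrow> fvec \<Rightarrow> complex" where
  "fm_tail n f g = (\<Sum>a\<in>letters D. fm n (\<lambda>w. f (a # w)) (\<lambda>w. g (a # w)))"

sublocale fms_tail: sesq UNIV "fm_tail n" for n
proof unfold_locales
  fix f g h :: fvec and c
  show "fm_tail n f (\<lambda>w. g w + c * h w) = fm_tail n f g + c * fm_tail n f h"
    by (simp add: fm_tail_def fm_lin sum.distrib sum_distrib_left)
  show "fm_tail n f g = cnj (fm_tail n g f)"
    unfolding fm_tail_def cnj_sum by (intro sum.cong refl fm_cnj)
  show "0 \<le> Re (fm_tail n f f)" unfolding fm_tail_def Re_sum by (intro sum_nonneg fm_nonneg)
qed auto

lemma fm_Suc: "fm (Suc n) f g = fm_tail n f (RR g)"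
proof -
  have "fm (Suc n) f g = (\<Sum>a\<in>letters D. \<Sum>w\<in>words D n. cnj (f (a # w)) * Pn D (Suc n) g (a # w))"
    unfolding ipT_deg_def by (rule sum_words_Suc)
  also have "\<dots> = fm_tail n f (RR g)"
    unfolding fm_tail_def ipT_deg_def by (intro sum.cong refl) (simp add: Pn_Cons)
  finally show ?thesis .
qed

lemma norm_form_tail_le:
  assumes "\<And>w. w \<in> words D (Suc n) \<Longrightarrow> norm (g w) \<le> M"
  shows "norm (fm_tail n f g) \<le> (\<Sum>w\<in>words D (Suc n). norm (f w)) * fact n * M"
proof -
  have "norm (fm_tail n f g) \<le> (\<Sum>a\<in>letters D. norm (\<Sum>w\<in>words D n. cnj (f (a # w)) * Pn D n (\<lambda>w. g (a # w)) w))"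
    unfolding fm_tail_def ipT_deg_def by (rule norm_sum)
  also have "\<dots> \<le> (\<Sum>a\<in>letters D. \<Sum>w\<in>words D n. norm (f (a # w)) * (fact n * M))"
  proof (intro sum_mono order_trans[OF norm_sum])
    fix a w assume aw: "a \<in> letters D" "w \<in> words D n"
    have "norm (Pn D n (\<lambda>w. g (a # w)) w) \<le> fact n * M"
      using aw assms by (intro norm_Pn_le) auto
    then show "norm (cnj (f (a # w)) * Pn D n (\<lambda>w. g (a # w)) w) \<le> norm (f (a # w)) * (fact n * M)"
      by (auto simp: norm_mult intro!: mult_left_mono)
  qed
  also have "\<dots> = (\<Sum>w\<in>words D (Suc n). norm (f w)) * fact n * M"
    by (simp add: sum_words_Suc sum_distrib_right mult.assoc)
  finally show ?thesis .
qed

definition Rnorm :: real where "Rnorm = 1 / (1 - qmax)"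

lemma Rnorm_pos: "0 < Rnorm" using qmax_bounds by (simp add: Rnorm_def)

text \<open>R is symmetric for the tail form because P^(n+1) is hermitian. Its sup norm bound
  \<open>Rnorm\<close> controls all iterates, and \<open>symmetric_bound\<close> turns it into
  P^(n+1) \<le> \<open>Rnorm\<close> (1 \<otimes> P^(n)).\<close>

lemma fm_Suc_le: "Re (fm (Suc n) f f) \<le> Rnorm * Re (fm_tail n f f)"
proof -
  define M where "M = (\<Sum>w\<in>words D (Suc n). norm (f w))"
  have fM: "norm (f w) \<le> M" if "w \<in> words D (Suc n)" for w
    unfolding M_def by (rule member_le_sum) (use that in auto)
  have iter: "norm ((RR ^^ k) f w) \<le> M * Rnorm ^ k" if "w \<in> words D (Suc n)" for k w
    using that
  proof (induction k arbitrary: w)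
    case (Suc k)
    then show ?case using norm_RR_le[OF Suc.prems Suc.IH] by (simp add: Rnorm_def mult.commute)
  qed (use fM in auto)
  have "Re (fm_tail n f (RR f)) \<le> Rnorm * Re (fm_tail n f f)"
  proof (rule fms_tail.symmetric_bound)
    show "fm_tail n (RR f) g = fm_tail n f (RR g)" for f g
    proof -
      have "fm_tail n (RR f) g = cnj (fm (Suc n) g f)" unfolding fm_Suc by (rule fms_tail.B_cnj) auto
      also have "\<dots> = fm (Suc n) f g" by (rule fm_cnj[symmetric])
      finally show ?thesis by (simp add: fm_Suc)
    qed
    show "cmod (fm_tail n f ((RR ^^ k) f)) \<le> ((\<Sum>w\<in>words D (Suc n). norm (f w)) * fact n * M) * Rnorm ^ k" for k
      using norm_form_tail_le[of n "(RR ^^ k) f" "M * Rnorm ^ k" f] iter by (simp add: mult.assoc)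
  qed (auto simp: Rnorm_pos)
  then show ?thesis by (simp add: fm_Suc)
qed

section \<open>Creation and annihilation in coordinates, degree by degree\<close>

definition cre :: "(nat \<Rightarrow> complex) \<Rightarrow> fvec \<Rightarrow> fvec" where
  "cre c f w = (case w of [] \<Rightarrow> 0 | k # v \<Rightarrow> if k \<in> letters D then c k * f v else 0)"

text \<open>Free annihilation after R; this is the adjoint of \<open>cre c\<close> for the twisted
  form, see \<open>fm_adj\<close>.\<close>

definition ann :: "(nat \<Rightarrow> complex) \<Rightarrow> fvec \<Rightarrow> fvec" where
  "ann c f v = (\<Sum>b\<in>letters D. cnj (c b) * RR f (b # v))"

definition cre_sqnorm :: "(nat \<Rightarrow> complex) \<Rightarrow> real" where
  "cre_sqnorm c = Rnorm * (\<Sum>k\<in>letters D. (cmod (c k))\<^sup>2)"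

lemma cre_sqnorm_nonneg: "0 \<le> cre_sqnorm c"
  unfolding cre_sqnorm_def using Rnorm_pos by (intro mult_nonneg_nonneg sum_nonneg) auto

lemma fm_scale_left: "fm n (\<lambda>w. c * f w) g = cnj c * fm n f g"
  by (simp add: ipT_deg_def sum_distrib_left mult_ac)

lemma fm_scale_right: "fm n f (\<lambda>w. c * g w) = c * fm n f g"
  by (simp add: ipT_deg_def Pn_eq words_length sum_distrib_left mult_ac)

lemma fm_scale: "fm n (\<lambda>w. c * f w) (\<lambda>w. d * g w) = cnj c * d * fm n f g"
  unfolding fm_scale_left fm_scale_right by simp

lemma cre_Cons: "k \<in> letters D \<Longrightarrow> cre c f (k # v) = c k * f v"
  by (simp add: cre_def)

lemma fm_tail_cre: "fm_tail n (cre c f) g = (\<Sum>k\<in>letters D. cnj (c k) * fm n f (\<lambda>w. g (k # w)))"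
  unfolding fm_tail_def
  by (intro sum.cong refl) (simp add: cre_Cons fm_scale_left)

text \<open>For the tail form the first leg is an untwisted tensor factor, so the created vector has
  exactly the product norm; the factor \<open>Rnorm\<close> pays for the passage to P^(n+1).\<close>

lemma fm_cre_le: "Re (fm (Suc n) (cre c f) (cre c f)) \<le> cre_sqnorm c * Re (fm n f f)"
proof -
  have "fm_tail n (cre c f) (cre c f) = (\<Sum>k\<in>letters D. of_real ((cmod (c k))\<^sup>2) * fm n f f)"
    unfolding fm_tail_cre
  proof (intro sum.cong refl)
    fix k assume k: "k \<in> letters D"
    have "cnj (c k) * c k = of_real ((cmod (c k))\<^sup>2)" by (metis complex_norm_square mult.commute of_real_power)
    then show "cnj (c k) * fm n f (\<lambda>w. cre c f (k # w)) = of_real ((cmod (c k))\<^sup>2) * fm n f f"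
      by (simp add: cre_Cons[OF k] fm_scale_right mult.assoc[symmetric])
  qed
  then have "Re (fm_tail n (cre c f) (cre c f)) = (\<Sum>k\<in>letters D. (cmod (c k))\<^sup>2) * Re (fm n f f)"
    by (simp add: Re_sum sum_distrib_right)
  then show ?thesis using fm_Suc_le[of n "cre c f"] by (simp add: cre_sqnorm_def mult.assoc)
qed

lemma fm_0_cre [simp]: "fm 0 (cre c f) g = 0" "fm 0 g (cre c f) = 0"
  by (simp_all add: ipT_deg_def Pn_0 cre_def)

lemma fm_adj: "fm (Suc n) (cre c f) g = fm n f (ann c g)"
proof -
  have "fm n f (\<lambda>v. \<Sum>b\<in>S. cnj (c b) * RR g (b # v)) = (\<Sum>b\<in>S. cnj (c b) * fm n f (\<lambda>v. RR g (b # v)))"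
    if "finite S" for S
    using that
  proof (induction S rule: finite_induct)
    case empty
    show ?case by (simp add: ipT_deg_def Pn_eq words_length)
  next
    case (insert b S)
    then show ?case
      using fm_lin[of n f "\<lambda>v. \<Sum>b\<in>S. cnj (c b) * RR g (b # v)" "cnj (c b)" "\<lambda>v. RR g (b # v)"]
      by (simp add: add.commute)
  qed
  then show ?thesis
    unfolding fm_Suc fm_tail_cre ann_def[abs_def] by simp
qed

text \<open>The adjoint inherits the bound: with X the squared norm of the annihilated vector,
  Cauchy-Schwarz gives X^2 \<le> K X G, and X cancels unless it vanishes.\<close>

lemma fm_ann_le: "Re (fm n (ann c g) (ann c g)) \<le> cre_sqnorm c * Re (fm (Suc n) g g)"
proof -
  let ?x = "ann c g" and ?K = "cre_sqnorm c"
  let ?X = "Re (fm n ?x ?x)" and ?G = "Re (fm (Suc n) g g)"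
  have nn: "0 \<le> ?X" "0 \<le> ?G" by (rule fm_nonneg)+
  have "?X\<^sup>2 \<le> (cmod (fm (Suc n) (cre c ?x) g))\<^sup>2"
    unfolding fm_adj using nn complex_Re_le_cmod by (intro power_mono) auto
  also have "\<dots> \<le> Re (fm (Suc n) (cre c ?x) (cre c ?x)) * ?G"
    by (rule fms.cauchy_schwarz) auto
  also have "\<dots> \<le> (?K * ?X) * ?G" by (rule mult_right_mono[OF fm_cre_le nn(2)])
  finally have *: "?X * ?X \<le> ?X * (?K * ?G)" by (simp add: power2_eq_square mult_ac)
  show ?thesis
  proof (cases "?X = 0")
    case True
    show ?thesis unfolding True by (intro mult_nonneg_nonneg cre_sqnorm_nonneg nn)
  next
    case False
    then have "0 < ?X" using nn(1) by linarith
    with * show ?thesis by (rule mult_left_le_imp_le)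
  qed
qed


section \<open>The Fock space norm\<close>

definition supp_words :: "fvec \<Rightarrow> bool" where
  "supp_words f \<longleftrightarrow> (\<forall>w. f w \<noteq> 0 \<longrightarrow> w \<in> words D (length w))"

lemma supp_wordsD: "supp_words f \<Longrightarrow> w \<notin> words D (length w) \<Longrightarrow> f w = 0"
  by (auto simp: supp_words_def)

lemma Fock_iff: "f \<in> Fock D \<longleftrightarrow> supp_words f \<and> summable (\<lambda>n. Re (fm n f f))"
  by (simp add: Fock_def supp_words_def)

lemma supp_words_lin: "supp_words f \<Longrightarrow> supp_words g \<Longrightarrow> supp_words (\<lambda>w. f w + c * g w)"
  unfolding supp_words_def by (metis add.right_neutral mult_zero_right)

lemma Re_fm_lin_le:
  "Re (fm n (\<lambda>w. f w + c * g w) (\<lambda>w. f w + c * g w)) \<le> 2 * Re (fm n f f) + 2 * (cmod c)\<^sup>2 * Re (fm n g g)"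
proof -
  have "0 \<le> Re (fm n (\<lambda>w. f w + (- c) * g w) (\<lambda>w. f w + (- c) * g w))" by (rule fm_nonneg)
  then show ?thesis using fms.B_expand[of f g n c] fms.B_expand[of f g n "- c"]
    by (simp add: algebra_simps)
qed

lemma Fock_lin:
  assumes "f \<in> Fock D" "g \<in> Fock D"
  shows "(\<lambda>w. f w + c * g w) \<in> Fock D"
proof -
  have "summable (\<lambda>n. 2 * Re (fm n f f) + 2 * (cmod c)\<^sup>2 * Re (fm n g g))"
    using assms by (intro summable_add summable_mult) (auto simp: Fock_iff)
  then have "summable (\<lambda>n. Re (fm n (\<lambda>w. f w + c * g w) (\<lambda>w. f w + c * g w)))"
    by (rule summable_comparison_test'[of _ 0]) (simp add: Re_fm_lin_le fm_nonneg abs_of_nonneg)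
  then show ?thesis using assms by (auto simp: Fock_iff intro: supp_words_lin)
qed

lemma summable_fm:
  assumes "f \<in> Fock D" "g \<in> Fock D" shows "summable (\<lambda>n. fm n f g)"
proof (rule summable_comparison_test'[of _ 0])
  show "summable (\<lambda>n. Re (fm n f f) + Re (fm n g g))"
    using assms by (intro summable_add) (auto simp: Fock_iff)
  fix n
  let ?a = "Re (fm n f f)" and ?b = "Re (fm n g g)"
  have nn: "0 \<le> ?a" "0 \<le> ?b" by (rule fm_nonneg)+
  have "(cmod (fm n f g))\<^sup>2 \<le> ?a * ?b" by (rule fms.cauchy_schwarz) auto
  also have "\<dots> \<le> (?a + ?b)\<^sup>2" using nn by (simp add: power2_sum)
  finally show "norm (fm n f g) \<le> ?a + ?b" by (rule power2_le_imp_le) (use nn in simp)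
qed

sublocale FF: sesq "Fock D" "ipT D"
proof unfold_locales
  fix f g h c assume f: "f \<in> Fock D" and g: "g \<in> Fock D"
  show "(\<lambda>w. f w + c * g w) \<in> Fock D" by (rule Fock_lin[OF f g])
  show "ipT D f g = cnj (ipT D g f)"
    unfolding ipT_def bounded_linear.suminf[OF bounded_linear_cnj summable_fm[OF g f]]
    by (intro suminf_cong fm_cnj)
  show "0 \<le> Re (ipT D f f)"
    unfolding ipT_def bounded_linear.suminf[OF bounded_linear_Re summable_fm[OF f f]]
    by (intro suminf_nonneg fm_nonneg bounded_linear.summable[OF bounded_linear_Re] summable_fm f)
  assume h: "h \<in> Fock D"
  show "ipT D f (\<lambda>w. g w + c * h w) = ipT D f g + c * ipT D f h"
    unfolding ipT_def fm_lin using summable_fm[OF f g] summable_fm[OF f h]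
    by (subst suminf_add[symmetric]) (auto intro: summable_mult simp: suminf_mult)
qed

lemma normT_eq: "normT D = FF.nrm"
  by (simp add: fun_eq_iff normT_def FF.nrm_def)

lemma Re_ipT: "f \<in> Fock D \<Longrightarrow> Re (ipT D f f) = (\<Sum>n. Re (fm n f f))"
  unfolding ipT_def by (rule bounded_linear.suminf[OF bounded_linear_Re]) (rule summable_fm)

lemma normT_nonneg: "f \<in> Fock D \<Longrightarrow> 0 \<le> normT D f"
  by (simp add: normT_eq FF.nrm_ge_0)

lemma normT_sq: "f \<in> Fock D \<Longrightarrow> (normT D f)\<^sup>2 = (\<Sum>n. Re (fm n f f))"
  by (simp add: normT_eq FF.nrm_sq Re_ipT)

lemma fm_le_normT: "f \<in> Fock D \<Longrightarrow> Re (fm n f f) \<le> (normT D f)\<^sup>2"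
  unfolding normT_sq using sum_le_suminf[of "\<lambda>n. Re (fm n f f)" "{n}"]
  by (auto simp: Fock_iff fm_nonneg)

lemma zero_Fock [simp]: "(\<lambda>w. 0) \<in> Fock D"
  by (simp add: Fock_iff supp_words_def ipT_deg_def)

lemma normT_zero [simp]: "normT D (\<lambda>w. 0) = 0"
  by (simp add: normT_def ipT_def ipT_deg_def)

lemma Fock_scale: "f \<in> Fock D \<Longrightarrow> (\<lambda>w. c * f w) \<in> Fock D"
  using Fock_lin[of "\<lambda>_. 0" f c] by simp

lemma Fock_add: "f \<in> Fock D \<Longrightarrow> g \<in> Fock D \<Longrightarrow> (\<lambda>w. f w + g w) \<in> Fock D"
  using Fock_lin[of f g 1] by simp

lemma Fock_diff: "f \<in> Fock D \<Longrightarrow> g \<in> Fock D \<Longrightarrow> (\<lambda>w. f w - g w) \<in> Fock D"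
  using Fock_lin[of f g "-1"] by simp

lemma Fock_sum: "(\<And>i. i \<in> S \<Longrightarrow> F i \<in> Fock D) \<Longrightarrow> (\<lambda>w. \<Sum>i\<in>S. F i w) \<in> Fock D"
  by (induction S rule: infinite_finite_induct) (auto intro: Fock_add)

lemma normT_scale:
  assumes "f \<in> Fock D" shows "normT D (\<lambda>w. c * f w) = cmod c * normT D f"
proof -
  have "cnj c * c = of_real ((cmod c)\<^sup>2)" by (metis complex_norm_square mult.commute of_real_power)
  then have "ipT D (\<lambda>w. c * f w) (\<lambda>w. c * f w) = of_real ((cmod c)\<^sup>2) * ipT D f f"
    unfolding ipT_def fm_scale using suminf_mult[OF summable_fm[OF assms assms]] by simp
  then show ?thesis unfolding normT_def by (simp add: real_sqrt_mult)
qed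

lemma normT_add: "f \<in> Fock D \<Longrightarrow> g \<in> Fock D \<Longrightarrow> normT D (\<lambda>w. f w + g w) \<le> normT D f + normT D g"
  using FF.nrm_triangle[of f g 1] by (simp add: normT_eq)

lemma normT_lin:
  "f \<in> Fock D \<Longrightarrow> g \<in> Fock D \<Longrightarrow> normT D (\<lambda>w. f w + c * g w) \<le> normT D f + cmod c * normT D g"
  using FF.nrm_triangle[of f g c] by (simp add: normT_eq)

lemma normT_sum:
  "(\<And>i. i \<in> S \<Longrightarrow> F i \<in> Fock D) \<Longrightarrow> normT D (\<lambda>w. \<Sum>i\<in>S. F i w) \<le> (\<Sum>i\<in>S. normT D (F i))"
proof (induction S rule: infinite_finite_induct)
  case (insert i S)
  then have "normT D (\<lambda>w. F i w + (\<Sum>i\<in>S. F i w)) \<le> normT D (F i) + normT D (\<lambda>w. \<Sum>i\<in>S. F i w)"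
    by (intro normT_add Fock_sum) auto
  then show ?case using insert by fastforce
qed auto

section \<open>Definiteness, uniqueness and limits in Fock space\<close>

lemma coord_le:
  assumes "f \<in> Fock D"
  shows "cmod (f w) \<le> normT D f / sqrt ((1 - qmax) ^ card (pairs (length w)))"
proof (cases "w \<in> words D (length w)")
  case True
  let ?c = "(1 - qmax) ^ card (pairs (length w))"
  have c: "0 < ?c" using qmax_bounds by simp
  have "(cmod (f w))\<^sup>2 \<le> (\<Sum>v\<in>words D (length w). (cmod (f v))\<^sup>2)"
    by (rule member_le_sum[OF True]) auto
  then have "?c * (cmod (f w))\<^sup>2 \<le> ?c * (\<Sum>v\<in>words D (length w). (cmod (f v))\<^sup>2)"
    using c by simp
  also have "\<dots> \<le> (normT D f)\<^sup>2" using fm_ge[of "length w" f] fm_le_normT[OF assms, of "length w"] by linarith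
  finally have "(cmod (f w))\<^sup>2 \<le> (normT D f / sqrt ?c)\<^sup>2"
    using c by (simp add: power_divide field_simps)
  then show ?thesis by (rule power2_le_imp_le) (use normT_nonneg[OF assms] c in simp)
next
  case False
  then have "f w = 0" using assms by (auto simp: Fock_iff supp_words_def)
  then show ?thesis using normT_nonneg[OF assms] qmax_bounds by simp
qed

lemma normT_eq_0:
  assumes "f \<in> Fock D" "normT D f \<le> 0" shows "f = (\<lambda>w. 0)"
proof
  fix w show "f w = 0"
    using coord_le[OF assms(1), of w] assms normT_nonneg[OF assms(1)] by simp
qed

text \<open>Testing against the basis words reads off the coordinates of P^(n)(f - g) in every
  degree; if all of them vanish, so does the norm of f - g.\<close>

lemma ipT_unique:
  assumes f: "f \<in> Fock D" and g: "g \<in> Fock D" and S: "S \<subseteq> Fock D"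
    and e: "\<And>w. w \<in> words D (length w) \<Longrightarrow> e_word D w \<in> S"
    and eq: "\<And>h. h \<in> S \<Longrightarrow> ipT D f h = ipT D g h"
  shows "f = g"
proof -
  define x where "x = (\<lambda>w. f w + (-1) * g w)"
  have x: "x \<in> Fock D" unfolding x_def by (rule Fock_lin[OF f g])
  have 0: "Pn D n x w = 0" if w: "w \<in> words D n" for n w
  proof -
    have ew: "e_word D w \<in> S" using e[of w] w words_length[OF w] by simp
    then have ew': "e_word D w \<in> Fock D" using S by blast
    have "fm m (e_word D w) x = (if m = n then Pn D n x w else 0)" for m
    proof -
      have "fm m (e_word D w) x = (\<Sum>v\<in>words D m. if v = w then Pn D m x v else 0)"
        unfolding ipT_deg_def e_word_eq[OF aw_setup w] by (intro sum.cong) auto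
      moreover have "w \<in> words D m \<longleftrightarrow> m = n" using w by (auto simp: words_def)
      ultimately show ?thesis by simp
    qed
    then have "ipT D (e_word D w) x = Pn D n x w"
      unfolding ipT_def using suminf_finite[of "{n}" "\<lambda>m. fm m (e_word D w) x"] by simp
    moreover have "ipT D x (e_word D w) = 0"
      unfolding x_def using FF.B_lin_left[OF f g ew', of "-1"] eq[OF ew] by simp
    ultimately show ?thesis using FF.B_cnj[OF x ew'] by simp
  qed
  have "fm n x x = 0" for n unfolding ipT_deg_def using 0 by (intro sum.neutral) auto
  then have "normT D x = 0" by (simp add: normT_def ipT_def)
  then have "x = (\<lambda>w. 0)" by (intro normT_eq_0 x) simp
  then show ?thesis by (auto simp: x_def fun_eq_iff)
qed

text \<open>A degree has finitely many coordinates, so coordinatewise convergence gives convergence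
  of the form in each degree, and the bounds on partial sums over the degrees survive. It replaces
  completeness when limits of operators are formed.\<close>

lemma fatou:
  assumes F: "\<And>k. F k \<in> Fock D" and lim: "\<And>w. (\<lambda>k. F k w) \<longlonglongrightarrow> g w"
    and B: "\<And>k. normT D (F k) \<le> B"
  shows "g \<in> Fock D" "normT D g \<le> B"
proof -
  have B0: "0 \<le> B" using B[of 0] normT_nonneg[OF F[of 0]] by linarith
  have "supp_words g"
    unfolding supp_words_def
  proof (intro allI impI, rule ccontr)
    fix w assume "g w \<noteq> 0" "w \<notin> words D (length w)"
    then have "F k w = 0" for k using F[of k] by (auto simp: Fock_iff supp_words_def)
    then have "(\<lambda>k. 0) \<longlonglongrightarrow> g w" using lim[of w] by simp
    then show False using \<open>g w \<noteq> 0\<close> LIMSEQ_unique tendsto_const by blast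
  qed
  have "(\<lambda>k. Pn D n (F k) w) \<longlonglongrightarrow> Pn D n g w" if "w \<in> words D n" for n w
    using words_length[OF that] by (simp add: Pn_eq) (intro tendsto_intros lim)
  then have fml: "(\<lambda>k. fm n (F k) (F k)) \<longlonglongrightarrow> fm n g g" for n
    unfolding ipT_deg_def by (intro tendsto_sum tendsto_mult tendsto_cnj lim) auto
  have part: "(\<Sum>n<N. Re (fm n g g)) \<le> B\<^sup>2" for N
  proof (rule LIMSEQ_le_const2)
    show "(\<lambda>k. \<Sum>n<N. Re (fm n (F k) (F k))) \<longlonglongrightarrow> (\<Sum>n<N. Re (fm n g g))"
      by (intro tendsto_sum tendsto_Re fml)
    have "(\<Sum>n<N. Re (fm n (F k) (F k))) \<le> B\<^sup>2" for k
    proof -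
      have "(\<Sum>n<N. Re (fm n (F k) (F k))) \<le> (normT D (F k))\<^sup>2"
        unfolding normT_sq[OF F] using F[of k] by (intro sum_le_suminf) (auto simp: Fock_iff fm_nonneg)
      also have "\<dots> \<le> B\<^sup>2" using B normT_nonneg[OF F] by (intro power_mono) auto
      finally show ?thesis .
    qed
    then show "\<exists>M. \<forall>k\<ge>M. (\<Sum>n<N. Re (fm n (F k) (F k))) \<le> B\<^sup>2" by blast
  qed
  have sm: "summable (\<lambda>n. Re (fm n g g))"
  proof (rule bounded_imp_summable)
    show "(\<Sum>k\<le>n. Re (fm k g g)) \<le> B\<^sup>2" for n
      using part[of "Suc n"] unfolding lessThan_Suc_atMost .
  qed (rule fm_nonneg)
  show g: "g \<in> Fock D" using sm \<open>supp_words g\<close> by (simp add: Fock_iff)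
  have "(normT D g)\<^sup>2 \<le> B\<^sup>2" unfolding normT_sq[OF g] by (rule suminf_le_const[OF sm part])
  then show "normT D g \<le> B" using B0 by (rule power2_le_imp_le)
qed

definition trunc :: "nat \<Rightarrow> fvec \<Rightarrow> fvec" where
  "trunc N f w = (if length w < N then f w else 0)"

lemma fm_trunc: "fm n (\<lambda>w. f w - trunc N f w) (\<lambda>w. f w - trunc N f w) = (if n < N then 0 else fm n f f)"
proof (cases "n < N")
  case True
  then show ?thesis by (auto simp: ipT_deg_def trunc_def words_def intro!: sum.neutral)
next
  case False
  then show ?thesis by (auto simp: trunc_def words_def intro!: fm_cong)
qed

lemma trunc_Fock:
  assumes "supp_words f" shows "trunc N f \<in> Fock D"
proof -
  have "fm n (trunc N f) (trunc N f) = 0" if "n \<notin> {..<N}" for n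
    using that by (auto simp: ipT_deg_def trunc_def words_def intro!: sum.neutral)
  then have "summable (\<lambda>n. Re (fm n (trunc N f) (trunc N f)))"
    by (intro summable_finite[of "{..<N}"]) auto
  then show ?thesis using assms by (auto simp: Fock_iff supp_words_def trunc_def)
qed

lemma trunc_tendsto:
  assumes f: "f \<in> Fock D"
  shows "(\<lambda>N. normT D (\<lambda>w. f w - trunc N f w)) \<longlonglongrightarrow> 0"
proof -
  have sm: "summable (\<lambda>n. Re (fm n f f))" and t: "trunc N f \<in> Fock D" for N
    using f trunc_Fock by (auto simp: Fock_iff)
  have "(normT D (\<lambda>w. f w - trunc N f w))\<^sup>2 = (\<Sum>n. Re (fm (n + N) f f))" for N
  proof -
    have "(normT D (\<lambda>w. f w - trunc N f w))\<^sup>2 = (\<Sum>n. if n < N then 0 else Re (fm n f f))"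
      unfolding normT_sq[OF Fock_diff[OF f t]] fm_trunc by (intro suminf_cong) auto
    also have "\<dots> = (\<Sum>n. if n + N < N then 0 else Re (fm (n + N) f f)) + (\<Sum>n<N. if n < N then 0 else Re (fm n f f))"
    proof (rule suminf_split_initial_segment)
      have "\<forall>\<^sub>F n in sequentially. (if n < N then 0 else Re (fm n f f)) = Re (fm n f f)"
        using eventually_ge_at_top[of N] by eventually_elim auto
      then show "summable (\<lambda>n. if n < N then 0 else Re (fm n f f))" using sm summable_cong by fast
    qed
    finally show ?thesis by simp
  qed
  moreover have "(\<lambda>N. \<Sum>n. Re (fm (n + N) f f)) \<longlonglongrightarrow> 0" by (rule suminf_exist_split2[OF sm])
  ultimately have "(\<lambda>N. sqrt ((normT D (\<lambda>w. f w - trunc N f w))\<^sup>2)) \<longlonglongrightarrow> sqrt 0"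
    by (intro tendsto_real_sqrt) simp
  then show ?thesis using normT_nonneg[OF Fock_diff[OF f t]] by simp
qed

section \<open>Operators that raise or lower the degree by one\<close>

lemma up_Fock:
  assumes f: "f \<in> Fock D" and "supp_words g" and K: "0 \<le> K"
    and "Re (fm 0 g g) = 0" "\<And>n. Re (fm (Suc n) g g) \<le> K * Re (fm n f f)"
  shows "g \<in> Fock D" "normT D g \<le> sqrt K * normT D f"
proof -
  have sf: "summable (\<lambda>n. K * Re (fm n f f))" using f by (auto simp: Fock_iff intro: summable_mult)
  then have s1: "summable (\<lambda>n. Re (fm (Suc n) g g))"
    by (rule summable_comparison_test'[of _ 0]) (simp add: assms fm_nonneg abs_of_nonneg)
  then have s: "summable (\<lambda>n. Re (fm n g g))" using summable_Suc_iff[of "\<lambda>n. Re (fm n g g)"] by simp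
  then show g: "g \<in> Fock D" using assms(2) by (simp add: Fock_iff)
  have "(normT D g)\<^sup>2 = (\<Sum>n. Re (fm (Suc n) g g))"
    unfolding normT_sq[OF g] using suminf_split_head[OF s] assms(4) by simp
  also have "\<dots> \<le> (\<Sum>n. K * Re (fm n f f))"
    by (rule suminf_le[OF _ s1 sf]) (rule assms)
  also have "\<dots> = K * (normT D f)\<^sup>2"
    unfolding normT_sq[OF f] using f by (intro suminf_mult) (auto simp: Fock_iff)
  also have "\<dots> = (sqrt K * normT D f)\<^sup>2" using K by (simp add: power_mult_distrib)
  finally show "normT D g \<le> sqrt K * normT D f"
    by (rule power2_le_imp_le) (use K normT_nonneg[OF f] in auto)
qed

lemma down_Fock:
  assumes f: "f \<in> Fock D" and "supp_words g" and K: "0 \<le> K"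
    and "\<And>n. Re (fm n g g) \<le> K * Re (fm (Suc n) f f)"
  shows "g \<in> Fock D" "normT D g \<le> sqrt K * normT D f"
proof -
  have s: "summable (\<lambda>n. Re (fm n f f))" using f by (simp add: Fock_iff)
  then have s': "summable (\<lambda>n. Re (fm (Suc n) f f))"
    using summable_Suc_iff[of "\<lambda>n. Re (fm n f f)"] by simp
  then have sf: "summable (\<lambda>n. K * Re (fm (Suc n) f f))" by (rule summable_mult)
  then have sg: "summable (\<lambda>n. Re (fm n g g))"
    by (rule summable_comparison_test'[of _ 0]) (simp add: assms fm_nonneg abs_of_nonneg)
  then show g: "g \<in> Fock D" using assms(2) by (simp add: Fock_iff)
  have "(normT D g)\<^sup>2 \<le> (\<Sum>n. K * Re (fm (Suc n) f f))"
    unfolding normT_sq[OF g] by (rule suminf_le) (use assms sg sf in auto)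
  also have "\<dots> = K * (\<Sum>n. Re (fm (Suc n) f f))" by (rule suminf_mult[OF s'])
  also have "\<dots> \<le> K * (normT D f)\<^sup>2"
    unfolding normT_sq[OF f] using suminf_split_head[OF s] K fm_nonneg[of 0 f] by (intro mult_left_mono) auto
  also have "\<dots> = (sqrt K * normT D f)\<^sup>2" using K by (simp add: power_mult_distrib)
  finally show "normT D g \<le> sqrt K * normT D f"
    by (rule power2_le_imp_le) (use K normT_nonneg[OF f] in auto)
qed

lemma supp_words_cre: "supp_words f \<Longrightarrow> supp_words (cre c f)"
  unfolding supp_words_def cre_def by (auto split: list.splits if_splits)

lemma supp_words_ann: 
  assumes "supp_words f" shows "supp_words (ann c f)"
  unfolding supp_words_def
proof (intro allI impI, rule ccontr)
  fix w assume *: "ann c f w \<noteq> 0" "w \<notin> words D (length w)"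
  then have "\<not> set w \<subseteq> letters D" by (simp add: words_def)
  then obtain x where x: "x \<in> set w" "x \<notin> letters D" by blast
  have "f (take k w @ b # drop k w) = 0" for k b
  proof (rule supp_wordsD[OF assms])
    have "x \<in> set (take k w) \<union> set (drop k w)" using x(1) by (metis append_take_drop_id set_append)
    then show "take k w @ b # drop k w \<notin> words D (length (take k w @ b # drop k w))"
      using x(2) by (auto simp: words_def)
  qed
  then show False using * by (simp add: ann_def)
qed

lemma cre_Fock:
  assumes "f \<in> Fock D"
  shows "cre c f \<in> Fock D" "normT D (cre c f) \<le> sqrt (cre_sqnorm c) * normT D f"
  using up_Fock[OF assms, of "cre c f" "cre_sqnorm c"] assms
  by (simp_all add: cre_sqnorm_nonneg fm_cre_le supp_words_cre Fock_iff)

lemma ann_Fock: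
  assumes "f \<in> Fock D"
  shows "ann c f \<in> Fock D" "normT D (ann c f) \<le> sqrt (cre_sqnorm c) * normT D f"
  using down_Fock[OF assms, of "ann c f" "cre_sqnorm c"] assms
  by (simp_all add: cre_sqnorm_nonneg fm_ann_le supp_words_ann Fock_iff)

lemma ipT_adj:
  assumes f: "f \<in> Fock D" and g: "g \<in> Fock D"
  shows "ipT D (cre c f) g = ipT D f (ann c g)"
proof -
  have "ipT D (cre c f) g = (\<Sum>n. fm (Suc n) (cre c f) g) + fm 0 (cre c f) g"
    unfolding ipT_def by (subst suminf_split_head) (auto intro!: summable_fm cre_Fock f g)
  then show ?thesis by (simp add: ipT_def fm_adj)
qed

lemma e_word_Fock: "e_word D w \<in> Fock D"
  unfolding e_word_def by (rule tens_Fock)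

text \<open>The adjoint is a definite description; one vector representing the functional is enough,
  because the basis words separate vectors.\<close>

lemma adj_eqI:
  assumes g: "g \<in> Fock D" and h: "h \<in> Fock D" and "\<And>f. f \<in> Fock D \<Longrightarrow> ipT D h f = ipT D g (X f)"
  shows "adj D X g = h"
  unfolding adjoint_on_def
proof (simp add: g, rule the_equality)
  show "h \<in> Fock D \<and> (\<forall>f\<in>Fock D. ipT D h f = ipT D g (X f))" using assms by blast
  fix h' assume "h' \<in> Fock D \<and> (\<forall>f\<in>Fock D. ipT D h' f = ipT D g (X f))"
  then show "h' = h" using h assms(3) by (intro ipT_unique[of h' h "Fock D"]) (auto simp: e_word_Fock)
qed

lemma crea_eq: "f \<in> Fock D \<Longrightarrow> crea D \<xi> f = cre (\<lambda>k. ipU D (bas D k) \<xi>) f"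
  by (auto simp: crea_def cre_def fun_eq_iff split: list.splits)

lemma crea_out: "f \<notin> Fock D \<Longrightarrow> crea D \<xi> f = (\<lambda>w. 0)"
  by (simp add: crea_def)

lemma anni_eq: "f \<in> Fock D \<Longrightarrow> anni D \<xi> f = ann (\<lambda>k. ipU D (bas D k) \<xi>) f"
  unfolding anni_def
proof (rule adj_eqI)
  let ?c = "\<lambda>k. ipU D (bas D k) \<xi>"
  assume f: "f \<in> Fock D"
  show "ann ?c f \<in> Fock D" by (rule ann_Fock(1)[OF f])
  fix g assume g: "g \<in> Fock D"
  show "ipT D (ann ?c f) g = ipT D f (crea D \<xi> g)"
    unfolding crea_eq[OF g]
    using FF.B_cnj[OF ann_Fock(1)[OF f] g] FF.B_cnj[OF f cre_Fock(1)[OF g]] ipT_adj[OF g f] by metis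
qed

lemma anni_out: "f \<notin> Fock D \<Longrightarrow> anni D \<xi> f = (\<lambda>w. 0)"
  by (simp add: anni_def adjoint_on_def)

end

section \<open>The dual real subspace\<close>

lemma cip_cnj: "cip v w = cnj (cip w v)"
  by (simp add: cip_def complex_eq_iff inner_commute)

context aw begin

lemma pos_gen: "pos_op (gen D)"
  using aw_setup by (simp add: aw_setup_def)

lemma ipU_add: "ipU D v (w + x) = ipU D v w + ipU D v x"
proof -
  obtain B where B: "clin B" "\<And>v w. ipU D v w = cip v (B w)" by (rule ipU_eq[OF pos_gen]) blast
  then show ?thesis by (metis clin_def cip_add)
qed

lemma ipU_cscale: "ipU D v (cscale c w) = c * ipU D v w"
proof -
  obtain B where B: "clin B" "\<And>v w. ipU D v w = cip v (B w)" by (rule ipU_eq[OF pos_gen]) blast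
  then show ?thesis by (metis clin_def cip_cscale)
qed

lemma ipU_sum: "ipU D v (\<Sum>k\<in>S. f k) = (\<Sum>k\<in>S. ipU D v (f k))"
proof (induction S rule: infinite_finite_induct)
  case empty
  show ?case using ipU_add[of v 0 0] by simp
qed (use ipU_add[of v 0 0] in \<open>simp_all add: ipU_add\<close>)

definition coord :: "'a \<times> 'a \<Rightarrow> nat \<Rightarrow> complex" where
  "coord \<xi> k = ipU D (bas D k) \<xi>"

lemma coord_bas: "k \<in> letters D \<Longrightarrow> l \<in> letters D \<Longrightarrow> coord (bas D k) l = (if l = k then 1 else 0)"
  unfolding coord_def by (rule ipU_bas[OF aw_setup])

lemma expand: "v = (\<Sum>k\<in>letters D. cscale (coord v k) (bas D k))"
proof -
  have "\<forall>v. \<exists>c. v = (\<Sum>k=1..DIM('a). cscale (c k) (bas D k))"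
    using aw_setup unfolding aw_setup_def by (elim conjE) assumption
  then obtain c where v: "v = (\<Sum>k\<in>letters D. cscale (c k) (bas D k))" by blast
  have "coord v l = c l" if "l \<in> letters D" for l
  proof -
    have "coord v l = (\<Sum>k\<in>letters D. if k = l then c k else 0)"
      unfolding coord_def by (subst v, unfold ipU_sum ipU_cscale, rule sum.cong) (use that ipU_bas[OF aw_setup] in auto)
    then show ?thesis using that by simp
  qed
  then show ?thesis by (subst v) (intro sum.cong, auto)
qed

text \<open>Hermitian symmetry is read off the orthonormal basis: by Parseval the form is the
  standard one in the coordinates.\<close>

lemma ipU_cnj: "ipU D v w = cnj (ipU D w v)"
proof -
  obtain B where B: "clin B" "\<And>v w. ipU D v w = cip v (B w)" by (rule ipU_eq[OF pos_gen]) blast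
  have left: "ipU D (\<Sum>k\<in>S. cscale (c k) (f k)) w = (\<Sum>k\<in>S. cnj (c k) * ipU D (f k) w)" for S :: "nat set" and c f w
    unfolding B(2) cip_cnj[of _ "B w"] by (simp add: cip_sum cip_cscale)
  have e: "ipU D v (bas D k) = cnj (coord v k)" if "k \<in> letters D" for k v
  proof -
    have "ipU D v (bas D k) = (\<Sum>l\<in>letters D. cnj (coord v l) * ipU D (bas D l) (bas D k))"
      by (subst expand[of v]) (rule left)
    also have "\<dots> = (\<Sum>l\<in>letters D. if l = k then cnj (coord v l) else 0)"
      by (rule sum.cong) (use that ipU_bas[OF aw_setup] in auto)
    finally show ?thesis using that by simp
  qed
  have "ipU D v w = (\<Sum>k\<in>letters D. cnj (coord v k) * coord w k)" for v w
    unfolding ipU_parseval[OF aw_setup, of v w, symmetric]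
    by (intro sum.cong refl arg_cong2[of _ _ _ _ "(*)"] e) (simp_all add: coord_def)
  from this[of v w] this[of w v] show ?thesis by (simp add: mult.commute)
qed

lemma coord_cnj: "cnj (coord \<xi> k) = ipU D \<xi> (bas D k)"
  unfolding coord_def by (rule ipU_cnj[symmetric])

lemma coord_add: "coord (v + w) k = coord v k + coord w k"
  by (simp add: coord_def ipU_add)

lemma coord_cscale: "coord (cscale c v) k = c * coord v k"
  by (simp add: coord_def ipU_cscale)

section \<open>Components along the decomposition\<close>

definition pcomp :: "'i \<Rightarrow> 'a \<times> 'a \<Rightarrow> 'a \<times> 'a" where
  "pcomp i v = (\<Sum>k\<in>{k \<in> letters D. dg D k = i}. cscale (coord v k) (bas D k))"

lemma HR_subspace: "i \<in> inds D \<Longrightarrow> subspace (HR D i)"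
  using aw_setup by (simp add: aw_setup_def)

lemma HR_orth: "i \<in> inds D \<Longrightarrow> j \<in> inds D \<Longrightarrow> i \<noteq> j \<Longrightarrow> x \<in> HR D i \<Longrightarrow> y \<in> HR D j \<Longrightarrow> x \<bullet> y = 0"
proof -
  have "\<forall>i\<in>inds D. \<forall>j\<in>inds D. i \<noteq> j \<longrightarrow> (\<forall>x\<in>HR D i. \<forall>y\<in>HR D j. x \<bullet> y = 0)"
    using aw_setup unfolding aw_setup_def by (elim conjE) assumption
  then show "i \<in> inds D \<Longrightarrow> j \<in> inds D \<Longrightarrow> i \<noteq> j \<Longrightarrow> x \<in> HR D i \<Longrightarrow> y \<in> HR D j \<Longrightarrow> x \<bullet> y = 0"
    by blast
qed

lemma bas_HR: "k \<in> letters D \<Longrightarrow> fst (bas D k) \<in> HR D (dg D k) \<and> snd (bas D k) \<in> HR D (dg D k)"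
proof -
  have "\<forall>k\<in>{1..DIM('a)}. dg D k \<in> inds D \<and> bas D k \<in> HR D (dg D k) \<times> HR D (dg D k)"
    using aw_setup unfolding aw_setup_def by (elim conjE) assumption
  then show "k \<in> letters D \<Longrightarrow> fst (bas D k) \<in> HR D (dg D k) \<and> snd (bas D k) \<in> HR D (dg D k)"
    by (simp add: mem_Times_iff)
qed

lemma comp_HR: 
  assumes "i \<in> inds D" shows "fst (pcomp i v) \<in> HR D i" "snd (pcomp i v) \<in> HR D i"
proof -
  note S = HR_subspace[OF assms]
  have "fst (cscale c (bas D k)) \<in> HR D i \<and> snd (cscale c (bas D k)) \<in> HR D i"
    if "k \<in> letters D" "dg D k = i" for c k
    using bas_HR[OF that(1)] that(2) S by (auto simp: cscale_def subspace_add subspace_diff subspace_scale)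
  then show "fst (pcomp i v) \<in> HR D i" "snd (pcomp i v) \<in> HR D i"
    unfolding pcomp_def fst_sum snd_sum by (auto intro!: subspace_sum[OF S])
qed

lemma comp_sum: "(\<Sum>i\<in>inds D. pcomp i v) = v"
proof -
  have "dg D ` letters D \<subseteq> inds D" using dg_inds by blast
  from sum.group[OF finite_atLeastAtMost finite_inds this, of "\<lambda>k. cscale (coord v k) (bas D k)"]
  show ?thesis unfolding pcomp_def expand[of v, symmetric] .
qed

text \<open>Here p picks the real or the imaginary part. That part of the i-th component lies in
  \<open>HR D i\<close> and is orthogonal to the others, so its inner product with p v is its own
  squared length.\<close>

lemma comp_part_zero:
  assumes proj: "(\<And>x y. p (x + y) = p x + p y)" "p 0 = 0" "p = fst \<or> p = snd"
    and i: "i \<in> inds D" and v: "\<And>x. x \<in> HR D i \<Longrightarrow> x \<bullet> p v = 0"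
  shows "p (pcomp i v) = (0::'a)"
proof -
  have pH: "p (pcomp j v) \<in> HR D j" if "j \<in> inds D" for j
    using comp_HR[OF that, of v] proj(3) by auto
  have ps: "p (\<Sum>j\<in>S. pcomp j v) = (\<Sum>j\<in>S. p (pcomp j v))" for S
    by (induction S rule: infinite_finite_induct) (simp_all add: proj)
  have "0 = p (pcomp i v) \<bullet> p v" using v[OF pH[OF i]] by simp
  also have "p v = (\<Sum>j\<in>inds D. p (pcomp j v))" using ps[of "inds D"] by (simp add: comp_sum)
  also have "p (pcomp i v) \<bullet> \<dots> = (\<Sum>j\<in>inds D. if j = i then p (pcomp i v) \<bullet> p (pcomp i v) else 0)"
    unfolding inner_sum_right using HR_orth[OF i _ _ pH[OF i] pH] by (intro sum.cong) auto
  also have "\<dots> = p (pcomp i v) \<bullet> p (pcomp i v)" using i finite_inds by simp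
  finally show ?thesis by simp
qed

lemma comp_real:
  assumes "i \<in> inds D" shows "snd (pcomp i (x, 0)) = 0"
  by (rule comp_part_zero[OF _ _ _ assms]) auto

lemma comp_homogeneous:
  assumes "i \<in> inds D" "j \<in> inds D" "i \<noteq> j" "fst v \<in> HR D j" "snd v \<in> HR D j"
  shows "pcomp i v = 0"
proof (rule prod_eqI)
  show "fst (pcomp i v) = fst 0"
    using comp_part_zero[of fst i v] HR_orth[OF assms(1-3)] assms by auto
  show "snd (pcomp i v) = snd 0"
    using comp_part_zero[of snd i v] HR_orth[OF assms(1-3)] assms by auto
qed

lemma ipU_comp: "ipU D (pcomp i v) w = (\<Sum>k\<in>{k \<in> letters D. dg D k = i}. cnj (coord v k) * coord w k)"
  unfolding ipU_cnj[of "pcomp i v"] unfolding pcomp_def ipU_sum ipU_cscale cnj_sum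
  by (intro sum.cong refl) (simp flip: coord_cnj)

text \<open>A component is the complexification of a real subspace, so with e_k it contains the
  conjugate vector, whose projection to any other component vanishes. In \<open>D_basis_odd\<close>
  this matches the q-factors of paired letters.\<close>

lemma coord_bar_homogeneous:
  assumes k: "k \<in> letters D" and l: "l \<in> letters D" and "dg D k \<noteq> dg D l"
  shows "coord (cconj (bas D k)) l = 0"
proof -
  let ?v = "cconj (bas D k)"
  have "snd ?v \<in> HR D (dg D k)"
    using bas_HR[OF k] HR_subspace[OF dg_inds[OF k]] by (simp add: cconj_def subspace_neg)
  then have 0: "pcomp (dg D l) ?v = 0"
    using bas_HR[OF k] assms by (intro comp_homogeneous[of _ "dg D k"] dg_inds) (auto simp: cconj_def)
  have "ipU D (pcomp (dg D l) ?v) (bas D l) = (\<Sum>k\<in>{k \<in> letters D. dg D k = dg D l}. if k = l then cnj (coord ?v k) else 0)"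
    unfolding ipU_comp using coord_bas[OF l] by (intro sum.cong) auto
  also have "\<dots> = cnj (coord ?v l)" using l by simp
  finally have "cnj (coord ?v l) = ipU D 0 (bas D l)" by (simp add: 0)
  also have "\<dots> = 0" using ipU_cnj[of 0 "bas D l"] ipU_sum[of "bas D l" id "{}"] by simp
  finally show ?thesis by simp
qed

text \<open>With \<open>\<langle>v, w\<rangle>\<^sub>U = \<langle>v, B w\<rangle>\<close>, the real subspace dual to the real vectors is \<open>B\<^sup>-\<^sup>1\<close> of the
  real vectors.\<close>

lemma dual_real:
  obtains \<eta> :: "'a \<Rightarrow> 'a \<times> 'a" where "\<And>x y i. i \<in> inds D \<Longrightarrow>
      Im (\<Sum>k\<in>{k \<in> letters D. dg D k = i}. cnj (coord (x, 0) k) * coord (\<eta> y) k) = 0"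
    and "\<And>v. \<exists>y z. v = \<eta> y + cscale \<i> (\<eta> z)"
proof -
  obtain B where B: "clin B" "\<And>v w. ipU D v w = cip v (B w)" by (rule ipU_eq[OF pos_gen]) blast
  have "B v \<noteq> 0" if "v \<noteq> 0" for v
  proof
    assume "B v = 0"
    then have "coord v k = 0" for k by (simp add: coord_def B(2) cip_def complex_eq_iff)
    then have "v = 0" by (subst expand) (simp add: cscale_def flip: zero_prod_def)
    then show False using that by simp
  qed
  note BI = clin_inv[OF B(1) this]
  have BB: "B (inv B v) = v" "inv B (B v) = v" for v
    using BI(1) by (simp_all add: bij_is_surj surj_f_inv_f bij_is_inj)
  show ?thesis
  proof (rule that[of "\<lambda>y. inv B (y, 0)"])
    fix x y i assume i: "i \<in> inds D"
    \<comment> \<open>B cancels its inverse and leaves the plain inner product of two real vectors,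
      because components of real vectors are real.\<close>
    have "Im (ipU D (pcomp i (x, 0)) (inv B (y, 0))) = 0"
      by (simp add: B(2) BB cip_def comp_real[OF i])
    then show "Im (\<Sum>k\<in>{k \<in> letters D. dg D k = i}. cnj (coord (x, 0) k) * coord (inv B (y, 0)) k) = 0"
      by (simp only: ipU_comp)
  next
    fix v
    have "B v = (fst (B v), 0) + cscale \<i> (snd (B v), 0)" by (simp add: cscale_def prod_eq_iff)
    then have "v = inv B (fst (B v), 0) + cscale \<i> (inv B (snd (B v), 0))"
      using BI(2) BB(2)[of v] unfolding clin_def by metis
    then show "\<exists>y z. v = inv B (y, 0) + cscale \<i> (inv B (z, 0))" by blast
  qed
qed

section \<open>Right creation and annihilation\<close>

definition flip :: "fvec \<Rightarrow> fvec" where "flip f w = f (rev w)"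

lemma flip_flip [simp]: "flip (flip f) = f"
  by (simp add: flip_def fun_eq_iff)

lemma flip_app: "flip f w = f (rev w)"
  by (simp add: flip_def)

lemma rev_words [simp]: "rev w \<in> words D n \<longleftrightarrow> w \<in> words D n"
  by (simp add: words_def)

lemma fm_flip: "fm n (flip f) (flip g) = fm n f g"
proof -
  have "fm n (flip f) (flip g) = (\<Sum>w\<in>words D n. cnj (f (rev w)) * Pn D n g (rev w))"
    unfolding ipT_deg_def by (intro sum.cong refl) (simp add: flip_def[abs_def] Pn_rev)
  also have "\<dots> = fm n f g"
    unfolding ipT_deg_def by (rule sum.reindex_bij_witness[of _ rev rev]) auto
  finally show ?thesis .
qed

lemma flip_Fock [simp]: "flip f \<in> Fock D \<longleftrightarrow> f \<in> Fock D"
proof -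
  have "supp_words (flip f) \<longleftrightarrow> supp_words f"
    unfolding supp_words_def flip_def by (metis length_rev rev_rev_ident rev_words)
  then show ?thesis by (simp add: Fock_iff fm_flip)
qed

lemma ipT_flip: "ipT D (flip f) (flip g) = ipT D f g"
  by (simp add: ipT_def fm_flip)

lemma normT_flip: "normT D (flip f) = normT D f"
  by (simp add: normT_def ipT_flip)

section \<open>Commutators of left and right operators\<close>

definition comm_weight :: "(nat \<Rightarrow> complex) \<Rightarrow> (nat \<Rightarrow> complex) \<Rightarrow> nat list \<Rightarrow> complex" where
  "comm_weight c b w = (\<Sum>l\<in>letters D. cnj (c l) * b l * q_word l w)"

definition rcre :: "(nat \<Rightarrow> complex) \<Rightarrow> fvec \<Rightarrow> fvec" where "rcre c f = flip (cre c (flip f))"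
definition rann :: "(nat \<Rightarrow> complex) \<Rightarrow> fvec \<Rightarrow> fvec" where "rann c f = flip (ann c (flip f))"

lemma rcre_snoc: "rcre c f (w @ [k]) = (if k \<in> letters D then c k * f w else 0)"
  by (simp add: rcre_def flip_def cre_def)

lemma rcre_Nil: "rcre c f [] = 0"
  by (simp add: rcre_def flip_def cre_def)

lemma cre_Nil: "cre c f [] = 0"
  by (simp add: cre_def)

lemma rann_eq: "rann c f w = (\<Sum>l\<in>letters D. cnj (c l) *
    (\<Sum>k\<le>length w. q_word l (drop k w) * f (take k w @ l # drop k w)))"
proof -
  have "RR (flip f) (l # rev w) = (\<Sum>k\<le>length w. q_word l (drop k w) * f (take k w @ l # drop k w))" for l
    unfolding RR_simps
    by (rule sum.reindex_bij_witness[of _ "\<lambda>k. length w - k" "\<lambda>k. length w - k"])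
      (auto simp: flip_def take_rev drop_rev)
  then show ?thesis by (simp add: rann_def ann_def flip_app)
qed

lemma cre_rcre: "cre b (rcre c f) = rcre c (cre b f)"
proof
  fix w
  show "cre b (rcre c f) w = rcre c (cre b f) w"
  proof (cases w)
    case Nil
    then show ?thesis by (simp add: rcre_Nil cre_Nil)
  next
    case (Cons a v)
    show ?thesis
    proof (cases v rule: rev_cases)
      case Nil
      have "rcre c (cre b f) ([] @ [a]) = 0" by (simp only: rcre_snoc cre_Nil) simp
      then show ?thesis using Cons Nil by (simp add: cre_def rcre_Nil)
    next
      case (snoc u z)
      have "rcre c (cre b f) ((a # u) @ [z]) = (if z \<in> letters D then c z * cre b f (a # u) else 0)"
        by (rule rcre_snoc)
      moreover have "cre b (rcre c f) (a # (u @ [z])) = (if a \<in> letters D then b a * rcre c f (u @ [z]) else 0)"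
        by (simp add: cre_def)
      ultimately show ?thesis using Cons snoc by (simp add: rcre_snoc) (simp add: cre_def)
    qed
  qed
qed

text \<open>In coordinates right annihilation inserts a letter. Inserted in front, that letter meets
  the created vector, and its q-factors with the whole word give the commutator term; at every other
  place creation strips the same first letter as before.\<close>

lemma rann_cre:
  assumes w: "w \<in> words D n"
  shows "rann c (cre b f) w = cre b (rann c f) w + comm_weight c b w * f w"
proof (cases w)
  case Nil
  then show ?thesis by (simp add: rann_eq comm_weight_def cre_def sum_distrib_left mult_ac)
next
  case (Cons a v)
  have a: "a \<in> letters D" using w Cons by (auto simp: words_def)
  have "(\<Sum>k\<le>length w. q_word l (drop k w) * cre b f (take k w @ l # drop k w)) =
      b l * q_word l w * f w + b a * (\<Sum>k\<le>length v. q_word l (drop k v) * f (take k v @ l # drop k v))"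
    if l: "l \<in> letters D" for l
  proof -
    have "(\<Sum>k\<le>length w. q_word l (drop k w) * cre b f (take k w @ l # drop k w)) =
        q_word l w * cre b f (l # w) + (\<Sum>k\<le>length v. q_word l (drop (Suc k) w) * cre b f (take (Suc k) w @ l # drop (Suc k) w))"
      unfolding Cons length_Cons sum.atMost_Suc_shift by simp
    also have "\<dots> = q_word l w * (b l * f w) + (\<Sum>k\<le>length v. b a * (q_word l (drop k v) * f (take k v @ l # drop k v)))"
      unfolding Cons by (simp add: cre_Cons[OF a] cre_Cons[OF l] mult_ac)
    finally show ?thesis by (simp add: sum_distrib_left mult_ac)
  qed
  then have "rann c (cre b f) w = (\<Sum>l\<in>letters D. cnj (c l) * b l * q_word l w * f w +
      b a * (cnj (c l) * (\<Sum>k\<le>length v. q_word l (drop k v) * f (take k v @ l # drop k v))))"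
    unfolding rann_eq[of c "cre b f"] by (intro sum.cong refl) (simp add: algebra_simps)
  also have "\<dots> = comm_weight c b w * f w + b a * rann c f v"
    unfolding rann_eq[of c f v] comm_weight_def by (simp add: sum.distrib sum_distrib_left sum_distrib_right)
  finally show ?thesis using Cons by (simp add: cre_Cons[OF a])
qed

lemma comm_weight_rev [simp]: "comm_weight c b (rev w) = comm_weight c b w"
  by (simp add: comm_weight_def)

lemma ann_rcre:
  assumes w: "w \<in> words D n"
  shows "ann c (rcre b f) w = rcre b (ann c f) w + comm_weight c b w * f w"
  using rann_cre[of "rev w" n c b "flip f"] w
  by (simp add: rcre_def rann_def flip_app)

lemma rcre_Fock: "f \<in> Fock D \<Longrightarrow> rcre c f \<in> Fock D"
  by (simp add: rcre_def cre_Fock)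

lemma rann_Fock: "f \<in> Fock D \<Longrightarrow> rann c f \<in> Fock D"
  by (simp add: rann_def ann_Fock)

lemma ipT_radj:
  assumes "f \<in> Fock D" "g \<in> Fock D"
  shows "ipT D (rcre c f) g = ipT D f (rann c g)"
proof -
  have "ipT D (rcre c f) g = ipT D (cre c (flip f)) (flip g)"
    unfolding rcre_def using ipT_flip[of "cre c (flip f)" "flip g"] by simp
  also have "\<dots> = ipT D (flip f) (ann c (flip g))" by (rule ipT_adj) (simp_all add: assms)
  also have "\<dots> = ipT D f (rann c g)"
    unfolding rann_def using ipT_flip[of f "flip (ann c (flip g))"] by simp
  finally show ?thesis .
qed

text \<open>Adjoint of the fact that left and right creation commute.\<close>

lemma ann_rann:
  assumes f: "f \<in> Fock D" shows "ann b (rann c f) = rann c (ann b f)"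
proof (rule ipT_unique[of _ _ "Fock D"])
  note F = ann_Fock(1) rann_Fock cre_Fock(1) rcre_Fock
  show "ann b (rann c f) \<in> Fock D" "rann c (ann b f) \<in> Fock D" by (intro F f)+
  fix h assume h: "h \<in> Fock D"
  have "ipT D h (ann b (rann c f)) = ipT D h (rann c (ann b f))"
    using ipT_adj[OF h, of "rann c f" b] ipT_radj[of "cre b h" f c]
      ipT_radj[OF h, of "ann b f" c] ipT_adj[of "rcre c h" f b] F f h
    by (simp add: cre_rcre)
  then show "ipT D (ann b (rann c f)) h = ipT D (rann c (ann b f)) h"
    using FF.B_cnj[OF _ h, of "ann b (rann c f)"] FF.B_cnj[OF _ h, of "rann c (ann b f)"] F f by simp
qed (auto simp: e_word_Fock)

lemma supp_eqI:
  assumes "f \<in> Fock D" "g \<in> Fock D" "\<And>w n. w \<in> words D n \<Longrightarrow> f w = g w" shows "f = g"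
proof
  fix w
  show "f w = g w"
  proof (cases "w \<in> words D (length w)")
    case False
    then have "f w = 0" "g w = 0" using assms(1,2) supp_wordsD unfolding Fock_iff by auto
    then show ?thesis by simp
  qed (rule assms(3))
qed

lemma ann_add: "ann c (\<lambda>w. f w + d * g w) w = ann c f w + d * ann c g w"
proof -
  have "RR (\<lambda>w. f w + d * g w) v = RR f v + d * RR g v" for v
    by (cases v) (simp_all add: sum.distrib sum_distrib_left algebra_simps)
  then show ?thesis by (simp add: ann_def sum.distrib sum_distrib_left algebra_simps)
qed

lemma cre_add: "cre c (\<lambda>w. f w + d * g w) w = cre c f w + d * cre c g w"
  by (auto simp: cre_def algebra_simps split: list.splits)

text \<open>Two coefficient families are needed because the field operator of e_k creates e_k but
  annihilates with its conjugate.\<close>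

definition gauss :: "(nat \<Rightarrow> complex) \<Rightarrow> (nat \<Rightarrow> complex) \<Rightarrow> fvec \<Rightarrow> fvec" where
  "gauss c d f = (if f \<in> Fock D then (\<lambda>w. cre c f w + ann d f w) else (\<lambda>w. 0))"

definition rgauss :: "(nat \<Rightarrow> complex) \<Rightarrow> (nat \<Rightarrow> complex) \<Rightarrow> fvec \<Rightarrow> fvec" where
  "rgauss c d f = flip (gauss c d (flip f))"

lemma gauss_in: "f \<in> Fock D \<Longrightarrow> gauss c d f = (\<lambda>w. cre c f w + ann d f w)"
  by (simp add: gauss_def)

lemma gauss_Fock [simp]: "gauss c d f \<in> Fock D"
  by (auto simp: gauss_def cre_Fock ann_Fock intro!: Fock_add)

lemma normT_gauss_le: "f \<in> Fock D \<Longrightarrow> normT D (gauss c d f) \<le> (sqrt (cre_sqnorm c) + sqrt (cre_sqnorm d)) * normT D f"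
  unfolding gauss_in
  using normT_add[of "cre c f" "ann d f"] cre_Fock[of f c] ann_Fock[of f d]
  by (simp add: distrib_right)

lemma gauss_lin:
  assumes "f \<in> Fock D" "g \<in> Fock D"
  shows "gauss c d (\<lambda>w. f w + e * g w) = (\<lambda>w. gauss c d f w + e * gauss c d g w)"
  unfolding gauss_in[OF assms(1)] gauss_in[OF assms(2)] gauss_in[OF Fock_lin[OF assms]]
  by (simp add: fun_eq_iff cre_add ann_add algebra_simps)

lemma gauss_bops: "gauss c d \<in> bops D"
proof -
  have "gauss c d f = (\<lambda>w. 0)" if "f \<notin> Fock D" for f using that by (simp add: gauss_def)
  then show ?thesis unfolding bops_def using normT_gauss_le[of _ c d] gauss_lin[of _ _ c d] gauss_Fock[of c d] by blast
qed

lemma rgauss_bops: "rgauss c d \<in> bops D"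
proof -
  have "rgauss c d (\<lambda>w. f w + e * g w) = (\<lambda>w. rgauss c d f w + e * rgauss c d g w)"
    if "f \<in> Fock D" "g \<in> Fock D" for f g e
  proof -
    have "flip (\<lambda>w. f w + e * g w) = (\<lambda>w. flip f w + e * flip g w)" by (simp add: flip_def fun_eq_iff)
    then show ?thesis using gauss_lin[of "flip f" "flip g" c d e] that by (simp add: rgauss_def) (simp add: flip_def[abs_def])
  qed
  moreover have "normT D (rgauss c d f) \<le> (sqrt (cre_sqnorm c) + sqrt (cre_sqnorm d)) * normT D f" if "f \<in> Fock D" for f
    using normT_gauss_le[of "flip f" c d] that by (simp add: rgauss_def normT_flip)
  moreover have "rgauss c d f = (\<lambda>w. 0)" if "f \<notin> Fock D" for f
    using that by (simp add: rgauss_def gauss_def) (simp add: flip_def[abs_def])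
  moreover have "rgauss c d f \<in> Fock D" for f by (simp add: rgauss_def)
  ultimately show ?thesis unfolding bops_def by blast
qed

lemma rgauss_in: "f \<in> Fock D \<Longrightarrow> rgauss c d f = (\<lambda>w. rcre c f w + rann d f w)"
  by (simp add: rgauss_def gauss_in rcre_def rann_def) (simp add: flip_def[abs_def])

text \<open>Only creation against annihilation from the opposite side fails to commute. The two
  commutators are \<open>comm_weight b c\<close> and \<open>comm_weight c b\<close>, they enter with
  opposite signs, and so they cancel when these weights agree.\<close>

lemma gauss_rgauss_commute:
  assumes "\<And>w n. w \<in> words D n \<Longrightarrow> comm_weight b c w = comm_weight c b w"
  shows "gauss b b \<circ> rgauss c c = rgauss c c \<circ> gauss b b"
proof
  fix f
  show "(gauss b b \<circ> rgauss c c) f = (rgauss c c \<circ> gauss b b) f"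
  proof (cases "f \<in> Fock D")
    case False
    have "RR (\<lambda>w. 0) v = 0" for v by (cases v) auto
    then have "gauss b b (\<lambda>w. 0) = (\<lambda>w. 0)" for b
      by (simp add: gauss_in cre_def ann_def fun_eq_iff split: list.splits)
    moreover have "flip (\<lambda>w. 0) = (\<lambda>w. 0)" by (simp add: flip_def fun_eq_iff)
    moreover have "gauss b b f = (\<lambda>w. 0)" "gauss c c (flip f) = (\<lambda>w. 0)" using False by (simp_all add: gauss_def)
    ultimately show ?thesis by (simp add: rgauss_def)
  next
    case f: True
    note F = ann_Fock(1) rann_Fock cre_Fock(1) rcre_Fock
    have L: "gauss b b (rgauss c c f) w = cre b (rcre c f) w + cre b (rann c f) w + ann b (rcre c f) w + ann b (rann c f) w" for w
      using gauss_lin[of "rcre c f" "rann c f" b b 1] F f by (simp add: rgauss_in gauss_in)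
    have R: "rgauss c c (gauss b b f) w = rcre c (cre b f) w + rcre c (ann b f) w + rann c (cre b f) w + rann c (ann b f) w" for w
    proof -
      have 1: "rcre c (gauss b b f) w = rcre c (cre b f) w + rcre c (ann b f) w" 
        using cre_add[of c "flip (cre b f)" 1 "flip (ann b f)"] f
        by (simp add: rcre_def gauss_in flip_def[abs_def])
      have 2: "rann c (gauss b b f) w = rann c (cre b f) w + rann c (ann b f) w" 
        using ann_add[of c "flip (cre b f)" 1 "flip (ann b f)"] f
        by (simp add: rann_def gauss_in flip_def[abs_def])
      show ?thesis unfolding rgauss_in[OF gauss_Fock] 1 2 by simp
    qed
    show ?thesis
    proof (rule supp_eqI)
      fix w n assume w: "w \<in> words D n"
      show "(gauss b b \<circ> rgauss c c) f w = (rgauss c c \<circ> gauss b b) f w"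
        unfolding comp_def L R cre_rcre ann_rann[OF f] rann_cre[OF w] ann_rcre[OF w] assms[OF w] by simp
    qed (simp_all add: rgauss_def)
  qed
qed

end

section \<open>The algebra and its commutant\<close>

lemma ins_eq_iff:
  assumes "k \<le> length x"
  shows "take k x @ b # drop k x = v \<longleftrightarrow>
    length v = Suc (length x) \<and> b = v ! k \<and> x = take k v @ drop (Suc k) v"
proof
  assume v: "take k x @ b # drop k x = v"
  show "length v = Suc (length x) \<and> b = v ! k \<and> x = take k v @ drop (Suc k) v"
    unfolding v[symmetric] using assms by (simp add: nth_append min_absorb2)
next
  assume v: "length v = Suc (length x) \<and> b = v ! k \<and> x = take k v @ drop (Suc k) v"
  then have 1: "take k x = take k v" "drop k x = drop (Suc k) v"
    using assms by (metis append_eq_conv_conj length_take min_absorb2 le_SucI)+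
  have 2: "b = v ! k" using v by simp
  show "take k x @ b # drop k x = v"
    unfolding 1 2 by (rule id_take_nth_drop[symmetric]) (use v assms in linarith)
qed

context aw begin

lemma crea_anni_eq: "(\<lambda>f w. anni D \<xi> f w + crea D \<xi> f w) = gauss (coord \<xi>) (coord \<xi>)"
proof (intro ext)
  fix f w
  show "anni D \<xi> f w + crea D \<xi> f w = gauss (coord \<xi>) (coord \<xi>) f w"
  proof (cases "f \<in> Fock D")
    case True
    then show ?thesis by (simp add: anni_eq crea_eq gauss_in coord_def[abs_def])
  next
    case False
    then show ?thesis by (simp add: anni_out crea_out gauss_def)
  qed
qed

lemma adj_gauss: "adj D (gauss c c) = gauss c c"
proof
  fix f
  show "adj D (gauss c c) f = gauss c c f"
  proof (cases "f \<in> Fock D")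
    case f: True
    show ?thesis
    proof (rule adj_eqI[OF f gauss_Fock])
      fix g assume g: "g \<in> Fock D"
      note C = cre_Fock(1)[OF f, of c] and A = ann_Fock(1)[OF f, of c]
        and C' = cre_Fock(1)[OF g, of c] and A' = ann_Fock(1)[OF g, of c]
      have "ipT D (gauss c c f) g = ipT D (cre c f) g + ipT D (ann c f) g"
        using FF.B_lin_left[OF C A g, of 1] by (simp add: gauss_in[OF f])
      also have "ipT D (cre c f) g = ipT D f (ann c g)" by (rule ipT_adj[OF f g])
      also have "ipT D (ann c f) g = ipT D f (cre c g)"
        using FF.B_cnj[OF A g] FF.B_cnj[OF f C'] ipT_adj[OF g f, of c] by simp
      also have "ipT D f (ann c g) + ipT D f (cre c g) = ipT D f (gauss c c g)"
        using FF.B_lin[OF f C' A', of 1] by (simp add: gauss_in[OF g])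
      finally show "ipT D (gauss c c f) g = ipT D f (gauss c c g)" .
    qed
  next
    case False
    then show ?thesis by (simp add: adjoint_on_def gauss_def)
  qed
qed

section \<open>Bounded operators and the bicommutant\<close>

definition gens :: "(fvec \<Rightarrow> fvec) set" where
  "gens = range (\<lambda>x. gauss (coord (x, 0)) (coord (x, 0)))"

text \<open>The generating field operators are self-adjoint, so the adjoints in
  \<open>vN_gen\<close> add nothing new.\<close>

lemma MT_eq: "MT D = commutant D (commutant D gens)"
proof -
  have "adj D ` gens = gens" unfolding gens_def image_image adj_gauss ..
  then show ?thesis unfolding MT_def vN_gen_def crea_anni_eq gens_def[symmetric] by simp
qed

lemma bops_Fock: "X \<in> bops D \<Longrightarrow> X f \<in> Fock D"
  unfolding bops_def by (cases "f \<in> Fock D") auto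

lemma bops_out: "X \<in> bops D \<Longrightarrow> f \<notin> Fock D \<Longrightarrow> X f = (\<lambda>w. 0)"
  unfolding bops_def by auto

lemma bops_lin: "X \<in> bops D \<Longrightarrow> f \<in> Fock D \<Longrightarrow> g \<in> Fock D \<Longrightarrow>
    X (\<lambda>w. f w + c * g w) = (\<lambda>w. X f w + c * X g w)"
  unfolding bops_def by auto

lemma bops_zero: "X \<in> bops D \<Longrightarrow> X (\<lambda>w. 0) = (\<lambda>w. 0)"
  using bops_lin[of X "\<lambda>w. 0" "\<lambda>w. 0" "-1"] by (simp add: fun_eq_iff)

lemma bops_diff: "X \<in> bops D \<Longrightarrow> f \<in> Fock D \<Longrightarrow> g \<in> Fock D \<Longrightarrow>
    X (\<lambda>w. f w - g w) = (\<lambda>w. X f w - X g w)"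
  using bops_lin[of X f g "-1"] by simp

lemma bops_bound:
  assumes "X \<in> bops D"
  obtains K where "0 \<le> K" "\<And>f. f \<in> Fock D \<Longrightarrow> normT D (X f) \<le> K * normT D f"
proof -
  obtain K where K: "\<And>f. f \<in> Fock D \<Longrightarrow> normT D (X f) \<le> K * normT D f"
    using assms unfolding bops_def mem_Collect_eq by blast
  show ?thesis
  proof (rule that[of "\<bar>K\<bar>"])
    fix f assume f: "f \<in> Fock D"
    have "K * normT D f \<le> \<bar>K\<bar> * normT D f" by (intro mult_right_mono normT_nonneg f) simp
    then show "normT D (X f) \<le> \<bar>K\<bar> * normT D f" using K[OF f] by linarith
  qed simp
qed

lemma bopsI:
  assumes "\<And>f. f \<in> Fock D \<Longrightarrow> X f \<in> Fock D"
    and "\<And>f g c. f \<in> Fock D \<Longrightarrow> g \<in> Fock D \<Longrightarrow> X (\<lambda>w. f w + c * g w) = (\<lambda>w. X f w + c * X g w)"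
    and "\<And>f. f \<in> Fock D \<Longrightarrow> normT D (X f) \<le> K * normT D f"
    and "\<And>f. f \<notin> Fock D \<Longrightarrow> X f = (\<lambda>w. 0)"
  shows "X \<in> bops D"
  unfolding bops_def using assms by blast

lemma bops_add:
  assumes X: "X \<in> bops D" and Y: "Y \<in> bops D"
  shows "(\<lambda>f w. X f w + c * Y f w) \<in> bops D"
proof -
  obtain K where K: "0 \<le> K" "\<And>f. f \<in> Fock D \<Longrightarrow> normT D (X f) \<le> K * normT D f"
    by (rule bops_bound[OF X]) blast
  obtain L where L: "0 \<le> L" "\<And>f. f \<in> Fock D \<Longrightarrow> normT D (Y f) \<le> L * normT D f"
    by (rule bops_bound[OF Y]) blast
  show ?thesis
  proof (rule bopsI[where K = "K + cmod c * L"])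
    fix f assume f: "f \<in> Fock D"
    have "normT D (\<lambda>w. X f w + c * Y f w) \<le> normT D (X f) + cmod c * normT D (Y f)"
      by (intro normT_lin bops_Fock X Y)
    also have "\<dots> \<le> K * normT D f + cmod c * (L * normT D f)"
      by (intro add_mono mult_left_mono K L f) simp
    finally show "normT D (\<lambda>w. X f w + c * Y f w) \<le> (K + cmod c * L) * normT D f"
      by (simp add: algebra_simps)
    show "(\<lambda>w. X f w + c * Y f w) \<in> Fock D" by (rule Fock_lin[OF bops_Fock[OF X] bops_Fock[OF Y]])
  qed (simp_all add: bops_lin[OF X] bops_lin[OF Y] bops_out[OF X] bops_out[OF Y] algebra_simps)
qed

lemma bops_comp:
  assumes X: "X \<in> bops D" and Y: "Y \<in> bops D"
  shows "X \<circ> Y \<in> bops D"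
proof -
  obtain K where K: "0 \<le> K" "\<And>f. f \<in> Fock D \<Longrightarrow> normT D (X f) \<le> K * normT D f"
    by (rule bops_bound[OF X]) blast
  obtain L where L: "0 \<le> L" "\<And>f. f \<in> Fock D \<Longrightarrow> normT D (Y f) \<le> L * normT D f"
    by (rule bops_bound[OF Y]) blast
  show ?thesis
  proof (rule bopsI[where K = "K * L"])
    fix f assume f: "f \<in> Fock D"
    have "normT D (X (Y f)) \<le> K * normT D (Y f)" by (intro K bops_Fock Y)
    also have "\<dots> \<le> K * (L * normT D f)" by (intro mult_left_mono K L f)
    finally show "normT D ((X \<circ> Y) f) \<le> K * L * normT D f" by (simp add: mult.assoc)
  qed (simp_all add: bops_Fock[OF X] bops_Fock[OF Y] bops_lin[OF X] bops_lin[OF Y] bops_out[OF Y] bops_zero[OF X])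
qed

lemma commutant_bops: "X \<in> commutant D S \<Longrightarrow> X \<in> bops D"
  by (simp add: commutant_def)

lemma MT_bops: "X \<in> MT D \<Longrightarrow> X \<in> bops D"
  unfolding MT_eq by (rule commutant_bops)

lemma MT_commute: "X \<in> MT D \<Longrightarrow> Z \<in> commutant D gens \<Longrightarrow> X (Z f) = Z (X f)"
proof -
  assume "X \<in> MT D" "Z \<in> commutant D gens"
  then have "X \<circ> Z = Z \<circ> X" unfolding MT_eq commutant_def[of D "commutant D gens"] by blast
  then show ?thesis by (metis comp_apply)
qed

lemma MT_I: "X \<in> bops D \<Longrightarrow> (\<And>Z f. Z \<in> commutant D gens \<Longrightarrow> f \<in> Fock D \<Longrightarrow> X (Z f) = Z (X f)) \<Longrightarrow> X \<in> MT D"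
  unfolding MT_eq commutant_def[of D "commutant D gens"]
proof safe
  fix Z assume X: "X \<in> bops D" and Z: "Z \<in> commutant D gens"
    and c: "\<And>Z f. Z \<in> commutant D gens \<Longrightarrow> f \<in> Fock D \<Longrightarrow> X (Z f) = Z (X f)"
  show "X \<circ> Z = Z \<circ> X"
  proof
    fix f
    show "(X \<circ> Z) f = (Z \<circ> X) f"
    proof (cases "f \<in> Fock D")
      case False
      then show ?thesis using bops_out[OF X] bops_out[OF commutant_bops[OF Z]]
        bops_zero[OF X] bops_zero[OF commutant_bops[OF Z]] by simp
    qed (simp add: c[OF Z])
  qed
qed

lemma MT_add:
  assumes X: "X \<in> MT D" and Y: "Y \<in> MT D"
  shows "(\<lambda>f w. X f w + c * Y f w) \<in> MT D"
proof (rule MT_I)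
  show "(\<lambda>f w. X f w + c * Y f w) \<in> bops D" by (intro bops_add MT_bops X Y)
  fix Z f assume Z: "Z \<in> commutant D gens"
  show "(\<lambda>w. X (Z f) w + c * Y (Z f) w) = Z (\<lambda>w. X f w + c * Y f w)"
    by (simp add: MT_commute[OF X Z] MT_commute[OF Y Z] bops_lin[OF commutant_bops[OF Z]]
        bops_Fock[OF MT_bops[OF X]] bops_Fock[OF MT_bops[OF Y]])
qed

lemma MT_comp:
  assumes X: "X \<in> MT D" and Y: "Y \<in> MT D" shows "X \<circ> Y \<in> MT D"
  by (rule MT_I) (simp_all add: bops_comp MT_bops[OF X] MT_bops[OF Y] MT_commute[OF X] MT_commute[OF Y])

lemma MT_gens: "X \<in> gens \<Longrightarrow> X \<in> MT D"
proof (rule MT_I)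
  assume X: "X \<in> gens"
  show "X \<in> bops D" using X by (auto simp: gens_def gauss_bops)
  fix Z f assume "Z \<in> commutant D gens"
  then have "Z \<circ> X = X \<circ> Z" using X by (auto simp: commutant_def)
  then show "X (Z f) = Z (X f)" by (metis comp_apply)
qed

text \<open>The unit of the algebra, set to zero off the Fock space by the convention on
  operators.\<close>

lemma MT_one: "(\<lambda>f. if f \<in> Fock D then f else (\<lambda>w. 0)) \<in> MT D"
proof (rule MT_I)
  show "(\<lambda>f. if f \<in> Fock D then f else (\<lambda>w. 0)) \<in> bops D"
    by (rule bopsI[where K = 1]) (auto simp: Fock_lin)
qed (simp add: bops_Fock commutant_bops)

lemma MT_zero: "(\<lambda>f w. 0) \<in> MT D"
proof (rule MT_I)
  show "(\<lambda>f w. 0) \<in> bops D" by (rule bopsI[where K = 0]) simp_all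
qed (simp add: bops_zero commutant_bops)

section \<open>The vacuum is separating\<close>

text \<open>\<open>q_word\<close> sees the letter l only through its component, so the weight is a
  combination with real coefficients of the inner products within single components. This is why
  reality is asked for each component; conjugation then exchanges b and c.\<close>

lemma comm_weight_commute:
  assumes "\<And>i. i \<in> inds D \<Longrightarrow> Im (\<Sum>k\<in>{k \<in> letters D. dg D k = i}. cnj (b k) * c k) = 0"
  shows "comm_weight b c w = comm_weight c b w"
proof -
  have im: "Im (of_real r * z) = 0" if "Im z = 0" for r z using that by simp
  have "dg D ` letters D \<subseteq> inds D" using dg_inds by blast
  from sum.group[OF finite_atLeastAtMost finite_inds this, of "\<lambda>l. cnj (b l) * c l * q_word l w"]
  have "comm_weight b c w = (\<Sum>i\<in>inds D. \<Sum>k\<in>{k \<in> letters D. dg D k = i}. cnj (b k) * c k * q_word k w)"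
    by (simp add: comm_weight_def)
  also have "\<dots> = (\<Sum>i\<in>inds D. of_real (prod_list (map (\<lambda>x. qm D i (dg D x)) w)) *
      (\<Sum>k\<in>{k \<in> letters D. dg D k = i}. cnj (b k) * c k))"
  proof (rule sum.cong[OF refl])
    fix i
    have "q_word k w = of_real (prod_list (map (\<lambda>x. qm D i (dg D x)) w))" if "dg D k = i" for k
      using that by (induction w) (auto simp: qq_def)
    then show "(\<Sum>k\<in>{k \<in> letters D. dg D k = i}. cnj (b k) * c k * q_word k w) =
      of_real (prod_list (map (\<lambda>x. qm D i (dg D x)) w)) * (\<Sum>k\<in>{k \<in> letters D. dg D k = i}. cnj (b k) * c k)"
      unfolding sum_distrib_left by (intro sum.cong) auto
  qed
  finally have e: "comm_weight b c w = \<dots>" .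
  have "Im (comm_weight b c w) = 0" unfolding e Im_sum[of _ "inds D"] by (intro sum.neutral ballI im assms)
  moreover have "comm_weight c b w = cnj (comm_weight b c w)" by (simp add: comm_weight_def mult_ac)
  ultimately show ?thesis by (simp add: complex_eq_iff)
qed

lemma vac_eq: "vac D = e_word D []"
  by (simp add: vac_def e_word_def)

lemma vac_Fock: "vac D \<in> Fock D"
  unfolding vac_eq by (rule e_word_Fock)

lemma e_word_app: "w \<in> words D n \<Longrightarrow> e_word D w x = (if x = w then 1 else 0)"
  using e_word_eq[OF aw_setup] by simp

definition fdeg :: "nat \<Rightarrow> fvec \<Rightarrow> bool" where
  "fdeg n f \<longleftrightarrow> supp_words f \<and> (\<forall>w. f w \<noteq> 0 \<longrightarrow> length w < n)"

lemma fdeg_Fock: "fdeg n f \<Longrightarrow> f \<in> Fock D"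
proof -
  assume f: "fdeg n f"
  then have "trunc n f = f" by (auto simp: fdeg_def trunc_def fun_eq_iff)
  then show ?thesis using trunc_Fock[of f n] f by (simp add: fdeg_def)
qed

lemma fdeg_trunc: "supp_words f \<Longrightarrow> fdeg n (trunc n f)"
  by (auto simp: fdeg_def trunc_def supp_words_def)

lemma fdeg_e_word: "w \<in> words D n \<Longrightarrow> n < m \<Longrightarrow> fdeg m (e_word D w)"
  by (auto simp: fdeg_def supp_words_def e_word_app words_length)

lemma word_expansion:
  assumes "supp_words f" "\<And>x. f x \<noteq> 0 \<Longrightarrow> length x = n"
  shows "f = (\<lambda>x. \<Sum>w\<in>words D n. f w * e_word D w x)"
proof
  fix x
  have "(\<Sum>w\<in>words D n. f w * e_word D w x) = (\<Sum>w\<in>words D n. if x = w then f w else 0)"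
    by (intro sum.cong) (auto simp: e_word_app)
  also have "\<dots> = f x"
    using assms unfolding supp_words_def by (cases "f x = 0") auto
  finally show "f x = (\<Sum>w\<in>words D n. f w * e_word D w x)" ..
qed

lemma fdeg_induct:
  assumes lin: "\<And>f g c. P f \<Longrightarrow> P g \<Longrightarrow> P (\<lambda>w. f w + c * g w)" and zero: "P (\<lambda>w. 0)"
    and step: "\<And>n w. w \<in> words D n \<Longrightarrow> (\<And>f. fdeg n f \<Longrightarrow> P f) \<Longrightarrow> P (e_word D w)"
  shows "fdeg n f \<Longrightarrow> P f"
proof (induction n arbitrary: f)
  case 0
  then have "f = (\<lambda>w. 0)" by (auto simp: fdeg_def)
  then show ?case using zero by simp
next
  case (Suc n)
  have s: "supp_words f" using Suc.prems by (simp add: fdeg_def)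
  define g where "g = (\<lambda>x. if length x = n then f x else 0)"
  have "P (\<lambda>x. \<Sum>w\<in>S. g w * e_word D w x)" if "finite S" "S \<subseteq> words D n" for S
    using that
  proof (induction S rule: finite_induct)
    case (insert w S)
    have "P (e_word D w)" using insert.prems by (intro step[of w n] Suc.IH) auto
    then show ?case using lin[of "\<lambda>x. \<Sum>w\<in>S. g w * e_word D w x" "e_word D w" "g w"] insert by (simp add: add.commute)
  qed (simp add: zero)
  then have "P (\<lambda>x. \<Sum>w\<in>words D n. g w * e_word D w x)" by simp
  moreover have "g = (\<lambda>x. \<Sum>w\<in>words D n. g w * e_word D w x)"
    by (rule word_expansion) (use s in \<open>auto simp: g_def supp_words_def split: if_splits\<close>)
  ultimately have "P g" by simp
  moreover have "P (trunc n f)" by (rule Suc.IH[OF fdeg_trunc[OF s]])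
  ultimately have "P (\<lambda>w. trunc n f w + 1 * g w)" by (intro lin)
  moreover have "(\<lambda>w. trunc n f w + 1 * g w) = f"
    using Suc.prems by (auto simp: fun_eq_iff trunc_def g_def fdeg_def less_Suc_eq)
  ultimately show ?case by simp
qed

lemma rcre_e_word:
  assumes w: "w @ [k] \<in> words D n"
  shows "rcre (coord (bas D k)) (e_word D w) = e_word D (w @ [k])"
proof
  fix x
  have k: "k \<in> letters D" and w': "w \<in> words D (n - 1)" using w by (auto simp: words_def)
  show "rcre (coord (bas D k)) (e_word D w) x = e_word D (w @ [k]) x"
  proof (cases x rule: rev_cases)
    case Nil
    then show ?thesis using e_word_app[OF w] by (simp add: rcre_Nil)
  next
    case (snoc y z)
    then show ?thesis using coord_bas[OF k, of z] k
      by (auto simp: rcre_snoc e_word_app[OF w] e_word_app[OF w'])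
  qed
qed

lemma cre_e_word:
  assumes w: "k # w \<in> words D (Suc n)"
  shows "cre (coord (bas D k)) (e_word D w) = e_word D (k # w)"
proof
  fix x
  have k: "k \<in> letters D" and w': "w \<in> words D n" using w by auto
  show "cre (coord (bas D k)) (e_word D w) x = e_word D (k # w) x"
  proof (cases x)
    case Nil
    then show ?thesis using e_word_app[OF w] by (simp add: cre_Nil)
  next
    case (Cons z y)
    then show ?thesis using coord_bas[OF k, of z] k
      by (auto simp: cre_def e_word_app[OF w] e_word_app[OF w'])
  qed
qed

lemma rann_fdeg: "f \<in> Fock D \<Longrightarrow> fdeg (Suc n) f \<Longrightarrow> fdeg n (rann c f)"
  unfolding fdeg_def
proof (intro conjI allI impI)
  assume f: "f \<in> Fock D" and d: "supp_words f \<and> (\<forall>w. f w \<noteq> 0 \<longrightarrow> length w < Suc n)"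
  show "supp_words (rann c f)" using rann_Fock[OF f] by (simp add: Fock_iff)
  fix w assume nz: "rann c f w \<noteq> 0"
  show "length w < n"
  proof (rule ccontr)
    assume "\<not> length w < n"
    then have "f (take k w @ l # drop k w) = 0" for k l using d by force
    then show False using nz by (simp add: rann_eq)
  qed
qed

text \<open>X commutes with the right-hand fields, so its kernel is invariant under them. Starting
  from the vacuum, induction on the degree puts every basis word into the kernel, and truncation
  with boundedness of X does the rest.\<close>

lemma MT_separating:
  assumes X: "X \<in> MT D" and v: "X (vac D) = (\<lambda>w. 0)"
  shows "X = (\<lambda>f w. 0)"
proof -
  note Xb = MT_bops[OF X]
  obtain \<eta> :: "'a \<Rightarrow> 'a \<times> 'a" where \<eta>: "\<And>x y i. i \<in> inds D \<Longrightarrow>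
      Im (\<Sum>k\<in>{k \<in> letters D. dg D k = i}. cnj (coord (x, 0) k) * coord (\<eta> y) k) = 0"
    "\<And>v. \<exists>y z. v = \<eta> y + cscale \<i> (\<eta> z)"
    by (rule dual_real) blast
  let ?N = "\<lambda>f. f \<in> Fock D \<and> X f = (\<lambda>w. 0)"
  have N_lin: "?N (\<lambda>w. f w + c * g w)" if "?N f" "?N g" for f g c
    using that bops_lin[OF Xb, of f g c] by (simp add: Fock_lin)
  have N_rop: "?N (rgauss (coord (\<eta> y)) (coord (\<eta> y)) f)" if "?N f" for y f
  proof -
    let ?R = "rgauss (coord (\<eta> y)) (coord (\<eta> y))"
    have "?R \<in> commutant D gens"
      unfolding commutant_def gens_def
    proof (safe intro!: rgauss_bops)
      fix x
      show "?R \<circ> gauss (coord (x, 0)) (coord (x, 0)) = gauss (coord (x, 0)) (coord (x, 0)) \<circ> ?R"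
        by (rule gauss_rgauss_commute[symmetric], rule comm_weight_commute, rule \<eta>(1))
    qed
    then have "X (?R f) = ?R (X f)" by (rule MT_commute[OF X])
    then show ?thesis using that bops_zero[OF rgauss_bops] bops_Fock[OF rgauss_bops] by simp
  qed
  have N: "?N f" if "fdeg n f" for n f
    using that
  proof (rule fdeg_induct[of ?N, rotated -1])
    show "?N (\<lambda>w. 0)" by (simp add: bops_zero[OF Xb])
    fix n w assume w: "w \<in> words D n" and IH: "\<And>f. fdeg n f \<Longrightarrow> ?N f"
    show "?N (e_word D w)"
    proof (cases w rule: rev_cases)
      case Nil
      then show ?thesis using v by (simp add: vac_eq[symmetric] vac_Fock)
    next
      case (snoc u k)
      have wu: "u @ [k] \<in> words D n" using w snoc by simp
      have n: "n = Suc (length u)" and u: "u \<in> words D (length u)" using wu by (auto simp: words_def)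
      obtain y z where yz: "bas D k = \<eta> y + cscale \<i> (\<eta> z)" using \<eta>(2) by blast
      let ?e = "e_word D u"
      \<comment> \<open>Right creation is linear but right annihilation antilinear in its vector, so
        this remainder differs from the annihilator of e_k; what matters is that its degree is below
        n.\<close>
      let ?r = "\<lambda>w. rann (coord (\<eta> y)) ?e w + \<i> * rann (coord (\<eta> z)) ?e w"
      note F = e_word_Fock[of u]
      have du: "fdeg n ?e" by (rule fdeg_e_word[OF u]) (simp add: n)
      have dr: "fdeg n (rann c ?e)" for c
        using rann_fdeg[OF F, of "length u" c] fdeg_e_word[OF u, of "Suc (length u)"] unfolding n fdeg_def by force
      have Nr: "?N ?r" by (intro N_lin IH dr)
      have "?N (\<lambda>w. rgauss (coord (\<eta> y)) (coord (\<eta> y)) ?e w + \<i> * rgauss (coord (\<eta> z)) (coord (\<eta> z)) ?e w)"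
        by (intro N_lin N_rop IH du)
      from N_lin[OF this Nr, of "-1"]
      have "?N (\<lambda>w. rcre (coord (\<eta> y)) ?e w + \<i> * rcre (coord (\<eta> z)) ?e w)"
        by (simp add: rgauss_in[OF F] algebra_simps)
      moreover have "(\<lambda>w. rcre (coord (\<eta> y)) ?e w + \<i> * rcre (coord (\<eta> z)) ?e w) = rcre (coord (bas D k)) ?e"
        unfolding yz rcre_def flip_def[abs_def] cre_def
        by (auto simp: fun_eq_iff coord_add coord_cscale algebra_simps split: list.splits)
      ultimately show ?thesis unfolding snoc rcre_e_word[OF wu, symmetric] by simp
    qed
  qed (rule N_lin)
  have "X f = (\<lambda>w. 0)" for f
  proof (cases "f \<in> Fock D")
    case f: True
    obtain K where K: "0 \<le> K" "\<And>f. f \<in> Fock D \<Longrightarrow> normT D (X f) \<le> K * normT D f"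
      by (rule bops_bound[OF Xb]) blast
    have s: "supp_words f" using f by (simp add: Fock_iff)
    have t: "trunc n f \<in> Fock D" for n by (rule trunc_Fock[OF s])
    \<comment> \<open>X kills every truncation of f, so only the tail contributes, and the tails
      tend to zero.\<close>
    have "normT D (X f) \<le> K * normT D (\<lambda>w. f w - trunc n f w)" for n
    proof -
      have "X (\<lambda>w. f w - trunc n f w) = X f"
        using bops_diff[OF Xb f t] N[OF fdeg_trunc[OF s]] by simp
      then show ?thesis using K(2)[OF Fock_diff[OF f t], of n] by simp
    qed
    moreover have "(\<lambda>n. K * normT D (\<lambda>w. f w - trunc n f w)) \<longlonglongrightarrow> K * 0"
      by (intro tendsto_mult tendsto_const trunc_tendsto f)
    ultimately have "normT D (X f) \<le> K * 0" by (intro LIMSEQ_le_const) auto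
    then show ?thesis by (intro normT_eq_0 bops_Fock[OF Xb]) simp
  qed (rule bops_out[OF Xb])
  then show ?thesis by blast
qed

lemma Wick_eq:
  assumes X: "X \<in> MT D" and v: "X (vac D) = g"
  shows "Wick D g = X"
  unfolding Wick_def
proof (rule the_equality)
  show "X \<in> MT D \<and> X (vac D) = g" using assms ..
  fix Y assume Y: "Y \<in> MT D \<and> Y (vac D) = g"
  have "(\<lambda>f w. Y f w + (-1) * X f w) = (\<lambda>f w. 0)"
    by (rule MT_separating) (use X Y v in \<open>auto intro: MT_add[of Y X "-1", simplified]\<close>)
  then show "Y = X" by (simp add: fun_eq_iff)
qed

section \<open>Wick operators\<close>

text \<open>Existence and norm bound travel together, so bounds can be built up before
  \<open>Wick\<close>, a definite description, is evaluated by \<open>Wick_eq\<close>.\<close>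

definition has_Wick :: "fvec \<Rightarrow> real \<Rightarrow> bool" where
  "has_Wick g K \<longleftrightarrow> (\<exists>X\<in>MT D. X (vac D) = g \<and> (\<forall>f\<in>Fock D. normT D (X f) \<le> K * normT D f))"

lemma has_Wick_lin:
  assumes "has_Wick g K" "has_Wick h L"
  shows "has_Wick (\<lambda>w. g w + c * h w) (K + cmod c * L)"
proof -
  obtain X where X: "X \<in> MT D" "X (vac D) = g" "\<And>f. f \<in> Fock D \<Longrightarrow> normT D (X f) \<le> K * normT D f"
    using assms(1) by (auto simp: has_Wick_def)
  obtain Y where Y: "Y \<in> MT D" "Y (vac D) = h" "\<And>f. f \<in> Fock D \<Longrightarrow> normT D (Y f) \<le> L * normT D f"
    using assms(2) by (auto simp: has_Wick_def)
  show ?thesis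
    unfolding has_Wick_def
  proof (intro bexI conjI ballI)
    show "(\<lambda>f w. X f w + c * Y f w) \<in> MT D" by (rule MT_add[OF X(1) Y(1)])
    fix f assume f: "f \<in> Fock D"
    have "normT D (\<lambda>w. X f w + c * Y f w) \<le> normT D (X f) + cmod c * normT D (Y f)"
      by (intro normT_lin bops_Fock MT_bops X Y)
    also have "\<dots> \<le> K * normT D f + cmod c * (L * normT D f)"
      by (intro add_mono mult_left_mono X Y f) simp
    finally show "normT D (\<lambda>w. X f w + c * Y f w) \<le> (K + cmod c * L) * normT D f"
      by (simp add: algebra_simps)
  qed (simp add: X Y)
qed

lemma has_Wick_zero: "has_Wick (\<lambda>w. 0) 0"
  unfolding has_Wick_def using MT_zero by (intro bexI[of _ "\<lambda>f w. 0"]) auto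

lemma has_Wick_sum:
  assumes "finite S" "\<And>i. i \<in> S \<Longrightarrow> has_Wick (F i) (K i)"
  shows "has_Wick (\<lambda>w. \<Sum>i\<in>S. c i * F i w) (\<Sum>i\<in>S. cmod (c i) * K i)"
  using assms
proof (induction S rule: finite_induct)
  case (insert i S)
  have "has_Wick (\<lambda>w. \<Sum>i\<in>S. c i * F i w) (\<Sum>i\<in>S. cmod (c i) * K i)"
    using insert.prems by (intro insert.IH) auto
  moreover have "has_Wick (F i) (K i)" using insert.prems by auto
  ultimately have "has_Wick (\<lambda>w. (\<Sum>i\<in>S. c i * F i w) + c i * F i w) ((\<Sum>i\<in>S. cmod (c i) * K i) + cmod (c i) * K i)"
    by (rule has_Wick_lin)
  then show ?case using insert.hyps by (simp add: add.commute)
qed (simp add: has_Wick_zero)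

lemma has_Wick_mono: "has_Wick g K \<Longrightarrow> K \<le> L \<Longrightarrow> has_Wick g L"
  unfolding has_Wick_def by (meson mult_right_mono normT_nonneg order_trans)

lemma has_Wick_apply:
  assumes "has_Wick g K" "Y \<in> MT D" "0 \<le> A" "\<And>f. f \<in> Fock D \<Longrightarrow> normT D (Y f) \<le> A * normT D f"
  shows "has_Wick (Y g) (A * K)"
proof -
  obtain X where X: "X \<in> MT D" "X (vac D) = g" "\<And>f. f \<in> Fock D \<Longrightarrow> normT D (X f) \<le> K * normT D f"
    using assms(1) by (auto simp: has_Wick_def)
  show ?thesis
    unfolding has_Wick_def
  proof (intro bexI conjI ballI)
    show "Y \<circ> X \<in> MT D" by (rule MT_comp[OF assms(2) X(1)])
    fix f assume f: "f \<in> Fock D"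
    have "normT D (Y (X f)) \<le> A * normT D (X f)" by (intro assms(4) bops_Fock MT_bops X)
    also have "\<dots> \<le> A * (K * normT D f)" by (intro mult_left_mono X f assms)
    finally show "normT D ((Y \<circ> X) f) \<le> A * K * normT D f" by (simp add: mult.assoc)
  qed (simp add: X)
qed

lemma has_Wick_vac: "has_Wick (vac D) 1"
  unfolding has_Wick_def by (rule bexI[OF _ MT_one]) (simp add: vac_Fock)

text \<open>With e_k = x + i y this is the field of x plus i times the field of y: creation is
  linear and annihilation antilinear in the vector, which brings in the conjugate of e_k.\<close>

lemma gauss_bas_MT: "gauss (coord (bas D k)) (coord (cconj (bas D k))) \<in> MT D"
proof -
  obtain x y where xy: "bas D k = (x, y)" by force
  have "(x, y) = (x, 0) + cscale \<i> (y, 0)" "cconj (x, y) = (x, 0) + cscale (- \<i>) (y, 0)"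
    by (simp_all add: cscale_def cconj_def)
  then have e: "coord (x, y) k = coord (x, 0) k + \<i> * coord (y, 0) k"
    "coord (cconj (x, y)) k = coord (x, 0) k + (- \<i>) * coord (y, 0) k" for k
    by (simp_all only: coord_add coord_cscale)
  have "gauss (coord (bas D k)) (coord (cconj (bas D k))) =
      (\<lambda>f w. gauss (coord (x, 0)) (coord (x, 0)) f w + \<i> * gauss (coord (y, 0)) (coord (y, 0)) f w)"
  proof (intro ext)
    fix f w
    have "cre (coord (x, y)) f w = cre (coord (x, 0)) f w + \<i> * cre (coord (y, 0)) f w"
      by (auto simp: cre_def e algebra_simps split: list.splits)
    moreover have "ann (coord (cconj (x, y))) f w = ann (coord (x, 0)) f w + \<i> * ann (coord (y, 0)) f w"
      by (simp add: ann_def e algebra_simps sum.distrib sum_distrib_left)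
    ultimately show "gauss (coord (bas D k)) (coord (cconj (bas D k))) f w =
      gauss (coord (x, 0)) (coord (x, 0)) f w + \<i> * gauss (coord (y, 0)) (coord (y, 0)) f w"
      by (simp add: gauss_def xy algebra_simps)
  qed
  also have "\<dots> \<in> MT D" by (intro MT_add MT_gens) (auto simp: gens_def)
  finally show ?thesis .
qed

text \<open>Of all insertions into x only the one that rebuilds v contributes; inserting a letter in
  coordinates thus becomes deleting a letter of the basis word, carried to the front first.\<close>

lemma ann_e_word:
  assumes v: "v \<in> words D n"
  shows "ann c (e_word D v) = (\<lambda>x. \<Sum>k<n. cnj (c (v ! k)) * q_word (v ! k) (take k v) *
    e_word D (take k v @ drop (Suc k) v) x)"
proof
  fix x
  have lv: "length v = n" by (rule words_length[OF v])
  have vk: "v ! k \<in> letters D" if "k < n" for k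
    using nth_words[OF v, of "Suc k"] that by simp
  have u: "take k v @ drop (Suc k) v \<in> words D (n - 1)" if "k < n" for k
    using v that set_take_subset[of k v] set_drop_subset[of "Suc k" v] by (auto simp: words_def min_def)
  have "ann c (e_word D v) x = (\<Sum>b\<in>letters D. \<Sum>k\<le>length x. cnj (c b) * (q_word b (take k x) * e_word D v (take k x @ b # drop k x)))"
    unfolding ann_def RR_simps sum_distrib_left ..
  also have "\<dots> = (\<Sum>k\<le>length x. \<Sum>b\<in>letters D. cnj (c b) * (q_word b (take k x) * e_word D v (take k x @ b # drop k x)))"
    by (rule sum.swap)
  also have "\<dots> = (\<Sum>k\<le>length x. if n = Suc (length x) \<and> x = take k v @ drop (Suc k) v
      then cnj (c (v ! k)) * q_word (v ! k) (take k v) else 0)"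
  proof (rule sum.cong[OF refl])
    fix k assume "k \<in> {..length x}"
    then have k: "k \<le> length x" by simp
    have "(\<Sum>b\<in>letters D. cnj (c b) * (q_word b (take k x) * e_word D v (take k x @ b # drop k x))) =
      (\<Sum>b\<in>letters D. if b = v ! k then (if n = Suc (length x) \<and> x = take k v @ drop (Suc k) v
      then cnj (c (v ! k)) * q_word (v ! k) (take k v) else 0) else 0)"
    proof (rule sum.cong[OF refl])
      fix b
      let ?P = "n = Suc (length x) \<and> x = take k v @ drop (Suc k) v"
      show "cnj (c b) * (q_word b (take k x) * e_word D v (take k x @ b # drop k x)) =
        (if b = v ! k then (if ?P then cnj (c (v ! k)) * q_word (v ! k) (take k v) else 0) else 0)"
      proof (cases ?P)
        case True
        then have t: "take k x = take k v"
          using k lv by (metis append_eq_conv_conj length_take min_absorb2 le_SucI)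
        have e: "(n = Suc (length x) \<and> b = v ! k \<and> x = take k v @ drop (Suc k) v) = (b = v ! k)"
          using True by blast
        have val: "e_word D v (take k x @ b # drop k x) = (if b = v ! k then 1 else 0)"
          unfolding e_word_app[OF v] ins_eq_iff[OF k] lv e ..
        have "?P = True" using True by blast
        then show ?thesis unfolding val unfolding t
          by (cases "b = v ! k") (simp_all only: if_True if_False mult_zero_right mult_1_right simp_thms)
      next
        case False
        have e: "(n = Suc (length x) \<and> b = v ! k \<and> x = take k v @ drop (Suc k) v) = False"
          using False by blast
        have val: "e_word D v (take k x @ b # drop k x) = 0"
          unfolding e_word_app[OF v] ins_eq_iff[OF k] lv e by (rule if_False)
        have "?P = False" using False by blast
        then show ?thesis unfolding val
          by (simp only: if_False mult_zero_right if_cancel)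
      qed
    qed
    also have "\<dots> = (if n = Suc (length x) \<and> x = take k v @ drop (Suc k) v
      then cnj (c (v ! k)) * q_word (v ! k) (take k v) else 0)"
    proof (cases "n = Suc (length x)")
      case True
      then show ?thesis using vk[of k] k by simp
    qed simp
    finally show "(\<Sum>b\<in>letters D. cnj (c b) * (q_word b (take k x) * e_word D v (take k x @ b # drop k x))) = \<dots>" .
  qed
  also have "\<dots> = (\<Sum>k<n. cnj (c (v ! k)) * q_word (v ! k) (take k v) * e_word D (take k v @ drop (Suc k) v) x)"
  proof (cases "n = Suc (length x)")
    case True
    show ?thesis
    proof (rule sum.cong)
      show "{..length x} = {..<n}" using True by auto
      fix k assume "k \<in> {..<n}"
      then have k: "k < n" by simp
      have e: "e_word D (take k v @ drop (Suc k) v) x = (if x = take k v @ drop (Suc k) v then 1 else 0)"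
        by (rule e_word_app[OF u[OF k]])
      have T: "(n = Suc (length x) \<and> x = take k v @ drop (Suc k) v) = (x = take k v @ drop (Suc k) v)"
        using True by blast
      show "(if n = Suc (length x) \<and> x = take k v @ drop (Suc k) v then cnj (c (v ! k)) * q_word (v ! k) (take k v) else 0) =
          cnj (c (v ! k)) * q_word (v ! k) (take k v) * e_word D (take k v @ drop (Suc k) v) x"
        unfolding e T by (simp only: if_distrib[of "(*) (cnj (c (v ! k)) * q_word (v ! k) (take k v))"] mult_1_right mult_zero_right)
    qed
  next
    case False
    have "e_word D (take k v @ drop (Suc k) v) x = 0" if "k < n" for k
      using e_word_app[OF u[OF that], of x] words_length[OF u[OF that]] False that by auto
    then show ?thesis using False by simp
  qed
  finally show "ann c (e_word D v) x = \<dots>" .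
qed

text \<open>A single constant dominating 1, the norms of the fields A_k and all entries of the
  matrix of conjugation in the basis; being at least 1 it has increasing powers.\<close>

definition wick_base :: real where
  "wick_base = 1 + (\<Sum>k\<in>letters D. sqrt (cre_sqnorm (coord (bas D k))) + sqrt (cre_sqnorm (coord (cconj (bas D k)))))
    + (\<Sum>k\<in>letters D. \<Sum>l\<in>letters D. cmod (coord (cconj (bas D k)) l))"

lemma wick_base_bounds:
  shows "1 \<le> wick_base"
    and "k \<in> letters D \<Longrightarrow> sqrt (cre_sqnorm (coord (bas D k))) + sqrt (cre_sqnorm (coord (cconj (bas D k)))) \<le> wick_base"
    and "k \<in> letters D \<Longrightarrow> l \<in> letters D \<Longrightarrow> cmod (coord (cconj (bas D k)) l) \<le> wick_base"
proof -
  let ?f = "\<lambda>k. sqrt (cre_sqnorm (coord (bas D k))) + sqrt (cre_sqnorm (coord (cconj (bas D k))))"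
  let ?g = "\<lambda>k l. cmod (coord (cconj (bas D k)) l)"
  have f0: "0 \<le> ?f k" for k by (intro add_nonneg_nonneg real_sqrt_ge_zero cre_sqnorm_nonneg)
  have F: "0 \<le> (\<Sum>k\<in>letters D. ?f k)" by (intro sum_nonneg f0)
  have G: "0 \<le> (\<Sum>k\<in>letters D. \<Sum>l\<in>letters D. ?g k l)" by (intro sum_nonneg) simp
  show "1 \<le> wick_base" unfolding wick_base_def using F G by linarith
  show "?f k \<le> wick_base" if "k \<in> letters D"
    using member_le_sum[of k "letters D" ?f] that f0 G unfolding wick_base_def by simp
  show "?g k l \<le> wick_base" if "k \<in> letters D" "l \<in> letters D"
  proof -
    have "?g k l \<le> (\<Sum>l\<in>letters D. ?g k l)" by (rule member_le_sum[OF that(2)]) auto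
    also have "\<dots> \<le> (\<Sum>k\<in>letters D. \<Sum>l\<in>letters D. ?g k l)"
      by (rule member_le_sum[OF that(1)]) (auto intro: sum_nonneg)
    finally show ?thesis unfolding wick_base_def using F by linarith
  qed
qed

text \<open>Wick recursion: W(e_k \<otimes> v) is A_k W(v) minus the weighted Wick operators of the
  words left when e_k contracts with a letter of v. With M = \<open>wick_base\<close> the bounds a_m
  need a_(m+1) \<ge> M a_m + m M a_(m-1), and a_m = m! (2 M)^m satisfies this.\<close>

lemma has_Wick_e_word: "w \<in> words D n \<Longrightarrow> has_Wick (e_word D w) (fact n * (2 * wick_base) ^ n)"
proof (induction n arbitrary: w rule: less_induct)
  case (less n)
  show ?case
  proof (cases n)
    case 0
    then show ?thesis using less.prems has_Wick_vac by (simp add: vac_eq)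
  next
    case (Suc m)
    then obtain k v where w: "w = k # v" using less.prems by (cases w) (auto simp: words_def)
    have kv: "k # v \<in> words D (Suc m)" using less.prems w Suc by simp
    then have k: "k \<in> letters D" and v: "v \<in> words D m" by auto
    let ?M = "2 * wick_base" and ?c = "coord (cconj (bas D k))"
    have M: "1 \<le> ?M" using wick_base_bounds(1) by simp
    have vk: "v ! j \<in> letters D" if "j < m" for j
      using nth_words[OF v, of "Suc j"] that by simp
    let ?u = "\<lambda>j. take j v @ drop (Suc j) v"
    let ?d = "\<lambda>j. cnj (?c (v ! j)) * q_word (v ! j) (take j v)"
    have d: "cmod (?d j) \<le> wick_base" if "j < m" for j
    proof -
      have "set (take j v) \<subseteq> letters D" using v set_take_subset[of j v] by (auto simp: words_def)
      then have "cmod (q_word (v ! j) (take j v)) \<le> qmax ^ length (take j v)" by (intro norm_q_word vk that)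
      also have "\<dots> \<le> 1" using qmax_bounds by (intro power_le_one) auto
      finally have "cmod (?c (v ! j)) * cmod (q_word (v ! j) (take j v)) \<le> wick_base * 1"
        using wick_base_bounds(3)[OF k vk[OF that]] wick_base_bounds(1) by (intro mult_mono) auto
      then show ?thesis by (simp add: norm_mult)
    qed
    have "has_Wick (e_word D v) (fact m * ?M ^ m)" using less.IH[OF _ v] Suc by simp
    then have "has_Wick (gauss (coord (bas D k)) ?c (e_word D v)) (wick_base * (fact m * ?M ^ m))"
    proof (rule has_Wick_apply[OF _ gauss_bas_MT])
      fix f assume f: "f \<in> Fock D"
      show "normT D (gauss (coord (bas D k)) ?c f) \<le> wick_base * normT D f"
        using normT_gauss_le[OF f, of "coord (bas D k)" ?c] mult_right_mono[OF wick_base_bounds(2)[OF k] normT_nonneg[OF f]]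
        by linarith
    qed (use wick_base_bounds(1) in simp)
    moreover have "has_Wick (\<lambda>x. \<Sum>j<m. ?d j * e_word D (?u j) x) (\<Sum>j<m. cmod (?d j) * (fact (m - 1) * ?M ^ (m - 1)))"
    proof (rule has_Wick_sum)
      fix j assume "j \<in> {..<m}"
      then have j: "j < m" by simp
      have "?u j \<in> words D (m - 1)"
        using v j set_take_subset[of j v] set_drop_subset[of "Suc j" v] by (auto simp: words_def min_def)
      then show "has_Wick (e_word D (?u j)) (fact (m - 1) * ?M ^ (m - 1))" using less.IH[of "m - 1"] Suc by simp
    qed simp
    ultimately have "has_Wick (\<lambda>x. gauss (coord (bas D k)) ?c (e_word D v) x + (- 1) * (\<Sum>j<m. ?d j * e_word D (?u j) x))
      (wick_base * (fact m * ?M ^ m) + cmod (- 1) * (\<Sum>j<m. cmod (?d j) * (fact (m - 1) * ?M ^ (m - 1))))"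
      by (rule has_Wick_lin)
    moreover have "(\<lambda>x. gauss (coord (bas D k)) ?c (e_word D v) x + (- 1) * (\<Sum>j<m. ?d j * e_word D (?u j) x)) = e_word D w"
      unfolding gauss_in[OF e_word_Fock] ann_e_word[OF v] cre_e_word[OF kv] w by simp
    ultimately have W: "has_Wick (e_word D w) (wick_base * (fact m * ?M ^ m) + (\<Sum>j<m. cmod (?d j) * (fact (m - 1) * ?M ^ (m - 1))))"
      by simp
    have "(\<Sum>j<m. cmod (?d j) * (fact (m - 1) * ?M ^ (m - 1))) \<le> (\<Sum>j<m. wick_base * (fact (m - 1) * ?M ^ (m - 1)))"
      using d M by (intro sum_mono mult_right_mono) auto
    also have "\<dots> = wick_base * ((real m * fact (m - 1)) * ?M ^ (m - 1))" by simp
    also have "\<dots> \<le> wick_base * (fact m * ?M ^ m)"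
    proof (rule mult_left_mono)
      show "real m * fact (m - 1) * ?M ^ (m - 1) \<le> fact m * ?M ^ m"
      proof (rule mult_mono)
        \<comment> \<open>Equality for m > 0; for m = 0 the left side vanishes.\<close>
        show "real m * fact (m - 1) \<le> fact m" by (cases m) simp_all
        show "?M ^ (m - 1) \<le> ?M ^ m" using M by (intro power_increasing) simp_all
      qed (use M in simp_all)
    qed (use wick_base_bounds(1) in simp)
    finally have s: "(\<Sum>j<m. cmod (?d j) * (fact (m - 1) * ?M ^ (m - 1))) \<le> wick_base * (fact m * ?M ^ m)" .
    have "wick_base * (fact m * ?M ^ m) + (\<Sum>j<m. cmod (?d j) * (fact (m - 1) * ?M ^ (m - 1)))
        \<le> wick_base * (fact m * ?M ^ m) + wick_base * (fact m * ?M ^ m)" by (rule add_left_mono[OF s])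
    also have "\<dots> = ?M * (fact m * ?M ^ m)" by simp
    also have "\<dots> = fact m * ?M ^ n" using Suc by simp
    also have "\<dots> \<le> fact n * ?M ^ n" using M Suc by (intro mult_right_mono) auto
    finally show ?thesis using W has_Wick_mono by blast
  qed
qed

lemma has_Wick_degree:
  assumes "supp_words f" "\<And>x. f x \<noteq> 0 \<Longrightarrow> length x = n" "\<And>x. x \<in> words D n \<Longrightarrow> cmod (f x) \<le> B"
  shows "has_Wick f (real (card (words D n)) * (B * (fact n * (2 * wick_base) ^ n)))"
proof -
  have "has_Wick (\<lambda>x. \<Sum>w\<in>words D n. f w * e_word D w x) (\<Sum>w\<in>words D n. cmod (f w) * (fact n * (2 * wick_base) ^ n))"
    by (intro has_Wick_sum has_Wick_e_word) auto
  moreover have "(\<Sum>w\<in>words D n. cmod (f w) * (fact n * (2 * wick_base) ^ n)) \<le> (\<Sum>w\<in>words D n. B * (fact n * (2 * wick_base) ^ n))"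
    using wick_base_bounds(1) by (intro sum_mono mult_right_mono assms) auto
  ultimately show ?thesis using has_Wick_mono word_expansion[OF assms(1,2)] by simp
qed

text \<open>The sum is formed coordinate by coordinate, which \<open>coord_le\<close> permits.
  \<open>fatou\<close> puts it back into the Fock space with the expected tail bound, and the tail
  bound in turn carries commutation with the commutant to the limit.\<close>

lemma MT_limit:
  assumes Y: "\<And>m. Y m \<in> MT D" and y: "summable y" "\<And>m. 0 \<le> y m"
    and bound: "\<And>m f. f \<in> Fock D \<Longrightarrow> normT D (Y m f) \<le> y m * normT D f"
  defines "X \<equiv> \<lambda>f w. \<Sum>m. Y m f w"
  shows "X \<in> MT D"
    and "\<And>M f. f \<in> Fock D \<Longrightarrow> normT D (\<lambda>w. X f w - (\<Sum>m<M. Y m f w)) \<le> (\<Sum>m. y (m + M)) * normT D f"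
    and "\<And>f w. summable (\<lambda>m. Y m f w)"
proof -
  note Yb = MT_bops[OF Y]
  have YF: "Y m f \<in> Fock D" for m f by (rule bops_Fock[OF Yb])
  have sm: "summable (\<lambda>m. Y m f w)" for f w
  proof (cases "f \<in> Fock D")
    case f: True
    let ?c = "sqrt ((1 - qmax) ^ card (pairs (length w)))"
    have c: "0 < ?c" using qmax_bounds by simp
    show ?thesis
    proof (rule summable_comparison_test'[of "\<lambda>m. y m * (normT D f / ?c)" 0])
      show "summable (\<lambda>m. y m * (normT D f / ?c))" by (rule summable_mult2[OF y(1)])
      fix m
      have "cmod (Y m f w) \<le> normT D (Y m f) / ?c" by (rule coord_le[OF YF])
      also have "\<dots> \<le> y m * normT D f / ?c" using c by (intro divide_right_mono bound f) auto
      finally show "norm (Y m f w) \<le> y m * (normT D f / ?c)" by simp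
    qed
  qed (simp add: bops_out[OF Yb])
  then show "\<And>f w. summable (\<lambda>m. Y m f w)" .
  have tail: "(\<lambda>w. X f w - (\<Sum>m<M. Y m f w)) \<in> Fock D \<and>
      normT D (\<lambda>w. X f w - (\<Sum>m<M. Y m f w)) \<le> (\<Sum>m. y (m + M)) * normT D f"
    if f: "f \<in> Fock D" for M f
  proof -
    let ?F = "\<lambda>k w. \<Sum>m<k. Y (m + M) f w"
    have sy: "summable (\<lambda>m. y (m + M))" using y(1) by (rule summable_ignore_initial_segment)
    have F: "?F k \<in> Fock D" for k by (intro Fock_sum YF)
    have lim: "(\<lambda>k. ?F k w) \<longlonglongrightarrow> X f w - (\<Sum>m<M. Y m f w)" for w
    proof -
      have "X f w - (\<Sum>m<M. Y m f w) = (\<Sum>m. Y (m + M) f w)"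
        unfolding X_def using suminf_split_initial_segment[OF sm[of f w], of M] by simp
      then show ?thesis
        using summable_LIMSEQ[OF summable_ignore_initial_segment[OF sm[of f w], of M]] by simp
    qed
    have B: "normT D (?F k) \<le> (\<Sum>m. y (m + M)) * normT D f" for k
    proof -
      have "normT D (?F k) \<le> (\<Sum>m<k. normT D (Y (m + M) f))" by (intro normT_sum YF)
      also have "\<dots> \<le> (\<Sum>m<k. y (m + M) * normT D f)" by (intro sum_mono bound f)
      also have "\<dots> = (\<Sum>m<k. y (m + M)) * normT D f" by (simp add: sum_distrib_right)
      also have "\<dots> \<le> (\<Sum>m. y (m + M)) * normT D f"
        by (intro mult_right_mono normT_nonneg f sum_le_suminf sy) (auto simp: y)
      finally show ?thesis .
    qed
    show ?thesis using fatou[OF F lim B] by blast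
  qed
  then show nt: "\<And>M f. f \<in> Fock D \<Longrightarrow> normT D (\<lambda>w. X f w - (\<Sum>m<M. Y m f w)) \<le> (\<Sum>m. y (m + M)) * normT D f"
    by blast
  have Xb: "X \<in> bops D"
  proof (rule bopsI[where K = "\<Sum>m. y m"])
    show "X f \<in> Fock D" "normT D (X f) \<le> (\<Sum>m. y m) * normT D f" if "f \<in> Fock D" for f
      using tail[OF that, of 0] by simp_all
    show "X f = (\<lambda>w. 0)" if "f \<notin> Fock D" for f
      using that by (simp add: X_def bops_out[OF Yb])
    show "X (\<lambda>w. f w + c * g w) = (\<lambda>w. X f w + c * X g w)" if "f \<in> Fock D" "g \<in> Fock D" for f g c
    proof
      fix w
      have "X f w + c * X g w = (\<Sum>m. Y m f w) + (\<Sum>m. c * Y m g w)"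
        unfolding X_def by (simp add: suminf_mult[OF sm])
      also have "\<dots> = (\<Sum>m. Y m f w + c * Y m g w)" by (intro suminf_add summable_mult sm)
      finally show "X (\<lambda>w. f w + c * g w) w = X f w + c * X g w"
        by (simp add: X_def bops_lin[OF Yb that])
    qed
  qed
  show "X \<in> MT D"
  proof (rule MT_I[OF Xb])
    fix Z f assume Z: "Z \<in> commutant D gens" and f: "f \<in> Fock D"
    note Zb = commutant_bops[OF Z]
    obtain K where K: "0 \<le> K" "\<And>f. f \<in> Fock D \<Longrightarrow> normT D (Z f) \<le> K * normT D f"
      by (rule bops_bound[OF Zb]) blast
    let ?T = "\<lambda>M. \<Sum>m. y (m + M)"
    have Zf: "Z f \<in> Fock D" by (rule bops_Fock[OF Zb])
    have S: "(\<lambda>w. \<Sum>m<M. Y m g w) \<in> Fock D" for M g by (intro Fock_sum YF)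
    have ZS: "Z (\<lambda>w. \<Sum>m<M. Y m f w) = (\<lambda>w. \<Sum>m<M. Y m (Z f) w)" for M
    proof (induction M)
      case (Suc M)
      then show ?case using bops_lin[OF Zb S[of f M] YF[of M f], of 1] by (simp add: MT_commute[OF Y Z])
    qed (simp add: bops_zero[OF Zb])
    \<comment> \<open>X is replaced by its partial sums on either side of Z; each replacement costs
      one tail.\<close>
    have le: "normT D (\<lambda>w. X (Z f) w - Z (X f) w) \<le> ?T M * normT D (Z f) + K * (?T M * normT D f)" for M
    proof -
      let ?a = "\<lambda>w. X (Z f) w - (\<Sum>m<M. Y m (Z f) w)" and ?b = "\<lambda>w. X f w - (\<Sum>m<M. Y m f w)"
      have Fa: "?a \<in> Fock D" and Fb: "?b \<in> Fock D" using tail[OF Zf, of M] tail[OF f, of M] by auto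
      have "Z ?b = (\<lambda>w. Z (X f) w - (\<Sum>m<M. Y m (Z f) w))"
        using bops_diff[OF Zb bops_Fock[OF Xb, of f] S[of f M]] by (simp add: ZS)
      then have "(\<lambda>w. X (Z f) w - Z (X f) w) = (\<lambda>w. ?a w + (-1) * Z ?b w)" by (simp add: fun_eq_iff)
      then have "normT D (\<lambda>w. X (Z f) w - Z (X f) w) \<le> normT D ?a + 1 * normT D (Z ?b)"
        using normT_lin[OF Fa bops_Fock[OF Zb], of "-1" ?b] by simp
      also have "\<dots> \<le> ?T M * normT D (Z f) + K * (?T M * normT D f)"
        using nt[OF Zf, of M] K(2)[OF Fb] mult_left_mono[OF nt[OF f, of M] K(1)] by linarith
      finally show ?thesis .
    qed
    have "?T \<longlonglongrightarrow> 0" by (rule suminf_exist_split2[OF y(1)])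
    then have "(\<lambda>M. ?T M * normT D (Z f) + K * (?T M * normT D f)) \<longlonglongrightarrow> 0 * normT D (Z f) + K * (0 * normT D f)"
      by (intro tendsto_intros)
    then have "normT D (\<lambda>w. X (Z f) w - Z (X f) w) \<le> 0 * normT D (Z f) + K * (0 * normT D f)"
      using le by (intro LIMSEQ_le_const) auto
    then have "(\<lambda>w. X (Z f) w - Z (X f) w) = (\<lambda>w. 0)"
      by (intro normT_eq_0 Fock_diff bops_Fock[OF Xb] bops_Fock[OF Zb]) simp
    then show "X (Z f) = Z (X f)" by (simp add: fun_eq_iff)
  qed
qed

end

section \<open>Inverting \<open>P\<^bsup>(n)\<^esup>\<close>\<close>

text \<open>Neumann series in the sup norm for a weighted composition operator whose weights are at
  most s < 1.\<close>

lemma contraction_solve: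
  fixes \<mu> :: "'b \<Rightarrow> complex" and \<rho> :: "'b \<Rightarrow> 'b" and g :: "'b \<Rightarrow> complex"
  assumes W: "\<And>w. w \<in> W \<Longrightarrow> \<rho> w \<in> W" "\<And>w. w \<in> W \<Longrightarrow> cmod (\<mu> w) \<le> s"
    and s: "0 \<le> s" "s < 1" and G: "\<And>w. w \<in> W \<Longrightarrow> cmod (g w) \<le> G"
  obtains z where "\<And>w. w \<in> W \<Longrightarrow> z w - \<mu> w * z (\<rho> w) = g w"
    and "\<And>w. w \<in> W \<Longrightarrow> cmod (z w) \<le> G / (1 - s)"
proof -
  define a where "a j = ((\<lambda>f w. \<mu> w * f (\<rho> w)) ^^ j) g" for j
  have a0: "a 0 = g" and aS: "a (Suc j) w = \<mu> w * a j (\<rho> w)" for j w by (simp_all add: a_def)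
  have le: "cmod (a j w) \<le> s ^ j * G" if "w \<in> W" for j w
    using that
  proof (induction j arbitrary: w)
    case (Suc j)
    have "cmod (\<mu> w) * cmod (a j (\<rho> w)) \<le> s * (s ^ j * G)"
      using W Suc s by (intro mult_mono) auto
    then show ?case by (simp add: aS norm_mult)
  qed (simp add: a0 G)
  have geo: "summable (\<lambda>j. s ^ j * G)" "(\<Sum>j. s ^ j * G) = G / (1 - s)"
    using s suminf_mult2[of "\<lambda>j. s ^ j" G] summable_geometric[of s] suminf_geometric[of s]
    by (auto intro: summable_mult2)
  have sm: "summable (\<lambda>j. a j w)" if "w \<in> W" for w
    by (rule summable_comparison_test'[OF geo(1)]) (rule le[OF that])
  show ?thesis
  proof (rule that[of "\<lambda>w. \<Sum>j. a j w"])
    fix w assume w: "w \<in> W"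
    have "(\<Sum>j. a (Suc j) w) = (\<Sum>j. a j w) - g w" using suminf_split_head[OF sm[OF w]] by (simp add: a0)
    moreover have "(\<Sum>j. a (Suc j) w) = \<mu> w * (\<Sum>j. a j (\<rho> w))"
      unfolding aS by (rule suminf_mult[OF sm[OF W(1)[OF w]]])
    ultimately show "(\<Sum>j. a j w) - \<mu> w * (\<Sum>j. a j (\<rho> w)) = g w" by simp
    have "cmod (\<Sum>j. a j w) \<le> (\<Sum>j. s ^ j * G)" by (rule norm_suminf_le[OF le[OF w] geo(1)])
    then show "cmod (\<Sum>j. a j w) \<le> G / (1 - s)" by (simp add: geo)
  qed
qed

context aw begin

definition cycle_op :: "nat \<Rightarrow> fvec \<Rightarrow> fvec" where
  "cycle_op k f w = (case w of [] \<Rightarrow> f [] | a # v \<Rightarrow> q_word a (take k v) * f (take k v @ a # drop k v))"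

definition RR_partial :: "nat \<Rightarrow> fvec \<Rightarrow> fvec" where
  "RR_partial k f w = (\<Sum>j<k. cycle_op j f w)"

lemma cycle_op_Cons: "cycle_op k f (a # v) = q_word a (take k v) * f (take k v @ a # drop k v)"
  by (simp add: cycle_op_def)

lemma RR_eq_partial: "w \<in> words D (Suc n) \<Longrightarrow> RR f w = RR_partial (Suc n) f w"
  by (cases w) (auto simp: RR_partial_def cycle_op_Cons lessThan_Suc_atMost words_def)

text \<open>Here \<open>cycle_op k\<close> is \<open>T\<^sub>1\<cdots>T\<^sub>k\<close>, so this is the relation \<open>T\<^sub>1\<cdots>T\<^sub>j T\<^sub>1\<cdots>T\<^sub>k = T\<^sub>1 (T\<^sub>1\<cdots>T\<^sub>k) (T\<^sub>1\<cdots>T\<^bsub>j-1\<^esub>)\<close> for \<open>j \<le> k\<close>.\<close>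

lemma cycle_op_braid:
  assumes "j \<le> K" "Suc K \<le> Suc (length v)"
  shows "cycle_op (Suc j) (cycle_op (Suc K) f) (a # b # v) = qq a b * cycle_op (Suc K) (cycle_op j f) (b # a # v)"
proof -
  have K: "K \<le> length v" using assms by simp
  have t: "take j (take K v) = take j v" "take K v = take j v @ take (K - j) (drop j v)"
    using assms(1) by (simp_all add: min_def take_add[symmetric])
  have d: "drop j (take K v) = take (K - j) (drop j v)" by (simp add: drop_take)
  have dd: "drop (K - j) (drop j v) = drop K v" using assms(1) by simp
  have L: "cycle_op (Suc j) (cycle_op (Suc K) f) (a # b # v) = qq a b * q_word a (take j v) *
      (q_word b (take j v @ a # take (K - j) (drop j v)) * f (take j v @ a # take (K - j) (drop j v) @ b # drop K v))"
  proof -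
    have "take (Suc K) (take j v @ a # drop j v) = take j v @ a # take (K - j) (drop j v)"
      using assms by (simp add: Suc_diff_le min_def)
    moreover have "drop (Suc K) (take j v @ a # drop j v) = drop K v"
      using assms dd by (simp add: Suc_diff_le min_def)
    ultimately show ?thesis by (simp add: cycle_op_Cons)
  qed
  have R: "cycle_op (Suc K) (cycle_op j f) (b # a # v) = qq b a * q_word b (take K v) *
      (q_word a (take j v) * f (take j v @ a # take (K - j) (drop j v) @ b # drop K v))"
  proof -
    have "take j (take K v @ b # drop K v) = take j v" using assms K t by simp
    moreover have "drop j (take K v @ b # drop K v) = take (K - j) (drop j v) @ b # drop K v"
      using assms K d by simp
    ultimately show ?thesis by (simp add: cycle_op_Cons)
  qed
  show ?thesis unfolding L R t(2) by simp
qed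

definition rot_word :: "nat \<Rightarrow> nat list \<Rightarrow> nat list" where
  "rot_word K w = (case w of a # b # v \<Rightarrow> a # take K v @ b # drop K v | _ \<Rightarrow> w)"

definition rot_weight :: "nat \<Rightarrow> nat list \<Rightarrow> complex" where
  "rot_weight K w = (case w of a # b # v \<Rightarrow> qq a b * q_word b (a # take K v) | _ \<Rightarrow> 0)"

text \<open>With \<open>C = T\<^sub>1\<cdots>T\<^bsub>k\<^esub>\<close>: \<open>R\<^bsub>k+1\<^esub> (1 - C) = (1 - T\<^sub>1 C) R\<^sub>k\<close>, where \<open>T\<^sub>1 C\<close> is the weighted
  permutation of words given by \<^term>\<open>rot_word\<close> and \<^term>\<open>rot_weight\<close>.\<close>

lemma RR_partial_factor:
  assumes w: "w \<in> words D n" and K: "Suc (Suc K) \<le> n"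
  shows "RR_partial (Suc (Suc K)) (\<lambda>w. x w - cycle_op (Suc K) x w) w = RR_partial (Suc K) x w - rot_weight K w * RR_partial (Suc K) x (rot_word K w)"
proof -
  obtain a b v where wv: "w = a # b # v" "K \<le> length v"
    using w K by (cases w; cases "tl w") (auto simp: words_def)
  have sub: "cycle_op j (\<lambda>w. x w - cycle_op (Suc K) x w) w = cycle_op j x w - cycle_op j (cycle_op (Suc K) x) w" for j
    unfolding wv by (simp add: cycle_op_Cons algebra_simps)
  have c: "cycle_op (Suc j) (cycle_op (Suc K) x) w = rot_weight K w * cycle_op j x (rot_word K w)" if "j \<le> K" for j
    unfolding wv cycle_op_braid[OF that Suc_le_mono[THEN iffD2, OF wv(2)]]
    by (simp add: cycle_op_Cons[of "Suc K"] rot_weight_def rot_word_def)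
  have "RR_partial (Suc (Suc K)) (\<lambda>w. x w - cycle_op (Suc K) x w) w =
      RR_partial (Suc (Suc K)) x w - (\<Sum>j<Suc (Suc K). cycle_op j (cycle_op (Suc K) x) w)"
    unfolding RR_partial_def sub by (rule sum_subtractf)
  also have "(\<Sum>j<Suc (Suc K). cycle_op j (cycle_op (Suc K) x) w) = cycle_op 0 (cycle_op (Suc K) x) w + (\<Sum>j<Suc K. cycle_op (Suc j) (cycle_op (Suc K) x) w)"
    by (rule sum.lessThan_Suc_shift)
  also have "cycle_op 0 (cycle_op (Suc K) x) w = cycle_op (Suc K) x w" by (simp add: wv cycle_op_Cons)
  also have "(\<Sum>j<Suc K. cycle_op (Suc j) (cycle_op (Suc K) x) w) = rot_weight K w * RR_partial (Suc K) x (rot_word K w)"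
    unfolding RR_partial_def sum_distrib_left by (rule sum.cong) (auto simp: c)
  also have "RR_partial (Suc (Suc K)) x w = RR_partial (Suc K) x w + cycle_op (Suc K) x w" by (simp add: RR_partial_def)
  finally show ?thesis by simp
qed

lemma cycle_op_bound:
  assumes w: "w \<in> words D n" and K: "Suc K \<le> n" and f: "\<And>w. w \<in> words D n \<Longrightarrow> cmod (f w) \<le> Y"
  shows "cmod (cycle_op K f w) \<le> qmax ^ K * Y"
proof -
  obtain a v where wv: "w = a # v" "K \<le> length v" using w K by (cases w) (auto simp: words_def)
  have a: "a \<in> letters D" and v: "set v \<subseteq> letters D" using w wv by (auto simp: words_def)
  have tv: "set (take K v) \<subseteq> letters D" using v set_take_subset by fastforce
  have "take K v @ a # drop K v \<in> words D n"
    using w wv tv v set_drop_subset[of K v] by (auto simp: words_def)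
  moreover have "cmod (q_word a (take K v)) \<le> qmax ^ K" using norm_q_word[OF a tv] wv by (simp add: min_absorb2)
  ultimately show ?thesis
    unfolding wv cycle_op_Cons norm_mult using f qmax_bounds by (intro mult_mono) auto
qed

lemma rot_word_bound:
  assumes w: "w \<in> words D n" and K: "Suc (Suc K) \<le> n"
  shows "rot_word K w \<in> words D n" "cmod (rot_weight K w) \<le> qmax ^ Suc (Suc K)"
proof -
  obtain a b v where wv: "w = a # b # v" "K \<le> length v"
    using w K by (cases w; cases "tl w") (auto simp: words_def)
  have a: "a \<in> letters D" and b: "b \<in> letters D" and v: "set v \<subseteq> letters D" using w wv by (auto simp: words_def)
  have tv: "set (take K v) \<subseteq> letters D" using v set_take_subset by fastforce
  show "rot_word K w \<in> words D n"
    using w wv tv v set_drop_subset[of K v] by (auto simp: words_def rot_word_def)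
  have "cmod (q_word b (a # take K v)) \<le> qmax ^ length (a # take K v)" using a tv by (intro norm_q_word b) auto
  then have "cmod (qq a b) * cmod (q_word b (a # take K v)) \<le> qmax * qmax ^ Suc K"
    using norm_qq[OF a b] qmax_bounds wv(2) by (intro mult_mono) (auto simp: min_absorb2)
  then show "cmod (rot_weight K w) \<le> qmax ^ Suc (Suc K)" by (simp add: wv rot_weight_def norm_mult)
qed

text \<open>Passing from the inverse of R_k to that of R_(k+1) costs (1 + r^k) / (1 - r^(k+1)) with
  r = \<open>qmax\<close>. Each such factor is at most exp(2 \<open>Rnorm\<close> r^k), so the
  product stays bounded in k.\<close>

definition Rinv_bound :: "nat \<Rightarrow> real" where
  "Rinv_bound k = exp (2 * Rnorm * (\<Sum>j<k. qmax ^ j))"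

lemma Rinv_bound_step: "(1 + qmax ^ Suc K) * (Rinv_bound (Suc K) * (1 / (1 - qmax ^ Suc (Suc K)))) \<le> Rinv_bound (Suc (Suc K))"
proof -
  let ?s = "qmax ^ Suc K" and ?x = "qmax ^ Suc (Suc K)"
  have s: "0 < ?s" using qmax_bounds by simp
  have x: "0 < ?x" "?x \<le> ?s" "?x \<le> qmax"
  proof -
    show "0 < ?x" using qmax_bounds by simp
    show "?x \<le> ?s" using qmax_bounds by (intro power_decreasing) auto
    show "?x \<le> qmax" using power_decreasing[of 1 "Suc (Suc K)" qmax] qmax_bounds by simp
  qed
  have kk1: "1 \<le> Rnorm" using qmax_bounds by (simp add: Rnorm_def)
  have "1 + ?s \<le> exp ?s" by (rule exp_ge_add_one_self)
  also have "\<dots> \<le> exp (Rnorm * ?s)" using kk1 s mult_right_mono[of 1 Rnorm ?s] by simp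
  finally have 1: "1 + ?s \<le> exp (Rnorm * ?s)" .
  have "1 / (1 - y) = 1 + y / (1 - y)" if "y < 1" for y :: real using that by (simp add: field_simps)
  from this[of ?x] have "1 / (1 - ?x) = 1 + ?x / (1 - ?x)" using x qmax_bounds by linarith
  also have "\<dots> \<le> exp (?x / (1 - ?x))" by (rule exp_ge_add_one_self)
  also have "?x / (1 - ?x) \<le> Rnorm * ?s"
    unfolding Rnorm_def using x qmax_bounds by (simp, intro frac_le) auto
  finally have 2: "1 / (1 - ?x) \<le> exp (Rnorm * ?s)" by simp
  have "(1 + ?s) * (Rinv_bound (Suc K) * (1 / (1 - ?x))) \<le> exp (Rnorm * ?s) * (Rinv_bound (Suc K) * exp (Rnorm * ?s))"
  proof (rule mult_mono[OF 1])
    have p: "0 \<le> Rinv_bound (Suc K)" by (simp add: Rinv_bound_def)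
    show "Rinv_bound (Suc K) * (1 / (1 - ?x)) \<le> Rinv_bound (Suc K) * exp (Rnorm * ?s)" by (rule mult_left_mono[OF 2 p])
    have "?x \<le> 1" using x(3) qmax_bounds by linarith
    then show "0 \<le> Rinv_bound (Suc K) * (1 / (1 - ?x))" using p by (intro mult_nonneg_nonneg divide_nonneg_nonneg) auto
  qed simp
  also have "\<dots> = Rinv_bound (Suc (Suc K))"
    unfolding Rinv_bound_def exp_add[symmetric] by (simp add: algebra_simps)
  finally show ?thesis .
qed

text \<open>By the factorization with C = T_1 ... T_(K+1), the equation for K + 2 summands reduces
  to fewer: solve (1 - T_1 C) z = g by a Neumann series, then R_(K+1) y = z by induction, and put f
  = (1 - C) y.\<close>

lemma RR_partial_solve:
  "Suc K \<le> n \<Longrightarrow> (\<And>w. w \<in> words D n \<Longrightarrow> cmod (g w) \<le> G) \<Longrightarrow> 0 \<le> G \<Longrightarrow>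
    \<exists>f. \<forall>w\<in>words D n. RR_partial (Suc K) f w = g w \<and> cmod (f w) \<le> Rinv_bound (Suc K) * G"
proof (induction K arbitrary: g G)
  case 0
  have "RR_partial (Suc 0) g w = g w" for w by (cases w) (simp_all add: RR_partial_def cycle_op_def)
  moreover have "1 * G \<le> Rinv_bound (Suc 0) * G"
    using 0 Rnorm_pos by (intro mult_right_mono) (auto simp: Rinv_bound_def)
  ultimately show ?case using 0 by (intro exI[of _ g]) force
next
  case (Suc K)
  let ?x = "qmax ^ Suc (Suc K)" and ?s = "qmax ^ Suc K"
  have x: "0 \<le> ?x" "?x < 1"
    using qmax_bounds power_Suc_less_one[of qmax "Suc K"] zero_le_power[of qmax "Suc (Suc K)"] by simp_all
  obtain z where z: "\<And>w. w \<in> words D n \<Longrightarrow> z w - rot_weight K w * z (rot_word K w) = g w"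
    "\<And>w. w \<in> words D n \<Longrightarrow> cmod (z w) \<le> G / (1 - ?x)"
    by (rule contraction_solve[of "words D n" "rot_word K" "rot_weight K" ?x g G])
      (use rot_word_bound Suc.prems x in auto)
  have G': "0 \<le> G / (1 - ?x)" using Suc.prems x by simp
  obtain y where y: "\<And>w. w \<in> words D n \<Longrightarrow> RR_partial (Suc K) y w = z w"
    "\<And>w. w \<in> words D n \<Longrightarrow> cmod (y w) \<le> Rinv_bound (Suc K) * (G / (1 - ?x))"
  proof -
    have "\<exists>y. \<forall>w\<in>words D n. RR_partial (Suc K) y w = z w \<and> cmod (y w) \<le> Rinv_bound (Suc K) * (G / (1 - ?x))"
      by (rule Suc.IH[OF _ z(2) G']) (use Suc.prems(1) in auto)
    then show ?thesis using that by blast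
  qed
  let ?f = "\<lambda>w. y w - cycle_op (Suc K) y w"
  show ?case
  proof (intro exI[of _ ?f] ballI conjI)
    fix w assume w: "w \<in> words D n"
    show "RR_partial (Suc (Suc K)) ?f w = g w"
      using RR_partial_factor[OF w Suc.prems(1), of y] y(1)[OF w] y(1)[OF rot_word_bound(1)[OF w Suc.prems(1)]] z(1)[OF w]
      by simp
    have "cmod (cycle_op (Suc K) y w) \<le> ?s * (Rinv_bound (Suc K) * (G / (1 - ?x)))"
      by (rule cycle_op_bound[OF w _ y(2)]) (use Suc.prems in auto)
    then have "cmod (?f w) \<le> (1 + ?s) * (Rinv_bound (Suc K) * (G / (1 - ?x)))"
      using norm_triangle_ineq4[of "y w" "cycle_op (Suc K) y w"] y(2)[OF w] by (simp only: distrib_right mult_1)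
    also have "\<dots> = (1 + ?s) * (Rinv_bound (Suc K) * (1 / (1 - ?x))) * G" by simp
    also have "\<dots> \<le> Rinv_bound (Suc (Suc K)) * G" by (rule mult_right_mono[OF Rinv_bound_step Suc.prems(3)])
    finally show "cmod (?f w) \<le> Rinv_bound (Suc (Suc K)) * G" .
  qed
qed

definition Rinv_norm :: real where "Rinv_norm = exp (2 * Rnorm * Rnorm)"

lemma Rinv_bound_le: "Rinv_bound k \<le> Rinv_norm"
proof -
  have "(\<Sum>j<k. qmax ^ j) = (1 - qmax ^ k) / (1 - qmax)" using qmax_bounds by (subst sum_gp_strict) auto
  also have "\<dots> \<le> Rnorm" unfolding Rnorm_def using qmax_bounds by (intro divide_right_mono) auto
  finally have "2 * Rnorm * (\<Sum>j<k. qmax ^ j) \<le> 2 * Rnorm * Rnorm" using Rnorm_pos by (intro mult_left_mono) auto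
  then show ?thesis by (simp add: Rinv_bound_def Rinv_norm_def)
qed

text \<open>First 1 \<otimes> P^(n) is inverted separately for each first letter, then R. Each of
  the n factors costs \<open>Rinv_norm\<close>, so no factorial arises.\<close>

lemma Pn_solve:
  "(\<And>w. w \<in> words D n \<Longrightarrow> cmod (g w) \<le> G) \<Longrightarrow> 0 \<le> G \<Longrightarrow>
    \<exists>f. \<forall>w\<in>words D n. Pn D n f w = g w \<and> cmod (f w) \<le> Rinv_norm ^ n * G"
proof (induction n arbitrary: g)
  case 0
  then show ?case by (intro exI[of _ g]) (simp add: Pn_0)
next
  case (Suc n)
  have "\<exists>h. \<forall>w\<in>words D n. Pn D n h w = g (a # w) \<and> cmod (h w) \<le> Rinv_norm ^ n * G" if "a \<in> letters D" for a
    using that by (intro Suc.IH Suc.prems) auto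
  then obtain h where h: "\<And>a w. a \<in> letters D \<Longrightarrow> w \<in> words D n \<Longrightarrow> Pn D n (h a) w = g (a # w)"
    "\<And>a w. a \<in> letters D \<Longrightarrow> w \<in> words D n \<Longrightarrow> cmod (h a w) \<le> Rinv_norm ^ n * G"
    by metis
  have Rinv_norm: "0 \<le> Rinv_norm" by (simp add: Rinv_norm_def)
  have "cmod (h (hd w) (tl w)) \<le> Rinv_norm ^ n * G" if "w \<in> words D (Suc n)" for w
    using that h(2)[of "hd w" "tl w"] by (cases w) (auto simp: words_def)
  then obtain f where f: "\<And>w. w \<in> words D (Suc n) \<Longrightarrow> RR_partial (Suc n) f w = h (hd w) (tl w)"
    "\<And>w. w \<in> words D (Suc n) \<Longrightarrow> cmod (f w) \<le> Rinv_bound (Suc n) * (Rinv_norm ^ n * G)"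
    using RR_partial_solve[of n "Suc n" "\<lambda>w. h (hd w) (tl w)" "Rinv_norm ^ n * G"] Rinv_norm Suc.prems(2) by auto
  show ?case
  proof (intro exI[of _ f] ballI conjI)
    fix w assume w: "w \<in> words D (Suc n)"
    have "Rinv_bound (Suc n) * (Rinv_norm ^ n * G) \<le> Rinv_norm * (Rinv_norm ^ n * G)"
      using Rinv_norm Suc.prems(2) by (intro mult_right_mono Rinv_bound_le) auto
    then show "cmod (f w) \<le> Rinv_norm ^ Suc n * G" using f(2)[OF w] by simp
    obtain a v where av: "w = a # v" using w by (cases w) (auto simp: words_def)
    have a: "a \<in> letters D" and v: "v \<in> words D n" using w av by auto
    have "Pn D (Suc n) f w = Pn D n (\<lambda>u. RR f (a # u)) v" using Pn_Cons w av by simp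
    also have "\<dots> = Pn D n (h a) v"
    proof (rule Pn_cong[OF v])
      fix u assume "u \<in> words D n"
      then have "a # u \<in> words D (Suc n)" using a by simp
      from RR_eq_partial[OF this] f(1)[OF this] show "RR f (a # u) = h a u" by simp
    qed
    finally show "Pn D (Suc n) f w = g w" using h(1)[OF a v] av by simp
  qed
qed

section \<open>Boundedness of free annihilation\<close>

lemma norm_fm_le:
  assumes "\<And>w. w \<in> words D n \<Longrightarrow> norm (g w) \<le> M"
  shows "norm (fm n f g) \<le> (\<Sum>w\<in>words D n. norm (f w)) * fact n * M"
proof -
  have "norm (fm n f g) \<le> (\<Sum>w\<in>words D n. norm (f w) * (fact n * M))"
    unfolding ipT_deg_def
    by (rule order_trans[OF norm_sum], rule sum_mono, unfold norm_mult complex_mod_cnj,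
        rule mult_left_mono[OF norm_Pn_le]) (use assms in auto)
  then show ?thesis by (simp add: sum_distrib_right mult.assoc)
qed

text \<open>Converse of \<open>fm_Suc_le\<close>: a right inverse S of R is symmetric for the form
  of P^(n+1), since that form takes f and S g to the tail form of f and g. Its iterates grow at most
  like \<open>Rinv_norm ^ k\<close> in the sup norm.\<close>

lemma fm_tail_le: "Re (fm_tail n f f) \<le> Rinv_norm * Re (fm (Suc n) f f)"
proof -
  have Rinv_norm: "0 < Rinv_norm" by (simp add: Rinv_norm_def)
  define mx where "mx g = (\<Sum>w\<in>words D (Suc n). cmod (g w))" for g :: fvec
  have mx: "cmod (g w) \<le> mx g" if "w \<in> words D (Suc n)" for g w
    unfolding mx_def by (rule member_le_sum) (use that in auto)
  have "\<exists>S. \<forall>g M. (\<forall>w\<in>words D (Suc n). cmod (g w) \<le> M) \<longrightarrow>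
      (\<forall>w\<in>words D (Suc n). RR (S g M) w = g w \<and> cmod (S g M w) \<le> Rinv_norm * M)"
  proof -
    have "\<exists>s. (\<forall>w\<in>words D (Suc n). cmod (g w) \<le> M) \<longrightarrow>
      (\<forall>w\<in>words D (Suc n). RR s w = g w \<and> cmod (s w) \<le> Rinv_norm * M)" for g M
    proof (cases "(\<forall>w\<in>words D (Suc n). cmod (g w) \<le> M) \<and> words D (Suc n) \<noteq> {}")
      case True
      then have M: "0 \<le> M" using norm_ge_zero order_trans by blast
      obtain s where s: "\<forall>w\<in>words D (Suc n). RR_partial (Suc n) s w = g w \<and> cmod (s w) \<le> Rinv_bound (Suc n) * M"
        using RR_partial_solve[of n "Suc n" g M] M True by auto
      have "Rinv_bound (Suc n) * M \<le> Rinv_norm * M" by (rule mult_right_mono[OF Rinv_bound_le M])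
      then show ?thesis using s RR_eq_partial[of _ n s] by (intro exI[of _ s]) fastforce
    qed auto
    then show ?thesis by metis
  qed
  then obtain S0 where S0: "\<And>g M w. (\<And>w. w \<in> words D (Suc n) \<Longrightarrow> cmod (g w) \<le> M) \<Longrightarrow> w \<in> words D (Suc n) \<Longrightarrow>
      RR (S0 g M) w = g w \<and> cmod (S0 g M w) \<le> Rinv_norm * M" by blast
  \<comment> \<open>Taking the exact sup norm as the bound makes S a function of g alone, with an
    estimate valid for every upper bound M; iterates need this.\<close>
  define mm where "mm g = Max (insert 0 ((\<lambda>w. cmod (g w)) ` words D (Suc n)))" for g :: fvec
  have mm: "cmod (g w) \<le> mm g" if "w \<in> words D (Suc n)" for g w
    unfolding mm_def using that by (intro Max_ge) auto
  have mm_le: "mm g \<le> M" if "\<And>w. w \<in> words D (Suc n) \<Longrightarrow> cmod (g w) \<le> M" "0 \<le> M" for g M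
    unfolding mm_def using that by (subst Max_le_iff) auto
  define S where "S g = S0 g (mm g)" for g
  have RS: "RR (S g) w = g w" if "w \<in> words D (Suc n)" for g w
    unfolding S_def using S0[where g = g and M = "mm g" and w = w, OF mm that] by blast
  have Sb: "cmod (S g w) \<le> Rinv_norm * M" if "w \<in> words D (Suc n)" "\<And>w. w \<in> words D (Suc n) \<Longrightarrow> cmod (g w) \<le> M" "0 \<le> M" for g w M
  proof -
    have "cmod (S g w) \<le> Rinv_norm * mm g" unfolding S_def using S0[where g = g and M = "mm g" and w = w, OF mm that(1)] by blast
    also have "\<dots> \<le> Rinv_norm * M" using Rinv_norm mm_le[OF that(2,3)] by (intro mult_left_mono) auto
    finally show ?thesis .
  qed
  have fmS: "fm (Suc n) f (S g) = fm_tail n f g" for f g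
    unfolding fm_Suc fm_tail_def by (intro sum.cong refl fm_cong RS) simp
  have mx0: "0 \<le> mx f" unfolding mx_def by (intro sum_nonneg) simp
  have iter: "cmod ((S ^^ k) f w) \<le> mx f * Rinv_norm ^ k" if "w \<in> words D (Suc n)" for k w
    using that
  proof (induction k arbitrary: w)
    case (Suc k)
    have "cmod (S ((S ^^ k) f) w) \<le> Rinv_norm * (mx f * Rinv_norm ^ k)"
      using Rinv_norm mx0 by (intro Sb[OF Suc.prems Suc.IH]) auto
    then show ?case by (simp add: mult_ac)
  qed (simp add: mx)
  have "Re (fm (Suc n) f (S f)) \<le> Rinv_norm * Re (fm (Suc n) f f)"
  proof (rule fms.symmetric_bound[where C = "(\<Sum>w\<in>words D (Suc n). norm (f w)) * fact (Suc n) * mx f"])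
    show "fm (Suc n) (S g) h = fm (Suc n) g (S h)" for g h
    proof -
      have "fm (Suc n) (S g) h = cnj (fm_tail n h g)" using fm_cnj[of "Suc n" "S g" h] by (simp only: fmS)
      also have "\<dots> = fm_tail n g h" by (rule fms_tail.B_cnj[symmetric]) auto
      finally show ?thesis by (simp only: fmS)
    qed
    show "cmod (fm (Suc n) f ((S ^^ k) f)) \<le> (\<Sum>w\<in>words D (Suc n). norm (f w)) * fact (Suc n) * mx f * Rinv_norm ^ k" for k
      using norm_fm_le[of "Suc n" "(S ^^ k) f" "mx f * Rinv_norm ^ k" f] iter by (simp only: mult.assoc)
  qed (use Rinv_norm in auto)
  then show ?thesis by (simp only: fmS)
qed

text \<open>Stripping the first letter k picks one of the nonnegative summands of the tail form,
  which P^(n+1) dominates.\<close>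

lemma shift_Fock:
  assumes f: "f \<in> Fock D" and k: "k \<in> letters D"
  shows "(\<lambda>x. f (k # x)) \<in> Fock D"
proof (rule down_Fock(1)[OF f])
  show "supp_words (\<lambda>x. f (k # x))"
    using f k unfolding Fock_iff supp_words_def by (metis Cons_words length_Cons)
  show "0 \<le> Rinv_norm" by (simp add: Rinv_norm_def)
  fix n
  have "Re (fm n (\<lambda>x. f (k # x)) (\<lambda>x. f (k # x))) \<le> (\<Sum>a\<in>letters D. Re (fm n (\<lambda>x. f (a # x)) (\<lambda>x. f (a # x))))"
    by (rule member_le_sum[OF k]) (auto simp: fm_nonneg)
  also have "\<dots> = Re (fm_tail n f f)" by (simp add: fm_tail_def Re_sum)
  also have "\<dots> \<le> Rinv_norm * Re (fm (Suc n) f f)" by (rule fm_tail_le)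
  finally show "Re (fm n (\<lambda>x. f (k # x)) (\<lambda>x. f (k # x))) \<le> Rinv_norm * Re (fm (Suc n) f f)" .
qed

lemma lann_bas:
  assumes "f \<in> Fock D" "k \<in> letters D"
  shows "lann D (bas D k) f = (\<lambda>x. f (k # x))"
proof
  fix x
  have "lann D (bas D k) f x = (\<Sum>l\<in>letters D. if l = k then f (l # x) else 0)"
    unfolding lann_def if_P[OF assms(1)] using ipU_bas[OF aw_setup assms(2)] by (intro sum.cong) auto
  then show "lann D (bas D k) f x = f (k # x)" using assms(2) by simp
qed

text \<open>The operator applied first removes the first letter of w and the last one removes
  \<beta>, so f is read off behind the prefix w \<beta>.\<close>

lemma Lop_eq:
  assumes f: "f \<in> Fock D" and w: "set w \<subseteq> letters D" and b: "\<beta> \<in> letters D"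
  shows "Lop D w \<beta> f = (\<lambda>x. f (w @ \<beta> # x))"
proof -
  have "foldr (\<lambda>k X. lann D (bas D k) \<circ> X) ks id f = (\<lambda>x. f (rev ks @ x)) \<and> (\<lambda>x. f (rev ks @ x)) \<in> Fock D"
    if "set ks \<subseteq> letters D" for ks
    using that
  proof (induction ks)
    case (Cons k ks)
    have k: "k \<in> letters D" and ks: "set ks \<subseteq> letters D" using Cons.prems by auto
    note IH = conjunct1[OF Cons.IH[OF ks]] conjunct2[OF Cons.IH[OF ks]]
    have e: "foldr (\<lambda>k X. lann D (bas D k) \<circ> X) (k # ks) id f =
        lann D (bas D k) (foldr (\<lambda>k X. lann D (bas D k) \<circ> X) ks id f)"
      by (simp only: foldr_Cons comp_apply)
    show ?case
      unfolding e IH(1) lann_bas[OF IH(2) k] using shift_Fock[OF IH(2) k] by simp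
  qed (use f in simp)
  from this[of "\<beta> # rev w"] show ?thesis unfolding Lop_def using w b by simp
qed

end

section \<open>Partitions without singletons\<close>

text \<open>Letters are numbered from the right. In a word w \<beta> u with |w| = |u| = k, the i-th
  letter of w has number 2k + 2 - i, \<beta> has k + 1 and the j-th letter of u has k + 1 - j. So
  \<sigma> pairs letter i of w with letter \<open>\<sigma> i\<close> of u, and 0 is paired with
  \<beta>.\<close>

definition nblock :: "nat \<Rightarrow> (nat \<Rightarrow> nat) \<Rightarrow> nat \<Rightarrow> nat set" where
  "nblock k \<sigma> i = (if i = 0 then {0, k + 1} else {k + 1 - \<sigma> i, 2 * k + 2 - i})"

definition npart :: "nat \<Rightarrow> (nat \<Rightarrow> nat) \<Rightarrow> nat set set" where
  "npart k \<sigma> = nblock k \<sigma> ` {0..k}"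

lemma partner_eq:
  assumes "partition_on A P" "{x, y} \<in> P" "x \<noteq> y"
  shows "partner P x = y" "x \<notin> singles P"
proof -
  have dis: "b = c" if "b \<in> P" "c \<in> P" "z \<in> b" "z \<in> c" for b c z
    using partition_onD2[OF assms(1)] that by (auto simp: disjoint_def)
  show s: "x \<notin> singles P"
  proof
    assume "x \<in> singles P"
    then have "{x} = {x, y}" by (intro dis[of _ _ x] assms(2)) (auto simp: singles_def)
    then show False using assms(3) by auto
  qed
  have "(THE l. l \<noteq> x \<and> {x, l} \<in> P) = y"
  proof (rule the_equality)
    show "y \<noteq> x \<and> {x, y} \<in> P" using assms by blast
    fix l assume l: "l \<noteq> x \<and> {x, l} \<in> P"
    then have "{x, l} = {x, y}" by (intro dis[of _ _ x] assms(2)) auto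
    then show "l = y" by (auto simp: doubleton_eq_iff)
  qed
  then show "partner P x = y" using s by (simp add: partner_def)
qed

context
  fixes k \<sigma> assumes \<sigma>: "\<sigma> permutes {1..k::nat}"
begin

lemma perm_range: "i \<in> {1..k} \<Longrightarrow> \<sigma> i \<in> {1..k}" "i \<in> {1..k} \<Longrightarrow> inv \<sigma> i \<in> {1..k}"
  using permutes_in_iff_atLeastAtMost[OF \<sigma>] permutes_in_iff_atLeastAtMost[OF permutes_inv[OF \<sigma>]] by auto

text \<open>The index of the block containing x, which shows at once that the blocks are disjoint
  and exhaust the set.\<close>

definition nlabel :: "nat \<Rightarrow> nat" where
  "nlabel x = (if x = 0 \<or> x = k + 1 then 0 else if x \<le> k then inv \<sigma> (k + 1 - x) else 2 * k + 2 - x)"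

lemma nlabel_block: "i \<in> {0..k} \<Longrightarrow> x \<in> nblock k \<sigma> i \<Longrightarrow> nlabel x = i"
proof (cases "i = 0")
  case False
  assume "i \<in> {0..k}" and x: "x \<in> nblock k \<sigma> i"
  then have i: "i \<in> {1..k}" using False by simp
  note r = perm_range(1)[OF i]
  have "inv \<sigma> (k + 1 - (k + 1 - \<sigma> i)) = i" using r permutes_inverses(2)[OF \<sigma>] by simp
  then show ?thesis using x i r False by (auto simp: nblock_def nlabel_def)
qed (auto simp: nblock_def nlabel_def)

lemma nblock_label: 
  assumes x: "x \<in> {0..2 * k + 1}"
  shows "nlabel x \<in> {0..k}" "x \<in> nblock k \<sigma> (nlabel x)"
proof -
  consider "x = 0 \<or> x = k + 1" | "1 \<le> x" "x \<le> k" | "k + 1 < x" "x \<le> 2 * k + 1" using x by fastforce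
  then have "nlabel x \<in> {0..k} \<and> x \<in> nblock k \<sigma> (nlabel x)"
  proof cases
    case 2
    then have "k + 1 - x \<in> {1..k}" by auto
    note r = perm_range(2)[OF this]
    have "nlabel x = inv \<sigma> (k + 1 - x)" using 2 by (simp add: nlabel_def)
    then show ?thesis using r 2 permutes_inverses(1)[OF \<sigma>] by (simp add: nblock_def)
  next
    case 3
    then have "nlabel x = 2 * k + 2 - x" by (simp add: nlabel_def)
    then show ?thesis using 3 by (simp add: nblock_def)
  qed (auto simp: nlabel_def nblock_def)
  then show "nlabel x \<in> {0..k}" "x \<in> nblock k \<sigma> (nlabel x)" by auto
qed

lemma nblock_subset: "i \<in> {0..k} \<Longrightarrow> nblock k \<sigma> i \<subseteq> {0..2 * k + 1}"
  using perm_range(1)[of i] by (auto simp: nblock_def)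

lemma npart_partition: "partition_on {0..2 * k + 1} (npart k \<sigma>)"
proof (rule partition_onI)
  show "\<Union> (npart k \<sigma>) = {0..2 * k + 1}"
  proof
    show "\<Union> (npart k \<sigma>) \<subseteq> {0..2 * k + 1}" unfolding npart_def using nblock_subset by blast
    show "{0..2 * k + 1} \<subseteq> \<Union> (npart k \<sigma>)" unfolding npart_def using nblock_label by blast
  qed
  fix b c assume "b \<in> npart k \<sigma>" "c \<in> npart k \<sigma>" "b \<noteq> c"
  then obtain i j where ij: "i \<in> {0..k}" "j \<in> {0..k}" "b = nblock k \<sigma> i" "c = nblock k \<sigma> j"
    unfolding npart_def by blast
  show "disjnt b c"
    unfolding disjnt_def
  proof (rule ccontr)
    assume "b \<inter> c \<noteq> {}"
    then obtain x where x: "x \<in> nblock k \<sigma> i" "x \<in> nblock k \<sigma> j" using ij by blast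
    have "i = j" using nlabel_block[OF ij(1) x(1)] nlabel_block[OF ij(2) x(2)] by simp
    then show False using ij \<open>b \<noteq> c\<close> by simp
  qed
next
  show "{} \<notin> npart k \<sigma>" by (auto simp: npart_def nblock_def split: if_splits)
qed

lemma nblock_pair: "i \<in> {1..k} \<Longrightarrow> {k + 1 - \<sigma> i, 2 * k + 2 - i} \<in> npart k \<sigma>"
  unfolding npart_def nblock_def by (rule image_eqI[of _ _ i]) auto

lemma nblock_zero: "{0, k + 1} \<in> npart k \<sigma>"
  unfolding npart_def nblock_def by (rule image_eqI[of _ _ 0]) auto

lemma npart_cases:
  assumes "b \<in> npart k \<sigma>"
  obtains "b = {0, k + 1}" | i where "i \<in> {1..k}" "b = {k + 1 - \<sigma> i, 2 * k + 2 - i}"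
proof -
  obtain i where i: "i \<in> {0..k}" "b = nblock k \<sigma> i" using assms unfolding npart_def by blast
  show ?thesis
  proof (cases "i = 0")
    case True
    then show ?thesis using that(1) i by (simp add: nblock_def)
  next
    case False
    then show ?thesis using that(2)[of i] i by (simp add: nblock_def)
  qed
qed

lemma card_npart: "b \<in> npart k \<sigma> \<Longrightarrow> card b = 2"
proof (erule npart_cases)
  fix i assume i: "i \<in> {1..k}" and b: "b = {k + 1 - \<sigma> i, 2 * k + 2 - i}"
  have "k + 1 - \<sigma> i \<noteq> 2 * k + 2 - i" using perm_range(1)[OF i] i by auto
  then show "card b = 2" by (simp add: b)
qed simp

lemma partner_npart:
  shows "partner (npart k \<sigma>) 0 = k + 1"
    and "i \<in> {1..k} \<Longrightarrow> partner (npart k \<sigma>) (k + 1 - \<sigma> i) = 2 * k + 2 - i"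
proof -
  show "partner (npart k \<sigma>) 0 = k + 1" by (rule partner_eq(1)[OF npart_partition nblock_zero]) simp
  assume i: "i \<in> {1..k}"
  show "partner (npart k \<sigma>) (k + 1 - \<sigma> i) = 2 * k + 2 - i"
    by (rule partner_eq(1)[OF npart_partition nblock_pair[OF i]]) (use perm_range(1)[OF i] i in auto)
qed

lemma singles_npart: "singles (npart k \<sigma>) = {}"
  by (auto simp: singles_def dest: card_npart)

lemma npart_Bpart: "npart k \<sigma> \<in> Bpart (2 * k + 1)"
proof -
  have "\<exists>m\<in>{k + 1<..2 * k + 1}. {l, m} \<in> npart k \<sigma>" if l: "l \<in> {1..<k + 1}" for l
  proof (rule bexI[of _ "2 * k + 2 - inv \<sigma> (k + 1 - l)"])
    have "k + 1 - l \<in> {1..k}" using l by auto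
    note r = perm_range(2)[OF this]
    have "k + 1 - \<sigma> (inv \<sigma> (k + 1 - l)) = l" using l permutes_inverses(1)[OF \<sigma>] by simp
    then show "{l, 2 * k + 2 - inv \<sigma> (k + 1 - l)} \<in> npart k \<sigma>" using nblock_pair[OF r] by simp
    show "2 * k + 2 - inv \<sigma> (k + 1 - l) \<in> {k + 1<..2 * k + 1}" using r by auto
  qed
  moreover have "b = {0, k + 1} \<or> (\<exists>l\<in>{1..<k + 1}. l \<in> b)" if "b \<in> npart k \<sigma>" for b
    using that
  proof (cases rule: npart_cases)
    case (2 i)
    then show ?thesis using perm_range(1)[OF 2(1)] by (intro disjI2 bexI[of _ "k + 1 - \<sigma> i"]) auto
  qed simp
  ultimately have "\<exists>m\<in>{1..2 * k + 1}. {0, m} \<in> npart k \<sigma> \<and>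
      (\<forall>l\<in>{1..<m}. \<exists>t\<in>{m<..2 * k + 1}. {l, t} \<in> npart k \<sigma>) \<and>
      (\<forall>b\<in>npart k \<sigma>. card b = 2 \<longrightarrow> b = {0, m} \<or> (\<exists>l\<in>{1..<m}. l \<in> b))"
    using nblock_zero by (intro bexI[of _ "k + 1"]) auto
  then show ?thesis unfolding Bpart_def using npart_partition card_npart by blast
qed

end

section \<open>Partitions without singletons correspond to permutations\<close>

lemma npart_inj:
  assumes "\<sigma> permutes {1..k}" "\<tau> permutes {1..k}" "npart k \<sigma> = npart k \<tau>"
  shows "\<sigma> = \<tau>"
proof
  fix i
  show "\<sigma> i = \<tau> i"
  proof (cases "i \<in> {1..k}")
    case True
    let ?x = "k + 1 - \<sigma> i"
    have r: "\<sigma> i \<in> {1..k}" "\<tau> i \<in> {1..k}" 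
      using perm_range(1)[OF assms(1) True] perm_range(1)[OF assms(2) True] by auto
    have "partner (npart k \<sigma>) (2 * k + 2 - i) = k + 1 - \<sigma> i"
      using partner_eq(1)[OF npart_partition[OF assms(1)], of "2 * k + 2 - i" "k + 1 - \<sigma> i"]
        nblock_pair[OF assms(1) True] True by (auto simp: insert_commute)
    moreover have "partner (npart k \<tau>) (2 * k + 2 - i) = k + 1 - \<tau> i"
      using partner_eq(1)[OF npart_partition[OF assms(2)], of "2 * k + 2 - i" "k + 1 - \<tau> i"]
        nblock_pair[OF assms(2) True] True by (auto simp: insert_commute)
    ultimately show ?thesis using r assms(3) by auto
  next
    case False
    then show ?thesis using permutes_not_in[OF assms(1) False] permutes_not_in[OF assms(2) False] by simp
  qed
qed

text \<open>Let m be the partner of 0. Without singletons every element above m is paired with one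
  of 1, ..., m - 1, and by definition each of these with an element above m. Hence n = 2m - 1 and
  the pairing is a permutation.\<close>

lemma Bpart_no_singles:
  assumes P: "P \<in> Bpart n" and s: "singles P = {}"
  obtains k \<sigma> where "n = 2 * k + 1" "\<sigma> permutes {1..k}" "P = npart k \<sigma>"
proof -
  have part: "partition_on {0..n} P" and card12: "\<And>b. b \<in> P \<Longrightarrow> card b = 1 \<or> card b = 2"
    using P by (auto simp: Bpart_def)
  obtain m where m: "m \<in> {1..n}" "{0, m} \<in> P" 
    and low: "\<And>l. l \<in> {1..<m} \<Longrightarrow> \<exists>t\<in>{m<..n}. {l, t} \<in> P"
    and rest: "\<And>b. b \<in> P \<Longrightarrow> card b = 2 \<Longrightarrow> b = {0, m} \<or> (\<exists>l\<in>{1..<m}. l \<in> b)"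
    using P by (auto simp: Bpart_def)
  have card2: "card b = 2" if "b \<in> P" for b
    using card12[OF that] s that by (auto simp: singles_def card_1_singleton_iff)
  have dis: "b = c" if "b \<in> P" "c \<in> P" "z \<in> b" "z \<in> c" for b c z
    using partition_onD2[OF part] that by (auto simp: disjoint_def)
  have high: "\<exists>l\<in>{1..<m}. {l, t} \<in> P" if t: "t \<in> {m<..n}" for t
  proof -
    have "t \<in> \<Union> P" using t unfolding partition_onD1[OF part, symmetric] by simp
    then obtain b where b: "b \<in> P" "t \<in> b" by blast
    have "b \<noteq> {0, m}" using b t by auto
    then obtain l where l: "l \<in> {1..<m}" "l \<in> b" using rest[OF b(1) card2[OF b(1)]] by blast
    have "l \<noteq> t" using l t by auto
    then have "b = {l, t}" using card2[OF b(1)] l(2) b(2) by (auto simp: card_2_iff)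
    then show ?thesis using l b by blast
  qed
  then obtain f where f: "\<And>t. t \<in> {m<..n} \<Longrightarrow> f t \<in> {1..<m} \<and> {f t, t} \<in> P" by metis
  have injf: "inj_on f {m<..n}"
  proof (rule inj_onI)
    fix t u assume t: "t \<in> {m<..n}" and u: "u \<in> {m<..n}" and e: "f t = f u"
    have "{f t, t} = {f u, u}" using dis[of "{f t, t}" "{f u, u}" "f t"] f[OF t] f[OF u] e by auto
    then show "t = u" using e f[OF t] f[OF u] t u by (auto simp: doubleton_eq_iff)
  qed
  have imf: "f ` {m<..n} = {1..<m}"
  proof
    show "f ` {m<..n} \<subseteq> {1..<m}" using f by auto
    show "{1..<m} \<subseteq> f ` {m<..n}"
    proof
      fix l assume l: "l \<in> {1..<m}"
      then obtain t where t: "t \<in> {m<..n}" "{l, t} \<in> P" using low by blast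
      have "{f t, t} = {l, t}" using dis[of "{f t, t}" "{l, t}" t] f[OF t(1)] t(2) by auto
      then have "f t = l" using f[OF t(1)] l t(1) by (auto simp: doubleton_eq_iff)
      then show "l \<in> f ` {m<..n}" using t(1) by blast
    qed
  qed
  define k where "k = m - 1"
  have mk: "m = k + 1" using m by (simp add: k_def)
  have "card {m<..n} = card {1..<m}" using card_image[OF injf] imf by simp
  then have n: "n = 2 * k + 1" using m mk by auto
  \<comment> \<open>Solves \<open>k + 1 - \<sigma> i = f (2 * k + 2 - i)\<close>, the lower member
    of the i-th block.\<close>
  define \<sigma> where "\<sigma> i = (if i \<in> {1..k} then k + 1 - f (2 * k + 2 - i) else i)" for i
  have tr: "2 * k + 2 - i \<in> {m<..n}" if "i \<in> {1..k}" for i using that mk n by auto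
  have fr: "f (2 * k + 2 - i) \<in> {1..k}" if "i \<in> {1..k}" for i using f[OF tr[OF that]] mk by auto
  have \<sigma>: "\<sigma> permutes {1..k}"
  proof (rule bij_imp_permutes)
    have "inj_on \<sigma> {1..k}"
    proof (rule inj_onI)
      fix i j assume i: "i \<in> {1..k}" and j: "j \<in> {1..k}" and e: "\<sigma> i = \<sigma> j"
      have aux: "x = y" if "k + 1 - x = k + 1 - y" "x \<in> {1..k}" "y \<in> {1..k}" for x y :: nat
        using that by auto
      have "k + 1 - f (2 * k + 2 - i) = k + 1 - f (2 * k + 2 - j)" using e i j by (simp add: \<sigma>_def)
      then have "f (2 * k + 2 - i) = f (2 * k + 2 - j)" by (rule aux[OF _ fr[OF i] fr[OF j]])
      then have "2 * k + 2 - i = 2 * k + 2 - j" using inj_onD[OF injf] tr[OF i] tr[OF j] by blast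
      then show "i = j" using i j by auto
    qed
    moreover have "\<sigma> ` {1..k} \<subseteq> {1..k}" using fr by (force simp: \<sigma>_def)
    ultimately show "bij_betw \<sigma> {1..k} {1..k}" by (simp add: bij_betw_def endo_inj_surj)
  qed (auto simp: \<sigma>_def)
  have pair: "{k + 1 - \<sigma> i, 2 * k + 2 - i} = {f (2 * k + 2 - i), 2 * k + 2 - i}" if "i \<in> {1..k}" for i
    using that fr[OF that] by (simp add: \<sigma>_def)
  have "P = npart k \<sigma>"
  proof
    show "npart k \<sigma> \<subseteq> P"
    proof
      fix b assume b: "b \<in> npart k \<sigma>"
      show "b \<in> P"
      proof (rule npart_cases[OF \<sigma> b])
        assume "b = {0, k + 1}"
        then show ?thesis using m mk by simp
      next
        fix i assume i: "i \<in> {1..k}" and "b = {k + 1 - \<sigma> i, 2 * k + 2 - i}"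
        then show ?thesis using pair[OF i] f[OF tr[OF i]] by simp
      qed
    qed
    show "P \<subseteq> npart k \<sigma>"
    proof
      fix b assume b: "b \<in> P"
      from rest[OF b card2[OF b]] show "b \<in> npart k \<sigma>"
      proof
        assume "b = {0, m}"
        then show ?thesis using nblock_zero[OF \<sigma>] mk by simp
      next
        assume "\<exists>l\<in>{1..<m}. l \<in> b"
        then obtain l where l: "l \<in> {1..<m}" "l \<in> b" by blast
        then obtain t where t: "t \<in> {m<..n}" "f t = l" using imf by (metis imageE)
        have "b = {f t, t}" using dis[OF b, of "{f t, t}" l] f[OF t(1)] l t by auto
        moreover have i: "2 * k + 2 - t \<in> {1..k}" and "2 * k + 2 - (2 * k + 2 - t) = t" using t mk n by auto
        ultimately show ?thesis using nblock_pair[OF \<sigma> i] pair[OF i] by simp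
      qed
    qed
  qed
  then show ?thesis using that n \<sigma> by blast
qed

lemma sum_Bpart_no_singles:
  "(\<Sum>P\<in>{P \<in> Bpart (2 * k + 1). singles P = {}}. F P) = (\<Sum>\<sigma> | \<sigma> permutes {1..k}. F (npart k \<sigma>))"
proof (rule sum.reindex_bij_betw[symmetric], rule bij_betw_imageI)
  show "inj_on (npart k) {\<sigma>. \<sigma> permutes {1..k}}" using npart_inj by (auto simp: inj_on_def)
  show "npart k ` {\<sigma>. \<sigma> permutes {1..k}} = {P \<in> Bpart (2 * k + 1). singles P = {}}"
  proof (intro equalityI subsetI)
    fix P assume "P \<in> npart k ` {\<sigma>. \<sigma> permutes {1..k}}"
    then show "P \<in> {P \<in> Bpart (2 * k + 1). singles P = {}}" using npart_Bpart singles_npart by auto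
  next
    fix P assume "P \<in> {P \<in> Bpart (2 * k + 1). singles P = {}}"
    then obtain k' \<sigma> where "2 * k + 1 = 2 * k' + 1" "\<sigma> permutes {1..k'}" "P = npart k' \<sigma>"
      using Bpart_no_singles[of P "2 * k + 1"] by blast
    then show "P \<in> npart k ` {\<sigma>. \<sigma> permutes {1..k}}" by auto
  qed
qed

lemma Bpart_even_no_singles: "even n \<Longrightarrow> {P \<in> Bpart n. singles P = {}} = {}"
  using Bpart_no_singles[of _ n] by force

text \<open>\<open>pairs k\<close> lists unordered pairs, which \<tau> permutes; the symmetry of s
  absorbs the sorting.\<close>

lemma prod_pairs_permute:
  fixes s :: "nat \<Rightarrow> nat \<Rightarrow> 'c::comm_monoid_mult"
  assumes \<tau>: "\<tau> permutes {1..k}" and sym: "\<And>a b. a \<in> {1..k} \<Longrightarrow> b \<in> {1..k} \<Longrightarrow> s a b = s b a"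
  shows "(\<Prod>(a, b)\<in>pairs k. s (\<tau> a) (\<tau> b)) = (\<Prod>(a, b)\<in>pairs k. s a b)"
proof (rule prod.reindex_bij_witness[of _
    "\<lambda>(a, b). if inv \<tau> a < inv \<tau> b then (inv \<tau> a, inv \<tau> b) else (inv \<tau> b, inv \<tau> a)"
    "\<lambda>(i, j). if \<tau> i < \<tau> j then (\<tau> i, \<tau> j) else (\<tau> j, \<tau> i)"])
  note I = permutes_inverses[OF \<tau>]
  note R = perm_range[OF \<tau>]
  fix e assume e: "e \<in> pairs k"
  obtain a b where ab: "e = (a, b)" by force
  with e have *: "a \<in> {1..k}" "b \<in> {1..k}" "a < b" by (auto simp: pairs_def)
  have ne: "\<tau> a \<noteq> \<tau> b" "inv \<tau> a \<noteq> inv \<tau> b" using I *(3) by (metis less_irrefl)+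
  show "(\<lambda>(a, b). if inv \<tau> a < inv \<tau> b then (inv \<tau> a, inv \<tau> b) else (inv \<tau> b, inv \<tau> a))
      (case e of (i, j) \<Rightarrow> if \<tau> i < \<tau> j then (\<tau> i, \<tau> j) else (\<tau> j, \<tau> i)) = e"
    using * by (simp add: ab I)
  show "(\<lambda>(i, j). if \<tau> i < \<tau> j then (\<tau> i, \<tau> j) else (\<tau> j, \<tau> i))
      (case e of (a, b) \<Rightarrow> if inv \<tau> a < inv \<tau> b then (inv \<tau> a, inv \<tau> b) else (inv \<tau> b, inv \<tau> a)) = e"
    using * by (simp add: ab I)
  show "(case e of (i, j) \<Rightarrow> if \<tau> i < \<tau> j then (\<tau> i, \<tau> j) else (\<tau> j, \<tau> i)) \<in> pairs k"
    using R(1)[OF *(1)] R(1)[OF *(2)] ne(1) by (auto simp: ab pairs_def)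
  show "(case e of (a, b) \<Rightarrow> if inv \<tau> a < inv \<tau> b then (inv \<tau> a, inv \<tau> b) else (inv \<tau> b, inv \<tau> a)) \<in> pairs k"
    using R(2)[OF *(1)] R(2)[OF *(2)] ne(2) by (auto simp: ab pairs_def)
  show "(case (case e of (i, j) \<Rightarrow> if \<tau> i < \<tau> j then (\<tau> i, \<tau> j) else (\<tau> j, \<tau> i)) of (a, b) \<Rightarrow> s a b) =
      (case e of (a, b) \<Rightarrow> s (\<tau> a) (\<tau> b))"
    using sym[OF R(1)[OF *(1)] R(1)[OF *(2)]] by (simp add: ab)
qed

lemma finite_Bpart: "finite (Bpart n)"
  by (rule finite_subset[of _ "Pow (Pow {0..n})"]) (auto simp: Bpart_def partition_on_def)

context aw begin

section \<open>The vectors \<open>\<xi>\<^sub>m\<close>\<close>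

lemma bas_bar: "ipU D (cconj (bas D k)) (bas D l) = cnj (coord (cconj (bas D k)) l)"
  by (rule coord_cnj[symmetric])

lemma ebar_app:
  "x \<in> words D (length w) \<Longrightarrow> ebar_word D w x = (\<Prod>p<length w. coord (cconj (bas D (w ! p))) (x ! p))"
  by (simp add: ebar_word_def tens_def coord_def)

lemma ebar_out: "x \<notin> words D (length w) \<Longrightarrow> ebar_word D w x = 0"
  by (simp add: ebar_word_def tens_def)

lemma ebar_bound:
  assumes w: "w \<in> words D k" shows "cmod (ebar_word D w x) \<le> wick_base ^ k"
proof (cases "x \<in> words D (length w)")
  case True
  then have x: "x \<in> words D k" using words_length[OF w] by simp
  have "cmod (ebar_word D w x) = (\<Prod>p<k. cmod (coord (cconj (bas D (w ! p))) (x ! p)))"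
    unfolding ebar_app[OF True] words_length[OF w] by (rule prod_norm[symmetric])
  also have "\<dots> \<le> (\<Prod>p<k. wick_base)"
  proof (rule prod_mono)
    fix p assume "p \<in> {..<k}"
    then have p: "Suc p \<in> {1..k}" by simp
    show "0 \<le> cmod (coord (cconj (bas D (w ! p))) (x ! p)) \<and> cmod (coord (cconj (bas D (w ! p))) (x ! p)) \<le> wick_base"
      using wick_base_bounds(3)[OF nth_words[OF w p] nth_words[OF x p]] by simp
  qed
  finally show ?thesis by simp
next
  case False
  then show ?thesis using wick_base_bounds(1) by (simp add: ebar_out)
qed

text \<open>The form as a plain sum over the coordinates of its second argument: h represents a
  given functional as soon as P h has prescribed values.\<close>

lemma fm_cnj_sum: "fm n h f = (\<Sum>w\<in>words D n. f w * cnj (Pn D n h w))"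
  unfolding fm_cnj[of n h f] by (simp add: ipT_deg_def)

lemma ipT_single:
  assumes "\<And>x. h x \<noteq> 0 \<Longrightarrow> length x = n"
  shows "ipT D h f = fm n h f"
proof -
  have "fm m h f = 0" if "m \<notin> {n}" for m
    unfolding ipT_deg_def using assms that words_length by (intro sum.neutral) fastforce
  then show ?thesis
    unfolding ipT_def using suminf_finite[of "{n}" "\<lambda>m. fm m h f"] by simp
qed

lemma drop_words: "y \<in> words D (k + 1 + n) \<Longrightarrow> drop (k + 1) y \<in> words D n"
  using set_drop_subset[of "k + 1" y] by (auto simp: words_def)

lemma take_words: "y \<in> words D (k + n) \<Longrightarrow> take k y \<in> words D k"
  using set_take_subset[of k y] by (auto simp: words_def min_def)

definition Lstar_ebar :: "nat list \<Rightarrow> nat \<Rightarrow> fvec" where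
  "Lstar_ebar w \<beta> = adj D (Lop D w \<beta>) (ebar_word D w)"

text \<open>The adjoint vector solves P h = g, where g lives on the words beginning with w \<beta>
  and is P^(k) of the conjugate word on the k letters behind. \<open>Pn_solve\<close> supplies both
  the vector and its bound.\<close>

lemma Lstar_ebar_props:
  assumes w: "w \<in> words D k" and b: "\<beta> \<in> letters D"
  shows "supp_words (Lstar_ebar w \<beta>)" "Lstar_ebar w \<beta> x \<noteq> 0 \<Longrightarrow> length x = 2 * k + 1"
    and "y \<in> words D (2 * k + 1) \<Longrightarrow> Pn D (2 * k + 1) (Lstar_ebar w \<beta>) y =
      (if take k y = w \<and> y ! k = \<beta> then Pn D k (ebar_word D w) (drop (k + 1) y) else 0)"
    and "cmod (Lstar_ebar w \<beta> x) \<le> Rinv_norm ^ (2 * k + 1) * (fact k * wick_base ^ k)"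
proof -
  let ?N = "2 * k + 1" and ?G = "fact k * wick_base ^ k"
  let ?g = "\<lambda>y. if take k y = w \<and> y ! k = \<beta> then Pn D k (ebar_word D w) (drop (k + 1) y) else 0"
  have lw: "length w = k" and sw: "set w \<subseteq> letters D" using w by (auto simp: words_def)
  have G0: "0 \<le> ?G" using wick_base_bounds(1) by simp
  have N: "?N = k + 1 + k" by simp
  have dN: "drop (k + 1) y \<in> words D k" if "y \<in> words D ?N" for y
    using that unfolding N by (rule drop_words)
  have "cmod (?g y) \<le> ?G" if y: "y \<in> words D ?N" for y
    using norm_Pn_le[OF dN[OF y] ebar_bound[OF w]] G0 by simp
  then obtain h0 where h0: "\<And>y. y \<in> words D ?N \<Longrightarrow> Pn D ?N h0 y = ?g y"
    "\<And>y. y \<in> words D ?N \<Longrightarrow> cmod (h0 y) \<le> Rinv_norm ^ ?N * ?G"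
    using Pn_solve[of ?N ?g ?G] G0 by blast
  \<comment> \<open>\<open>Pn_solve\<close> says nothing about h0 at words of other lengths; cutting
    it off there yields a vector of the Fock space.\<close>
  define h where "h x = (if x \<in> words D ?N then h0 x else 0)" for x
  have hs: "supp_words h" by (auto simp: supp_words_def h_def words_length)
  have hl: "length x = ?N" if "h x \<noteq> 0" for x using that by (auto simp: h_def words_length split: if_splits)
  have hF: "h \<in> Fock D" by (rule fdeg_Fock[of "Suc ?N"]) (use hs hl in \<open>auto simp: fdeg_def\<close>)
  have Ph: "Pn D ?N h y = ?g y" if "y \<in> words D ?N" for y
    unfolding h0(1)[OF that, symmetric] by (rule Pn_cong[OF that]) (simp add: h_def)
  have hb: "cmod (h x) \<le> Rinv_norm ^ ?N * ?G" for x
    using h0(2) G0 by (auto simp: h_def Rinv_norm_def)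
  have "Lstar_ebar w \<beta> = h"
    unfolding Lstar_ebar_def
  proof (rule adj_eqI[OF _ hF])
    show "ebar_word D w \<in> Fock D" unfolding ebar_word_def by (rule tens_Fock)
    fix f assume f: "f \<in> Fock D"
    have "ipT D h f = fm ?N h f" by (rule ipT_single) (rule hl)
    also have "\<dots> = (\<Sum>y\<in>words D ?N. f y * cnj (?g y))"
      unfolding fm_cnj_sum by (intro sum.cong refl) (simp only: Ph)
    also have "\<dots> = (\<Sum>y\<in>words D ?N. if take k y = w \<and> y ! k = \<beta>
        then f y * cnj (Pn D k (ebar_word D w) (drop (k + 1) y)) else 0)"
      by (intro sum.cong refl) simp
    also have "\<dots> = (\<Sum>y\<in>{y \<in> words D ?N. take k y = w \<and> y ! k = \<beta>}.
        f y * cnj (Pn D k (ebar_word D w) (drop (k + 1) y)))"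
      by (rule sum.inter_filter[symmetric]) simp
    also have "\<dots> = (\<Sum>x\<in>words D k. f (w @ \<beta> # x) * cnj (Pn D k (ebar_word D w) x))"
    proof (rule sum.reindex_bij_witness[of _ "\<lambda>x. w @ \<beta> # x" "drop (k + 1)"])
      fix y assume y: "y \<in> {y \<in> words D ?N. take k y = w \<and> y ! k = \<beta>}"
      then have "k < length y" by (simp add: words_def)
      from id_take_nth_drop[OF this] have yy: "take k y @ y ! k # drop (k + 1) y = y" by (simp only: Suc_eq_plus1)
      have "w = take k y" "\<beta> = y ! k" using y by auto
      then show e: "w @ \<beta> # drop (k + 1) y = y" by (simp only: yy)
      show "drop (k + 1) y \<in> words D k" using y dN by blast
      show "f (w @ \<beta> # drop (k + 1) y) * cnj (Pn D k (ebar_word D w) (drop (k + 1) y)) =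
          f y * cnj (Pn D k (ebar_word D w) (drop (k + 1) y))" unfolding e ..
    next
      fix x assume "x \<in> words D k"
      then show "w @ \<beta> # x \<in> {y \<in> words D ?N. take k y = w \<and> y ! k = \<beta>}"
        using lw sw b by (auto simp: words_def nth_append)
    qed (use lw in simp)
    also have "\<dots> = ipT D (ebar_word D w) (\<lambda>x. f (w @ \<beta> # x))"
    proof -
      have "length x = k" if "ebar_word D w x \<noteq> 0" for x
        using that ebar_out[of x w] words_length lw by metis
      then have "ipT D (ebar_word D w) g = fm k (ebar_word D w) g" for g by (rule ipT_single)
      then show ?thesis by (simp only: fm_cnj_sum)
    qed
    finally show "ipT D h f = ipT D (ebar_word D w) (Lop D w \<beta> f)"
      by (simp only: Lop_eq[OF f sw b])
  qed
  then show "supp_words (Lstar_ebar w \<beta>)" "Lstar_ebar w \<beta> x \<noteq> 0 \<Longrightarrow> length x = 2 * k + 1"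
    "y \<in> words D (2 * k + 1) \<Longrightarrow> Pn D (2 * k + 1) (Lstar_ebar w \<beta>) y = ?g y"
    "cmod (Lstar_ebar w \<beta> x) \<le> Rinv_norm ^ (2 * k + 1) * (fact k * wick_base ^ k)"
    using hs hl Ph hb by simp_all
qed

section \<open>Coefficients, size and image under P of the vectors\<close>

definition xi_coeff :: "nat \<Rightarrow> nat \<Rightarrow> nat list \<Rightarrow> complex" where
  "xi_coeff \<alpha> k w = of_real (\<Prod>(v, u)\<in>pairs k. qm D (dg D (letter w v)) (dg D (letter w u)))
     * of_real (\<Prod>t=1..k. qm D (dg D \<alpha>) (dg D (letter w t)))"

lemma xi_Suc:
  "xi D (Suc k) \<alpha> = (\<lambda>x. \<Sum>\<beta>\<in>letters D. \<Sum>w\<in>words D k.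
     xi_coeff \<alpha> k w * ipU D (bas D \<alpha>) (cconj (bas D \<beta>)) * Lstar_ebar w \<beta> x)"
  unfolding xi_def xi_coeff_def Lstar_ebar_def pairs_def by simp

lemma letter_words: "w \<in> words D k \<Longrightarrow> t \<in> {1..k} \<Longrightarrow> letter w t \<in> letters D"
proof -
  assume w: "w \<in> words D k" and "t \<in> {1..k}"
  then have "k + 1 - t \<in> {1..k}" by auto
  from nth_words[OF w this] show ?thesis using words_length[OF w] by (simp add: letter_def)
qed

text \<open>The source of the decay: one factor \<open>qmax\<close> for each of the k (k - 1) / 2
  pairs of letters of w. The factors involving \<alpha> are merely bounded by 1.\<close>

lemma xi_coeff_bound:
  assumes \<alpha>: "\<alpha> \<in> letters D" and w: "w \<in> words D k"
  shows "cmod (xi_coeff \<alpha> k w) \<le> qmax ^ card (pairs k)"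
proof -
  have "cmod (of_real (\<Prod>(v, u)\<in>pairs k. qm D (dg D (letter w v)) (dg D (letter w u)))) =
      (\<Prod>e\<in>pairs k. \<bar>qm D (dg D (letter w (fst e))) (dg D (letter w (snd e)))\<bar>)"
    unfolding split_def of_real_prod prod_norm[symmetric] by simp
  also have "\<dots> \<le> (\<Prod>e\<in>pairs k. qmax)"
    by (rule prod_mono) (use qm_le_qmax letter_words[OF w] in \<open>auto simp: pairs_def\<close>)
  finally have 1: "cmod (of_real (\<Prod>(v, u)\<in>pairs k. qm D (dg D (letter w v)) (dg D (letter w u)))) \<le> qmax ^ card (pairs k)"
    by simp
  have "cmod (of_real (\<Prod>t=1..k. qm D (dg D \<alpha>) (dg D (letter w t)))) = (\<Prod>t=1..k. \<bar>qm D (dg D \<alpha>) (dg D (letter w t))\<bar>)"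
    unfolding of_real_prod prod_norm[symmetric] by simp
  also have "\<dots> \<le> (\<Prod>t=1..k. 1)"
  proof (rule prod_mono)
    fix t assume t: "t \<in> {1..k}"
    show "0 \<le> \<bar>qm D (dg D \<alpha>) (dg D (letter w t))\<bar> \<and> \<bar>qm D (dg D \<alpha>) (dg D (letter w t))\<bar> \<le> 1"
      using qm_le_qmax[OF \<alpha> letter_words[OF w t]] qmax_bounds by auto
  qed
  finally have 2: "cmod (of_real (\<Prod>t=1..k. qm D (dg D \<alpha>) (dg D (letter w t)))) \<le> 1" by simp
  show ?thesis unfolding xi_coeff_def norm_mult using mult_mono[OF 1 2] qmax_bounds by simp
qed

lemma card_words: "card (words D n) = DIM('a) ^ n"
  using card_lists_length_eq[of "letters D" n] by (simp add: words_def conj_commute)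

lemma xi_bound:
  assumes \<alpha>: "\<alpha> \<in> letters D"
  shows "cmod (xi D (Suc k) \<alpha> x) \<le>
    DIM('a) * (DIM('a) ^ k * (qmax ^ card (pairs k) * wick_base * (Rinv_norm ^ (2 * k + 1) * (fact k * wick_base ^ k))))"
proof -
  let ?B = "qmax ^ card (pairs k) * wick_base * (Rinv_norm ^ (2 * k + 1) * (fact k * wick_base ^ k))"
  have "cmod (xi D (Suc k) \<alpha> x) \<le> (\<Sum>\<beta>\<in>letters D. \<Sum>w\<in>words D k.
      cmod (xi_coeff \<alpha> k w * ipU D (bas D \<alpha>) (cconj (bas D \<beta>)) * Lstar_ebar w \<beta> x))"
    unfolding xi_Suc by (intro order_trans[OF norm_sum] sum_mono norm_sum)
  also have "\<dots> \<le> (\<Sum>\<beta>\<in>letters D. \<Sum>w\<in>words D k. ?B)"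
  proof (intro sum_mono)
    fix \<beta> w assume b: "\<beta> \<in> letters D" and w: "w \<in> words D k"
    have "cmod (ipU D (bas D \<alpha>) (cconj (bas D \<beta>))) \<le> wick_base"
      using wick_base_bounds(3)[OF b \<alpha>] by (simp add: coord_def)
    then show "cmod (xi_coeff \<alpha> k w * ipU D (bas D \<alpha>) (cconj (bas D \<beta>)) * Lstar_ebar w \<beta> x) \<le> ?B"
      unfolding norm_mult using xi_coeff_bound[OF \<alpha> w] Lstar_ebar_props(4)[OF w b, of x] wick_base_bounds(1) qmax_bounds
      by (intro mult_mono) auto
  qed
  also have "\<dots> = DIM('a) * (DIM('a) ^ k * ?B)" by (simp add: card_words)
  finally show ?thesis .
qed

lemma xi_supp: "supp_words (xi D (Suc k) \<alpha>)" "xi D (Suc k) \<alpha> x \<noteq> 0 \<Longrightarrow> length x = 2 * k + 1"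
proof -
  have s: "Lstar_ebar w \<beta> x = 0" if "w \<in> words D k" "\<beta> \<in> letters D" "x \<notin> words D (length x)" for w \<beta> x
    by (rule supp_wordsD[OF Lstar_ebar_props(1)[OF that(1,2)] that(3)])
  show "supp_words (xi D (Suc k) \<alpha>)"
    unfolding supp_words_def
  proof (intro allI impI, rule ccontr)
    fix x assume nz: "xi D (Suc k) \<alpha> x \<noteq> 0" and x: "x \<notin> words D (length x)"
    have "xi D (Suc k) \<alpha> x = 0" unfolding xi_Suc by (intro sum.neutral ballI) (simp add: s[OF _ _ x])
    then show False using nz by simp
  qed
  show "length x = 2 * k + 1" if nz: "xi D (Suc k) \<alpha> x \<noteq> 0"
  proof (rule ccontr)
    assume l: "length x \<noteq> 2 * k + 1"
    have "Lstar_ebar w \<beta> x = 0" if "w \<in> words D k" "\<beta> \<in> letters D" for w \<beta>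
      using Lstar_ebar_props(2)[OF that, of x] l by blast
    then have "xi D (Suc k) \<alpha> x = 0" unfolding xi_Suc by (intro sum.neutral ballI) simp
    then show False using nz by simp
  qed
qed

lemma Pn_sum:
  assumes "length w = n"
  shows "Pn D n (\<lambda>x. \<Sum>i\<in>S. c i * F i x) w = (\<Sum>i\<in>S. c i * Pn D n (F i) w)"
  unfolding Pn_eq[OF assms] sum_distrib_left by (subst sum.swap) (simp add: mult_ac)

text \<open>After P is applied only the summand whose w \<beta> is the beginning of y survives, and
  the double sum collapses.\<close>

lemma Pn_xi:
  assumes y: "y \<in> words D (2 * k + 1)"
  shows "Pn D (2 * k + 1) (xi D (Suc k) \<alpha>) y =
    xi_coeff \<alpha> k (take k y) * ipU D (bas D \<alpha>) (cconj (bas D (y ! k))) * Pn D k (ebar_word D (take k y)) (drop (k + 1) y)"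
proof -
  let ?c = "\<lambda>\<beta> w. xi_coeff \<alpha> k w * ipU D (bas D \<alpha>) (cconj (bas D \<beta>))"
  note ly = words_length[OF y]
  have w: "take k y \<in> words D k" using take_words[of y k "k + 1"] y by (simp add: mult_2)
  have b: "y ! k \<in> letters D" using nth_words[OF y, of "k + 1"] by simp
  have "Pn D (2 * k + 1) (xi D (Suc k) \<alpha>) y = (\<Sum>\<beta>\<in>letters D. 1 * Pn D (2 * k + 1) (\<lambda>x. \<Sum>w\<in>words D k. ?c \<beta> w * Lstar_ebar w \<beta> x) y)"
    unfolding xi_Suc Pn_sum[OF ly, symmetric] by simp
  also have "\<dots> = (\<Sum>\<beta>\<in>letters D. \<Sum>w\<in>words D k. ?c \<beta> w * Pn D (2 * k + 1) (Lstar_ebar w \<beta>) y)"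
    unfolding Pn_sum[OF ly] by simp
  also have "\<dots> = (\<Sum>\<beta>\<in>letters D. if \<beta> = y ! k then \<Sum>w\<in>words D k. if w = take k y
      then ?c \<beta> w * Pn D k (ebar_word D w) (drop (k + 1) y) else 0 else 0)"
  proof (rule sum.cong[OF refl])
    fix \<beta> assume \<beta>: "\<beta> \<in> letters D"
    have "(\<Sum>w\<in>words D k. ?c \<beta> w * Pn D (2 * k + 1) (Lstar_ebar w \<beta>) y) = (\<Sum>w\<in>words D k. if \<beta> = y ! k then if w = take k y
      then ?c \<beta> w * Pn D k (ebar_word D w) (drop (k + 1) y) else 0 else 0)"
      by (rule sum.cong[OF refl]) (use Lstar_ebar_props(3)[OF _ \<beta> y] in auto)
    then show "(\<Sum>w\<in>words D k. ?c \<beta> w * Pn D (2 * k + 1) (Lstar_ebar w \<beta>) y) = (if \<beta> = y ! k then \<Sum>w\<in>words D k. if w = take k y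
      then ?c \<beta> w * Pn D k (ebar_word D w) (drop (k + 1) y) else 0 else 0)" by simp
  qed
  also have "\<dots> = ?c (y ! k) (take k y) * Pn D k (ebar_word D (take k y)) (drop (k + 1) y)"
    using w b by simp
  finally show ?thesis .
qed

section \<open>The vacuum coefficient of \<open>D\<^sub>\<alpha>\<close>\<close>

lemma e_singles_Nil:
  assumes "P \<in> Bpart n"
  shows "e_singles D a P [] = (if singles P = {} then 1 else 0)"
proof -
  have "partition_on {0..n} P" using assms by (auto simp: Bpart_def)
  from partition_onD1[OF this] have "singles P \<subseteq> {0..n}" by (auto simp: singles_def)
  then have "finite (singles P)" by (rule finite_subset) simp
  then have "length (sorted_list_of_set (singles P)) = 0 \<longleftrightarrow> singles P = {}" by simp
  then show ?thesis
    by (auto simp: e_singles_def e_word_def tens_def words_def)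
qed

lemma D_basis_Nil:
  assumes y: "y \<in> words D n" and n: "0 < n"
  shows "D_basis D \<alpha> y [] = (\<Sum>P\<in>{P \<in> Bpart n. singles P = {}}.
    (- 1) ^ (partner P 0 - 1) * of_real (Qpart D n (\<lambda>t. if t = 0 then \<alpha> else letter y t) P)
      * Epart D (\<lambda>t. if t = 0 then \<alpha> else letter y t) P)"
proof -
  let ?a = "\<lambda>t. if t = 0 then \<alpha> else letter y t"
  have ly: "length y = n" "y \<noteq> []" using words_length[OF y] n by auto
  have "D_basis D \<alpha> y [] = (\<Sum>P\<in>Bpart n. (- 1) ^ (partner P 0 - 1) * of_real (Qpart D n ?a P) * Epart D ?a P * e_singles D ?a P [])"
    unfolding D_basis_def Let_def ly(1) using ly(2) by simp
  also have "\<dots> = (\<Sum>P\<in>Bpart n. if singles P = {} then (- 1) ^ (partner P 0 - 1) * of_real (Qpart D n ?a P) * Epart D ?a P else 0)"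
    by (rule sum.cong[OF refl]) (simp add: e_singles_Nil)
  also have "\<dots> = (\<Sum>P\<in>{P \<in> Bpart n. singles P = {}}. (- 1) ^ (partner P 0 - 1) * of_real (Qpart D n ?a P) * Epart D ?a P)"
    by (rule sum.inter_filter[symmetric, OF finite_Bpart])
  finally show ?thesis .
qed

lemma Epart_npart:
  assumes \<sigma>: "\<sigma> permutes {1..k}"
  shows "Epart D a (npart k \<sigma>) = ipU D (cconj (bas D (a (k + 1)))) (bas D (a 0)) *
    (\<Prod>i\<in>{1..k}. ipU D (cconj (bas D (a (2 * k + 2 - i)))) (bas D (a (k + 1 - \<sigma> i))))"
proof -
  note r = perm_range(1)[OF \<sigma>]
  have "{(K, l). {K, l} \<in> npart k \<sigma> \<and> K > l} = insert (k + 1, 0) ((\<lambda>i. (2 * k + 2 - i, k + 1 - \<sigma> i)) ` {1..k})" (is "?L = ?R")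
  proof (intro equalityI subsetI)
    fix e assume "e \<in> ?L"
    then obtain K l where e: "e = (K, l)" "{K, l} \<in> npart k \<sigma>" "K > l" by auto
    from e(2) show "e \<in> ?R"
    proof (rule npart_cases[OF \<sigma>])
      assume "{K, l} = {0, k + 1}"
      then show ?thesis using e by (auto simp: doubleton_eq_iff)
    next
      fix i assume i: "i \<in> {1..k}" and "{K, l} = {k + 1 - \<sigma> i, 2 * k + 2 - i}"
      then have "K = 2 * k + 2 - i \<and> l = k + 1 - \<sigma> i" using e(3) r[OF i] by (auto simp: doubleton_eq_iff)
      then show ?thesis using e(1) i by blast
    qed
  next
    fix e assume "e \<in> ?R"
    then consider "e = (k + 1, 0)" | i where "i \<in> {1..k}" "e = (2 * k + 2 - i, k + 1 - \<sigma> i)" by blast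
    then show "e \<in> ?L"
    proof cases
      case 1
      then show ?thesis using nblock_zero[OF \<sigma>] by (simp add: insert_commute)
    next
      case (2 i)
      then show ?thesis using nblock_pair[OF \<sigma> 2(1)] r[OF 2(1)] by (auto simp: insert_commute)
    qed
  qed
  moreover have "(k + 1, 0) \<notin> (\<lambda>i. (2 * k + 2 - i, k + 1 - \<sigma> i)) ` {1..k}" by auto
  moreover have "inj_on (\<lambda>i. (2 * k + 2 - i, k + 1 - \<sigma> i)) {1..k}" by (rule inj_onI) auto
  ultimately show ?thesis by (simp add: Epart_def prod.reindex)
qed

text \<open>The first product of Q splits into the pairs containing 0 and those within 1, ..., k.
  The crossings in the second product are the inversions of \<sigma>. The third is empty, there
  being no singletons.\<close>

lemma Qpart_npart:
  assumes \<sigma>: "\<sigma> permutes {1..k}"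
  shows "Qpart D (2 * k + 1) a (npart k \<sigma>) =
    (\<Prod>t=1..k. qm D (dg D (a 0)) (dg D (a t))) * (\<Prod>(v, u)\<in>pairs k. qm D (dg D (a v)) (dg D (a u)))
    * (\<Prod>(i, j)\<in>invs k \<sigma>. qm D (dg D (a (2 * k + 2 - i))) (dg D (a (2 * k + 2 - j))))"
proof -
  let ?P = "npart k \<sigma>"
  note r = perm_range(1)[OF \<sigma>] and r' = perm_range(2)[OF \<sigma>]
  note pz = partner_npart(1)[OF \<sigma>] and pp = partner_npart(2)[OF \<sigma>]
  have S1: "{(v, u). 0 \<le> v \<and> v < u \<and> u < k + 1} = (\<lambda>t. (0, t)) ` {1..k} \<union> pairs k"
    by (auto simp: pairs_def)
  have "(\<Prod>(v, u)\<in>{(v, u). 0 \<le> v \<and> v < u \<and> u < k + 1}. qm D (dg D (a v)) (dg D (a u))) =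
      (\<Prod>(v, u)\<in>(\<lambda>t. (0, t)) ` {1..k}. qm D (dg D (a v)) (dg D (a u))) * (\<Prod>(v, u)\<in>pairs k. qm D (dg D (a v)) (dg D (a u)))"
    unfolding S1 by (rule prod.union_disjoint) (simp, simp, auto simp: pairs_def)
  also have "(\<Prod>(v, u)\<in>(\<lambda>t. (0, t)) ` {1..k}. qm D (dg D (a v)) (dg D (a u))) = (\<Prod>t=1..k. qm D (dg D (a 0)) (dg D (a t)))"
    by (subst prod.reindex) (auto simp: inj_on_def)
  finally have Q1: "(\<Prod>(v, u)\<in>{(v, u). 0 \<le> v \<and> v < u \<and> u < k + 1}. qm D (dg D (a v)) (dg D (a u))) =
      (\<Prod>t=1..k. qm D (dg D (a 0)) (dg D (a t))) * (\<Prod>(v, u)\<in>pairs k. qm D (dg D (a v)) (dg D (a u)))" .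
  have S2: "{(v, u). 0 < v \<and> v < u \<and> u < k + 1 \<and> partner ?P v > partner ?P u} =
      (\<lambda>(i, j). (k + 1 - \<sigma> i, k + 1 - \<sigma> j)) ` invs k \<sigma>" (is "?L = ?R")
  proof (intro equalityI subsetI)
    fix e assume "e \<in> ?L"
    then obtain v u where e: "e = (v, u)" "0 < v" "v < u" "u < k + 1" "partner ?P v > partner ?P u" by auto
    define i where "i = inv \<sigma> (k + 1 - v)"
    define j where "j = inv \<sigma> (k + 1 - u)"
    have "k + 1 - v \<in> {1..k}" "k + 1 - u \<in> {1..k}" using e by auto
    then have ij: "i \<in> {1..k}" "j \<in> {1..k}" unfolding i_def j_def by (simp_all only: r')
    have s: "\<sigma> i = k + 1 - v" "\<sigma> j = k + 1 - u" unfolding i_def j_def by (rule permutes_inverses(1)[OF \<sigma>])+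
    then have vu: "v = k + 1 - \<sigma> i" "u = k + 1 - \<sigma> j" using e by auto
    have "2 * k + 2 - i > 2 * k + 2 - j" using e(5) unfolding vu pp[OF ij(1)] pp[OF ij(2)] .
    then have "(i, j) \<in> invs k \<sigma>" using ij s e by (auto simp: invs_def)
    then show "e \<in> ?R" unfolding e(1) vu by (rule image_eqI[rotated]) simp
  next
    fix e assume "e \<in> ?R"
    then obtain i j where e: "e = (k + 1 - \<sigma> i, k + 1 - \<sigma> j)" and ij: "(i, j) \<in> invs k \<sigma>" by auto
    have *: "i \<in> {1..k}" "j \<in> {1..k}" "i < j" "\<sigma> j < \<sigma> i" using ij by (auto simp: invs_def)
    have "partner ?P (k + 1 - \<sigma> i) > partner ?P (k + 1 - \<sigma> j)"
      unfolding pp[OF *(1)] pp[OF *(2)] using * by auto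
    then show "e \<in> ?L" using r[OF *(1)] r[OF *(2)] * by (auto simp: e)
  qed
  have inj: "inj_on (\<lambda>(i, j). (k + 1 - \<sigma> i, k + 1 - \<sigma> j)) (invs k \<sigma>)"
  proof (rule inj_onI, clarify)
    fix i j i' j' assume "(i, j) \<in> invs k \<sigma>" "(i', j') \<in> invs k \<sigma>"
    then have *: "i \<in> {1..k}" "j \<in> {1..k}" "i' \<in> {1..k}" "j' \<in> {1..k}" by (auto simp: invs_def)
    assume "k + 1 - \<sigma> i = k + 1 - \<sigma> i'" "k + 1 - \<sigma> j = k + 1 - \<sigma> j'"
    then have "\<sigma> i = \<sigma> i'" "\<sigma> j = \<sigma> j'" using r[OF *(1)] r[OF *(2)] r[OF *(3)] r[OF *(4)] by auto
    then show "i = i' \<and> j = j'" using permutes_inverses(2)[OF \<sigma>] by metis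
  qed
  have Q2: "(\<Prod>(v, u)\<in>{(v, u). 0 < v \<and> v < u \<and> u < k + 1 \<and> partner ?P v > partner ?P u}.
      qm D (dg D (a (partner ?P v))) (dg D (a (partner ?P u)))) =
      (\<Prod>(i, j)\<in>invs k \<sigma>. qm D (dg D (a (2 * k + 2 - i))) (dg D (a (2 * k + 2 - j))))"
    unfolding S2
  proof (subst prod.reindex[OF inj], rule prod.cong[OF refl])
    fix e assume e: "e \<in> invs k \<sigma>"
    obtain i j where ij: "e = (i, j)" by force
    have *: "i \<in> {1..k}" "j \<in> {1..k}" using e by (auto simp: ij invs_def)
    show "((\<lambda>(v, u). qm D (dg D (a (partner ?P v))) (dg D (a (partner ?P u)))) \<circ> (\<lambda>(i, j). (k + 1 - \<sigma> i, k + 1 - \<sigma> j))) e =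
      (case e of (i, j) \<Rightarrow> qm D (dg D (a (2 * k + 2 - i))) (dg D (a (2 * k + 2 - j))))"
      unfolding ij comp_def prod.case pp[OF *(1)] pp[OF *(2)] ..
  qed
  have e3: "{(v, u). k + 1 < v \<and> v < u \<and> u \<le> 2 * k + 1 \<and> v \<in> singles ?P \<and> u \<notin> singles ?P} = {}"
    using singles_npart[OF \<sigma>] by auto
  show ?thesis
    unfolding Qpart_def pz Q1 Q2 e3 by simp
qed

text \<open>Write y = w \<beta> u. The sum over partitions and P^(k) of the conjugate word of w,
  evaluated at u, both run over permutations and are compared term by term; conjugation enters
  because the inner products appear with their arguments exchanged.\<close>

lemma D_basis_odd:
  assumes \<alpha>: "\<alpha> \<in> letters D" and y: "y \<in> words D (2 * k + 1)"
  shows "D_basis D \<alpha> y [] = (- 1) ^ k * cnj (Pn D (2 * k + 1) (xi D (Suc k) \<alpha>) y)"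
proof -
  let ?a = "\<lambda>t. if t = 0 then \<alpha> else letter y t"
  define w where "w = take k y"
  define u where "u = drop (k + 1) y"
  have ly: "length y = 2 * k + 1" by (rule words_length[OF y])
  have w: "w \<in> words D k" unfolding w_def using take_words[of y k "k + 1"] y by (simp add: mult_2)
  have u: "u \<in> words D k" unfolding u_def using drop_words[of y k k] y by (simp add: mult_2)
  have au: "?a (k + 1 - i) = u ! (i - 1)" if "i \<in> {1..k}" for i
    using that ly by (auto simp: letter_def u_def)
  have aw: "?a (2 * k + 2 - i) = w ! (i - 1)" if "i \<in> {1..k}" for i
    using that ly by (auto simp: letter_def w_def)
  have ab: "?a (k + 1) = y ! k" using ly by (simp add: letter_def)
  define dw where "dw i = dg D (w ! (i - 1))" for i
  define du where "du i = dg D (u ! (i - 1))" for i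
  \<comment> \<open>The reversal of 1, ..., k: letters are numbered from the right, places of a list
    from the left.\<close>
  define \<omega> where "\<omega> t = (if t \<in> {1..k} then k + 1 - t else t)" for t
  have \<omega>\<omega>: "\<omega> (\<omega> t) = t" for t by (auto simp: \<omega>_def)
  have \<omega>: "\<omega> permutes {1..k}"
  proof (rule bij_imp_permutes)
    show "bij_betw \<omega> {1..k} {1..k}"
      by (rule bij_betw_byWitness[of _ \<omega>]) (auto simp: \<omega>_def)
  qed (auto simp: \<omega>_def)
  have \<omega>r: "\<omega> t \<in> {1..k}" if "t \<in> {1..k}" for t using that by (auto simp: \<omega>_def)
  have dau: "dg D (?a t) = du (\<omega> t)" if t: "t \<in> {1..k}" for t
  proof -
    have kt: "k + 1 - \<omega> t = t" using t by (auto simp: \<omega>_def)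
    show ?thesis using arg_cong[OF au[OF \<omega>r[OF t]], of "dg D"] unfolding du_def kt .
  qed
  have dlw: "dg D (letter w t) = dw (\<omega> t)" if t: "t \<in> {1..k}" for t
    using t words_length[OF w] by (auto simp: letter_def dw_def \<omega>_def)
  have du_inds: "du i \<in> inds D" if "i \<in> {1..k}" for i
    unfolding du_def by (rule dg_inds[OF nth_words[OF u that]])
  have main: "(- 1) ^ (partner (npart k \<sigma>) 0 - 1) * of_real (Qpart D (2 * k + 1) ?a (npart k \<sigma>)) * Epart D ?a (npart k \<sigma>) =
      (- 1) ^ k * cnj (xi_coeff \<alpha> k w * ipU D (bas D \<alpha>) (cconj (bas D (y ! k))) * (inv_weight k \<sigma> u * ebar_word D w (perm_word \<sigma> u)))"
    if \<sigma>: "\<sigma> permutes {1..k}" for \<sigma>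
  proof -
    note r = perm_range(1)[OF \<sigma>]
    have pu: "perm_word \<sigma> u \<in> words D k" by (rule perm_word_words[OF \<sigma> u])
    have lu: "length u = k" "length w = k" using words_length u w by auto
    have "ebar_word D w (perm_word \<sigma> u) = (\<Prod>p<k. coord (cconj (bas D (w ! p))) (perm_word \<sigma> u ! p))"
      using ebar_app[of "perm_word \<sigma> u" w] pu lu by simp
    also have "\<dots> = (\<Prod>i\<in>{1..k}. coord (cconj (bas D (w ! (i - 1)))) (u ! (\<sigma> i - 1)))"
      by (rule prod.reindex_bij_witness[of _ "\<lambda>i. i - 1" Suc]) (auto simp: nth_perm_word lu)
    finally have eb: "ebar_word D w (perm_word \<sigma> u) = (\<Prod>i\<in>{1..k}. coord (cconj (bas D (w ! (i - 1)))) (u ! (\<sigma> i - 1)))" .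
    have "(\<Prod>i\<in>{1..k}. ipU D (cconj (bas D (?a (2 * k + 2 - i)))) (bas D (?a (k + 1 - \<sigma> i)))) =
        (\<Prod>i\<in>{1..k}. cnj (coord (cconj (bas D (w ! (i - 1)))) (u ! (\<sigma> i - 1))))"
      by (rule prod.cong[OF refl]) (simp only: aw au[OF r] bas_bar)
    then have E: "Epart D ?a (npart k \<sigma>) = cnj (ipU D (bas D \<alpha>) (cconj (bas D (y ! k)))) * cnj (ebar_word D w (perm_word \<sigma> u))"
      unfolding Epart_npart[OF \<sigma>] ab eb cnj_prod using ipU_cnj[of "cconj (bas D (y ! k))" "bas D \<alpha>"] by simp
    show ?thesis
    proof (cases "ebar_word D w (perm_word \<sigma> u) = 0")
      case True
      then show ?thesis by (simp add: E)
    next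
      case False
      \<comment> \<open>One vanishing entry of the conjugation matrix kills the whole product, so in
        a nonzero term paired letters share their component.\<close>
      have deq: "dw i = du (\<sigma> i)" if i: "i \<in> {1..k}" for i
      proof (rule ccontr)
        assume "dw i \<noteq> du (\<sigma> i)"
        then have "coord (cconj (bas D (w ! (i - 1)))) (u ! (\<sigma> i - 1)) = 0"
          unfolding dw_def du_def by (rule coord_bar_homogeneous[OF nth_words[OF w i] nth_words[OF u r[OF i]]])
        then have "ebar_word D w (perm_word \<sigma> u) = 0" unfolding eb using i by (intro prod_zero) auto
        then show False using False by simp
      qed
      \<comment> \<open>A product over all letters is invariant under reordering: \<omega> leads
        from the numbering to places of u, and \<open>\<sigma> \<circ> \<omega>\<close> from there
        to the paired letters of w.\<close>
      have A: "(\<Prod>t=1..k. qm D (dg D \<alpha>) (dg D (?a t))) = (\<Prod>t=1..k. qm D (dg D \<alpha>) (dg D (letter w t)))"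
      proof -
        have "(\<Prod>t=1..k. qm D (dg D \<alpha>) (dg D (?a t))) = (\<Prod>t=1..k. ((\<lambda>t. qm D (dg D \<alpha>) (du t)) \<circ> \<omega>) t)"
          by (rule prod.cong[OF refl]) (simp only: dau comp_apply)
        also have "\<dots> = (\<Prod>t=1..k. qm D (dg D \<alpha>) (du t))" by (rule prod.permute[OF \<omega>, symmetric])
        also have "\<dots> = (\<Prod>t=1..k. ((\<lambda>t. qm D (dg D \<alpha>) (du t)) \<circ> (\<sigma> \<circ> \<omega>)) t)"
          by (rule prod.permute[OF permutes_compose[OF \<omega> \<sigma>]])
        also have "\<dots> = (\<Prod>t=1..k. qm D (dg D \<alpha>) (dg D (letter w t)))"
          by (rule prod.cong[OF refl]) (simp only: dlw deq[OF \<omega>r] comp_apply)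
        finally show ?thesis .
      qed
      have B: "(\<Prod>(v, t)\<in>pairs k. qm D (dg D (?a v)) (dg D (?a t))) =
          (\<Prod>(v, t)\<in>pairs k. qm D (dg D (letter w v)) (dg D (letter w t)))"
      proof -
        have sym: "qm D (du i) (du j) = qm D (du j) (du i)" if "i \<in> {1..k}" "j \<in> {1..k}" for i j
          by (rule qm_sym[OF du_inds du_inds]) (rule that)+
        have pr: "v \<in> {1..k} \<and> t \<in> {1..k}" if "(v, t) \<in> pairs k" for v t using that by (auto simp: pairs_def)
        have "(\<Prod>(v, t)\<in>pairs k. qm D (dg D (?a v)) (dg D (?a t))) = (\<Prod>(v, t)\<in>pairs k. qm D (du (\<omega> v)) (du (\<omega> t)))"
        proof (rule prod.cong[OF refl], clarify)
          fix v t assume "(v, t) \<in> pairs k"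
          then have "v \<in> {1..k}" "t \<in> {1..k}" using pr by auto
          then show "qm D (dg D (?a v)) (dg D (?a t)) = qm D (du (\<omega> v)) (du (\<omega> t))" by (simp only: dau)
        qed
        also have "\<dots> = (\<Prod>(v, t)\<in>pairs k. qm D (du v) (du t))"
          by (rule prod_pairs_permute[OF \<omega>, of "\<lambda>v t. qm D (du v) (du t)"]) (rule sym)
        also have "\<dots> = (\<Prod>(v, t)\<in>pairs k. qm D (du ((\<sigma> \<circ> \<omega>) v)) (du ((\<sigma> \<circ> \<omega>) t)))"
          by (rule prod_pairs_permute[OF permutes_compose[OF \<omega> \<sigma>], of "\<lambda>v t. qm D (du v) (du t)", symmetric]) (rule sym)
        also have "\<dots> = (\<Prod>(v, t)\<in>pairs k. qm D (dg D (letter w v)) (dg D (letter w t)))"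
        proof (rule prod.cong[OF refl], clarify)
          fix v t assume "(v, t) \<in> pairs k"
          then have "v \<in> {1..k}" "t \<in> {1..k}" using pr by auto
          then show "qm D (du ((\<sigma> \<circ> \<omega>) v)) (du ((\<sigma> \<circ> \<omega>) t)) = qm D (dg D (letter w v)) (dg D (letter w t))"
            by (simp only: dlw deq[OF \<omega>r] comp_apply)
        qed
        finally show ?thesis .
      qed
      \<comment> \<open>The weight of P^(k) is taken at letters of u, the crossings of the partition
        at letters of w; \<open>deq\<close> identifies their components.\<close>
      have C: "of_real (\<Prod>(i, j)\<in>invs k \<sigma>. qm D (dg D (?a (2 * k + 2 - i))) (dg D (?a (2 * k + 2 - j)))) = inv_weight k \<sigma> u"
        unfolding inv_weight_def of_real_prod
      proof (rule prod.cong[OF refl])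
        fix e assume e: "e \<in> invs k \<sigma>"
        obtain i j where ij: "e = (i, j)" by force
        have *: "i \<in> {1..k}" "j \<in> {1..k}" using e by (auto simp: ij invs_def)
        have "qm D (dg D (w ! (i - 1))) (dg D (w ! (j - 1))) = qm D (dg D (u ! (\<sigma> i - 1))) (dg D (u ! (\<sigma> j - 1)))"
          using deq[OF *(1)] deq[OF *(2)] by (simp add: dw_def du_def)
        then show "complex_of_real (case e of (i, j) \<Rightarrow> qm D (dg D (?a (2 * k + 2 - i))) (dg D (?a (2 * k + 2 - j)))) =
            (case e of (i, j) \<Rightarrow> qq (u ! (\<sigma> i - 1)) (u ! (\<sigma> j - 1)))"
          unfolding ij prod.case aw[OF *(1)] aw[OF *(2)] qq_def by simp
      qed
      have a0: "?a 0 = \<alpha>" by simp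
      have "of_real (Qpart D (2 * k + 1) ?a (npart k \<sigma>)) = xi_coeff \<alpha> k w * inv_weight k \<sigma> u"
        unfolding Qpart_npart[OF \<sigma>] a0 A B C[symmetric] xi_coeff_def by (simp only: of_real_mult mult_ac)
      moreover have "cnj (xi_coeff \<alpha> k w) = xi_coeff \<alpha> k w" by (simp add: xi_coeff_def)
      moreover have "cnj (inv_weight k \<sigma> u) = inv_weight k \<sigma> u" unfolding inv_weight_def cnj_prod by (intro prod.cong) auto
      ultimately show ?thesis
        unfolding E partner_npart(1)[OF \<sigma>] complex_cnj_mult by (simp only: add_diff_cancel_right' mult_ac)
    qed
  qed
  have "D_basis D \<alpha> y [] = (\<Sum>\<sigma> | \<sigma> permutes {1..k}.
      (- 1) ^ (partner (npart k \<sigma>) 0 - 1) * of_real (Qpart D (2 * k + 1) ?a (npart k \<sigma>)) * Epart D ?a (npart k \<sigma>))"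
  proof -
    have n: "0 < 2 * k + 1" by simp
    show ?thesis unfolding D_basis_Nil[OF y n] by (rule sum_Bpart_no_singles)
  qed
  also have "\<dots> = (\<Sum>\<sigma> | \<sigma> permutes {1..k}.
      (- 1) ^ k * cnj (xi_coeff \<alpha> k w * ipU D (bas D \<alpha>) (cconj (bas D (y ! k))) * (inv_weight k \<sigma> u * ebar_word D w (perm_word \<sigma> u))))"
    by (rule sum.cong[OF refl]) (simp only: main mem_Collect_eq)
  also have "\<dots> = (- 1) ^ k * cnj (Pn D (2 * k + 1) (xi D (Suc k) \<alpha>) y)"
    unfolding Pn_xi[OF y] w_def[symmetric] u_def[symmetric] Pn_eq[OF words_length[OF u]]
    by (simp only: sum_distrib_left cnj_sum)
  finally show ?thesis .
qed

lemma D_basis_even: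
  assumes y: "y \<in> words D n" and n: "even n" shows "D_basis D \<alpha> y [] = 0"
proof (cases "n = 0")
  case True
  then show ?thesis using y by (simp add: D_basis_def)
next
  case False
  then show ?thesis using D_basis_Nil[OF y] Bpart_even_no_singles[OF n] by simp
qed

end

section \<open>Convergence\<close>

lemma card_pairs_Suc: "card (pairs (Suc k)) = card (pairs k) + k"
proof -
  have "pairs (Suc k) = pairs k \<union> (\<lambda>a. (a, Suc k)) ` {1..k}" by (auto simp: pairs_def)
  moreover have "pairs k \<inter> (\<lambda>a. (a, Suc k)) ` {1..k} = {}" by (auto simp: pairs_def)
  moreover have "card ((\<lambda>a. (a, Suc k)) ` {1..k}) = k" by (subst card_image) (auto simp: inj_on_def)
  ultimately show ?thesis by (simp add: card_Un_disjoint)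
qed

lemma cubic_geometric_tendsto_0:
  fixes r C :: real
  assumes r: "0 < r" "r < 1"
  shows "(\<lambda>k. C * ((real k + 1) * (2 * real k + 2) * (2 * real k + 3)) * r ^ k) \<longlonglongrightarrow> 0"
proof -
  \<comment> \<open>The cube root supplies one geometric factor for each of the three linear
    factors.\<close>
  define s where "s = r powr (1 / 3)"
  have s: "0 < s" "s < 1" using r powr_less_mono2[of "1 / 3" r 1] by (simp_all add: s_def)
  have s3: "r ^ k = s ^ k * s ^ k * s ^ k" for k
  proof -
    have "s * s * s = r" using r by (simp add: s_def powr_add[symmetric])
    then show ?thesis by (metis power_mult_distrib)
  qed
  have 0: "(\<lambda>k. s ^ k) \<longlonglongrightarrow> 0" using s by (intro LIMSEQ_power_zero) auto
  have 1: "(\<lambda>k. real k * s ^ k) \<longlonglongrightarrow> 0" using powser_times_n_limit_0[of s] s by simp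
  have "(\<lambda>k. C * ((real k * s ^ k + s ^ k) * (2 * (real k * s ^ k) + 2 * s ^ k) * (2 * (real k * s ^ k) + 3 * s ^ k)))
      \<longlonglongrightarrow> C * ((0 + 0) * (2 * 0 + 2 * 0) * (2 * 0 + 3 * 0))"
    by (intro tendsto_intros 0 1)
  then show ?thesis by (simp add: s3 algebra_simps)
qed

context aw begin

text \<open>Number of words of length 2k + 1, times the coordinate bound of \<open>xi_bound\<close>,
  times the Wick bound of one basis word of that length.\<close>

definition xi_bound_seq :: "nat \<Rightarrow> real" where
  "xi_bound_seq k = real (card (words D (2 * k + 1))) *
    (DIM('a) * (DIM('a) ^ k * (qmax ^ card (pairs k) * wick_base * (Rinv_norm ^ (2 * k + 1) * (fact k * wick_base ^ k))))
      * (fact (2 * k + 1) * (2 * wick_base) ^ (2 * k + 1)))"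

lemma xi_bound_seq_nonneg: "0 \<le> xi_bound_seq k"
  unfolding xi_bound_seq_def using wick_base_bounds(1) qmax_bounds by (simp add: Rinv_norm_def)

text \<open>The three linear factors come from k! and (2k + 1)!, and \<open>qmax ^ k\<close> from
  the k new pairs of letters; so the ratio tends to zero and the ratio test applies.\<close>

lemma xi_bound_seq_Suc:
  "xi_bound_seq (Suc k) = (real DIM('a) ^ 3 * Rinv_norm\<^sup>2 * wick_base * (2 * wick_base)\<^sup>2) *
    ((real k + 1) * (2 * real k + 2) * (2 * real k + 3)) * qmax ^ k * xi_bound_seq k"
proof -
  have f: "(fact (2 * Suc k + 1) :: real) = (2 * real k + 3) * ((2 * real k + 2) * fact (2 * k + 1))"
    by (simp add: algebra_simps)
  have g: "(fact (Suc k) :: real) = (real k + 1) * fact k" by simp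
  have p: "x ^ (2 * Suc k + 1) = x\<^sup>2 * x ^ (2 * k + 1)" for x :: real
    by (simp add: power2_eq_square)
  show ?thesis
    unfolding xi_bound_seq_def card_words of_nat_power f g p card_pairs_Suc power_add[of qmax] power_Suc
    by (simp only: of_nat_mult of_nat_power power3_eq_cube power2_eq_square mult_ac)
qed

lemma summable_xi_bound_seq: "summable xi_bound_seq"
proof -
  let ?c = "\<lambda>k. (real DIM('a) ^ 3 * Rinv_norm\<^sup>2 * wick_base * (2 * wick_base)\<^sup>2) *
    ((real k + 1) * (2 * real k + 2) * (2 * real k + 3)) * qmax ^ k"
  have "?c \<longlonglongrightarrow> 0" by (rule cubic_geometric_tendsto_0[OF qmax_bounds])
  then have "\<forall>\<^sub>F k in sequentially. ?c k < 1 / 2" by (rule order_tendstoD) simp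
  then obtain N where N: "\<And>k. k \<ge> N \<Longrightarrow> ?c k < 1 / 2" by (auto simp: eventually_sequentially)
  show ?thesis
  proof (rule summable_ratio_test[of "1 / 2" N])
    fix k assume "k \<ge> N"
    then have "?c k * xi_bound_seq k \<le> 1 / 2 * xi_bound_seq k" by (intro mult_right_mono xi_bound_seq_nonneg) (use N in fastforce)
    then show "norm (xi_bound_seq (Suc k)) \<le> 1 / 2 * norm (xi_bound_seq k)"
      using xi_bound_seq_nonneg[of k] xi_bound_seq_nonneg[of "Suc k"] by (simp only: xi_bound_seq_Suc real_norm_def abs_of_nonneg)
  qed simp
qed

lemma has_Wick_xi: "\<alpha> \<in> letters D \<Longrightarrow> has_Wick (xi D (Suc k) \<alpha>) (xi_bound_seq k)"
  unfolding xi_bound_seq_def by (rule has_Wick_degree[OF xi_supp xi_bound])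

lemma Wick_xi:
  assumes "\<alpha> \<in> letters D"
  shows "Wick D (xi D (Suc k) \<alpha>) \<in> MT D" "Wick D (xi D (Suc k) \<alpha>) (vac D) = xi D (Suc k) \<alpha>"
    and "f \<in> Fock D \<Longrightarrow> normT D (Wick D (xi D (Suc k) \<alpha>) f) \<le> xi_bound_seq k * normT D f"
proof -
  obtain X where X: "X \<in> MT D" "X (vac D) = xi D (Suc k) \<alpha>"
    "\<And>f. f \<in> Fock D \<Longrightarrow> normT D (X f) \<le> xi_bound_seq k * normT D f"
    using has_Wick_xi[OF assms, of k] unfolding has_Wick_def by blast
  have "Wick D (xi D (Suc k) \<alpha>) = X" by (rule Wick_eq[OF X(1,2)])
  then show "Wick D (xi D (Suc k) \<alpha>) \<in> MT D" "Wick D (xi D (Suc k) \<alpha>) (vac D) = xi D (Suc k) \<alpha>"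
    "f \<in> Fock D \<Longrightarrow> normT D (Wick D (xi D (Suc k) \<alpha>) f) \<le> xi_bound_seq k * normT D f"
    using X by simp_all
qed

section \<open>Identification of the conjugate variable and conclusion\<close>

lemma ipT_vac: "ipT D (vac D) g = g []"
proof -
  have nil: "[] \<in> words D 0" by simp
  have "ipT D (vac D) g = fm 0 (vac D) g"
    by (rule ipT_single) (use e_word_app[OF nil] in \<open>auto simp: vac_eq split: if_splits\<close>)
  then show ?thesis using e_word_app[OF nil, of "[]"] by (simp add: ipT_deg_def Pn_0 vac_eq)
qed

lemma Fock_alg_fdeg:
  assumes "f \<in> Fock_alg D" obtains N where "fdeg N f"
proof -
  obtain S c where S: "finite S" "f = (\<lambda>w. \<Sum>\<xi>s\<in>S. c \<xi>s * tens D \<xi>s w)"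
    using assms by (auto simp: Fock_alg_def)
  have t: "w \<in> words D (length w) \<and> length w < Suc (Max (length ` S))" if "f w \<noteq> 0" for w
  proof -
    have "\<exists>\<xi>s\<in>S. tens D \<xi>s w \<noteq> 0"
    proof (rule ccontr)
      assume "\<not> ?thesis"
      then have "f w = 0" unfolding S(2) by (intro sum.neutral) auto
      then show False using that by simp
    qed
    then obtain \<xi>s where "\<xi>s \<in> S" "tens D \<xi>s w \<noteq> 0" by blast
    then have "w \<in> words D (length \<xi>s)" by (auto simp: tens_def split: if_splits)
    moreover have "length \<xi>s \<le> Max (length ` S)" using \<open>\<xi>s \<in> S\<close> S(1) by (intro Max_ge) auto
    ultimately show ?thesis using words_length[of w "length \<xi>s"] by simp
  qed
  then have "fdeg (Suc (Max (length ` S))) f" unfolding fdeg_def supp_words_def by blast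
  then show ?thesis by (rule that)
qed

lemma e_word_Fock_alg: "e_word D w \<in> Fock_alg D"
  unfolding Fock_alg_def e_word_def
  by (intro CollectI exI[of _ "{map (bas D) w}"] exI[of _ "\<lambda>_. 1"]) simp

text \<open>Pairing with the vacuum keeps only the vacuum coefficient of D f, a finite sum over the
  words occurring in f. By \<open>fm_cnj_sum\<close> the pairing of \<xi> with f is the same sum,
  with the conjugate of P \<xi> as coefficients.\<close>

lemma conj_var_eq:
  assumes \<xi>: "\<xi> \<in> Fock D" and P: "\<And>n w. w \<in> words D n \<Longrightarrow> cnj (Pn D n \<xi> w) = D_basis D \<alpha> w []"
  shows "conj_var D \<alpha> = \<xi>"
proof -
  have eq: "ipT D \<xi> f = ipT D (vac D) (D_op D \<alpha> f)" if f: "f \<in> Fock_alg D" for f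
  proof -
    obtain N where N: "fdeg N f" by (rule Fock_alg_fdeg[OF f])
    let ?t = "\<lambda>w. f w * D_basis D \<alpha> w []"
    have fm: "fm n \<xi> f = (\<Sum>w\<in>words D n. ?t w)" for n
      unfolding fm_cnj_sum by (intro sum.cong refl) (simp add: P)
    have "ipT D \<xi> f = (\<Sum>n\<in>{..<N}. fm n \<xi> f)"
      unfolding ipT_def
    proof (rule suminf_finite)
      fix n assume n: "n \<notin> {..<N}"
      have "f w = 0" if "w \<in> words D n" for w
        using N n words_length[OF that] unfolding fdeg_def by fastforce
      then show "fm n \<xi> f = 0" unfolding fm by (intro sum.neutral ballI) simp
    qed simp
    also have "\<dots> = (\<Sum>w\<in>(\<Union>n\<in>{..<N}. words D n). ?t w)"
      unfolding fm by (rule sum.UNION_disjoint[symmetric]) (simp, simp, use words_length in blast)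
    also have "\<dots> = (\<Sum>w\<in>{w. f w \<noteq> 0}. ?t w)"
    proof (rule sum.mono_neutral_right)
      show "{w. f w \<noteq> 0} \<subseteq> (\<Union>n\<in>{..<N}. words D n)"
        using N unfolding fdeg_def supp_words_def by blast
    qed auto
    also have "\<dots> = ipT D (vac D) (D_op D \<alpha> f)" by (simp add: ipT_vac D_op_def)
    finally show ?thesis .
  qed
  show ?thesis
    unfolding conj_var_def adjoint_on_def if_P[OF vac_Fock]
  proof (rule the_equality)
    show "\<xi> \<in> Fock D \<and> (\<forall>f\<in>Fock_alg D. ipT D \<xi> f = ipT D (vac D) (D_op D \<alpha> f))" using \<xi> eq by blast
    fix h assume h: "h \<in> Fock D \<and> (\<forall>f\<in>Fock_alg D. ipT D h f = ipT D (vac D) (D_op D \<alpha> f))"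
    show "h = \<xi>"
    proof (rule ipT_unique[of _ _ "Fock_alg D"])
      show "Fock_alg D \<subseteq> Fock D" by (metis Fock_alg_fdeg fdeg_Fock subsetI)
      show "ipT D h f = ipT D \<xi> f" if "f \<in> Fock_alg D" for f using h eq[OF that] that by simp
    qed (use h \<xi> e_word_Fock_alg in auto)
  qed
qed

lemma Pn_scale: "w \<in> words D n \<Longrightarrow> Pn D n (\<lambda>x. c * f x) w = c * Pn D n f w"
  by (simp add: Pn_eq words_length sum_distrib_left mult_ac)

lemma conjugate_variable_series:
  assumes \<alpha>: "\<alpha> \<in> letters D"
  shows "((\<lambda>M. normT D (\<lambda>w. (\<Sum>m=1..M. (-1) ^ (m - 1) * xi D m \<alpha> w) - conj_var D \<alpha> w))
            \<longlonglongrightarrow> 0)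
    \<and> (\<exists>X\<in>MT D. ((\<lambda>M. opnorm D (\<lambda>f w.
            (\<Sum>m=1..M. (-1) ^ (m - 1) * Wick D (xi D m \<alpha>) f w) - X f w)) \<longlonglongrightarrow> 0)
          \<and> X (vac D) = conj_var D \<alpha>)"
proof -
  define Y where "Y k = (\<lambda>f w. (-1) ^ k * Wick D (xi D (Suc k) \<alpha>) f w)" for k
  define X where "X = (\<lambda>f w. \<Sum>k. Y k f w)"
  let ?T = "\<lambda>M. \<Sum>k. xi_bound_seq (k + M)"
  have Y: "Y k \<in> MT D" for k
    using MT_add[OF MT_zero Wick_xi(1)[OF \<alpha>, of k], of "(-1) ^ k"] by (simp add: Y_def)
  have Yb: "normT D (Y k f) \<le> xi_bound_seq k * normT D f" if f: "f \<in> Fock D" for k f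
  proof -
    have "normT D (Y k f) = cmod ((-1) ^ k) * normT D (Wick D (xi D (Suc k) \<alpha>) f)"
      unfolding Y_def by (rule normT_scale[OF bops_Fock[OF MT_bops[OF Wick_xi(1)[OF \<alpha>]]]])
    then show ?thesis using Wick_xi(3)[OF \<alpha> f, of k] by (simp add: norm_power)
  qed
  have lim1: "X \<in> MT D"
    unfolding X_def by (rule MT_limit(1)[of Y xi_bound_seq, OF Y summable_xi_bound_seq xi_bound_seq_nonneg]) (rule Yb)
  have lim2: "normT D (\<lambda>w. X f w - (\<Sum>k<M. Y k f w)) \<le> ?T M * normT D f" if "f \<in> Fock D" for f M
    unfolding X_def by (rule MT_limit(2)[of Y xi_bound_seq, OF Y summable_xi_bound_seq xi_bound_seq_nonneg _ that]) (rule Yb)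
  have XF: "X f \<in> Fock D" for f by (rule bops_Fock[OF MT_bops[OF lim1]])
  have YF: "Y k f \<in> Fock D" for k f by (rule bops_Fock[OF MT_bops[OF Y]])
  have WF: "Wick D (xi D (Suc k) \<alpha>) f \<in> Fock D" for k f
    by (rule bops_Fock[OF MT_bops[OF Wick_xi(1)[OF \<alpha>]]])
  have T: "?T \<longlonglongrightarrow> 0" by (rule suminf_exist_split2[OF summable_xi_bound_seq])
  have T0: "0 \<le> ?T M" for M
    using summable_xi_bound_seq by (intro suminf_nonneg summable_ignore_initial_segment xi_bound_seq_nonneg)
  have shift: "(\<Sum>m=1..M. (-1) ^ (m - 1) * F m) = (\<Sum>k<M. (-1) ^ k * F (Suc k))"
    for F :: "nat \<Rightarrow> complex" and M
    by (rule sum.reindex_bij_witness[of _ Suc "\<lambda>m. m - 1"]) auto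
  have diff: "normT D (\<lambda>w. (\<Sum>m=1..M. (-1) ^ (m - 1) * Wick D (xi D m \<alpha>) f w) - X f w) \<le> ?T M * normT D f"
    if f: "f \<in> Fock D" for f M
  proof -
    have F: "(\<lambda>w. X f w - (\<Sum>k<M. Y k f w)) \<in> Fock D"
      by (rule Fock_diff[OF XF Fock_sum[OF YF]])
    have "(\<lambda>w. (\<Sum>m=1..M. (-1) ^ (m - 1) * Wick D (xi D m \<alpha>) f w) - X f w) =
        (\<lambda>w. (-1) * (X f w - (\<Sum>k<M. Y k f w)))"
      unfolding shift by (simp add: Y_def)
    then show ?thesis using normT_scale[OF F, of "-1"] lim2[OF f, of M] by simp
  qed
  have Xv: "X (vac D) = (\<lambda>w. \<Sum>k. (-1) ^ k * xi D (Suc k) \<alpha> w)"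
    by (simp add: X_def Y_def Wick_xi(2)[OF \<alpha>])
  \<comment> \<open>\<xi>_(k+1) lives in degree 2k + 1 alone, so at each word at most one term of
    the coordinatewise series is nonzero.\<close>
  have odd: "X (vac D) w = (-1) ^ k * xi D (Suc k) \<alpha> w" if "length w = 2 * k + 1" for w k
    unfolding Xv
  proof (subst suminf_finite[of "{k}"])
    fix j assume "j \<notin> {k}"
    then show "(-1) ^ j * xi D (Suc j) \<alpha> w = 0" using xi_supp(2)[of j \<alpha> w] that by auto
  qed auto
  have even: "X (vac D) w = 0" if "even (length w)" for w
  proof -
    have "xi D (Suc k) \<alpha> w = 0" for k
    proof (rule ccontr)
      assume "xi D (Suc k) \<alpha> w \<noteq> 0"
      from xi_supp(2)[OF this] show False using that by simp
    qed
    then show ?thesis by (simp add: Xv)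
  qed
  \<comment> \<open>The sign (-1)^k of the series is the one in the vacuum coefficient; in even
    degrees both sides vanish.\<close>
  have cv: "conj_var D \<alpha> = X (vac D)"
  proof (rule conj_var_eq[OF bops_Fock[OF MT_bops[OF lim1]]])
    fix n w assume w: "w \<in> words D n"
    show "cnj (Pn D n (X (vac D)) w) = D_basis D \<alpha> w []"
    proof (cases "even n")
      case True
      have "Pn D n (X (vac D)) w = Pn D n (\<lambda>x. 0 * X (vac D) x) w"
        by (rule Pn_cong[OF w]) (simp add: even words_length True)
      then show ?thesis using D_basis_even[OF w True] Pn_scale[OF w, of 0] by simp
    next
      case False
      then obtain k where n: "n = 2 * k + 1" by (auto elim: oddE)
      have "Pn D n (X (vac D)) w = Pn D n (\<lambda>x. (-1) ^ k * xi D (Suc k) \<alpha> x) w"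
        by (rule Pn_cong[OF w]) (simp add: odd words_length n)
      also have "\<dots> = (-1) ^ k * Pn D n (xi D (Suc k) \<alpha>) w" by (rule Pn_scale[OF w])
      finally show ?thesis using D_basis_odd[OF \<alpha>, of w k] w by (simp add: n)
    qed
  qed
  \<comment> \<open>At the vacuum the Wick operators give back the vectors, so convergence in the
    Fock space is the operator estimate applied to one vector.\<close>
  have first: "(\<lambda>M. normT D (\<lambda>w. (\<Sum>m=1..M. (-1) ^ (m - 1) * xi D m \<alpha> w) - conj_var D \<alpha> w)) \<longlonglongrightarrow> 0"
  proof (rule tendsto_sandwich[OF _ _ tendsto_const])
    have F: "(\<lambda>w. (\<Sum>m=1..M. (-1) ^ (m - 1) * Wick D (xi D m \<alpha>) (vac D) w) - X (vac D) w) \<in> Fock D" for M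
      unfolding shift
      by (rule Fock_diff[OF Fock_sum[OF Fock_scale[OF WF]] XF])
    have e: "(\<lambda>w. (\<Sum>m=1..M. (-1) ^ (m - 1) * Wick D (xi D m \<alpha>) (vac D) w) - X (vac D) w) =
        (\<lambda>w. (\<Sum>m=1..M. (-1) ^ (m - 1) * xi D m \<alpha> w) - conj_var D \<alpha> w)" for M
      unfolding shift cv Wick_xi(2)[OF \<alpha>] ..
    show "\<forall>\<^sub>F M in sequentially. 0 \<le> normT D (\<lambda>w. (\<Sum>m=1..M. (-1) ^ (m - 1) * xi D m \<alpha> w) - conj_var D \<alpha> w)"
      using normT_nonneg[OF F] unfolding e by simp
    show "\<forall>\<^sub>F M in sequentially. normT D (\<lambda>w. (\<Sum>m=1..M. (-1) ^ (m - 1) * xi D m \<alpha> w) - conj_var D \<alpha> w)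
        \<le> ?T M * normT D (vac D)"
      using diff[OF vac_Fock] unfolding e by simp
    show "(\<lambda>M. ?T M * normT D (vac D)) \<longlonglongrightarrow> 0" using tendsto_mult_right[OF T, of "normT D (vac D)"] by simp
  qed
  have second: "(\<lambda>M. opnorm D (\<lambda>f w. (\<Sum>m=1..M. (-1) ^ (m - 1) * Wick D (xi D m \<alpha>) f w) - X f w)) \<longlonglongrightarrow> 0"
  proof (rule tendsto_sandwich[OF _ _ tendsto_const T])
    let ?Z = "\<lambda>M f w. (\<Sum>m=1..M. (-1) ^ (m - 1) * Wick D (xi D m \<alpha>) f w) - X f w"
    let ?S = "\<lambda>M. {normT D (?Z M f) | f. f \<in> Fock D \<and> normT D f \<le> 1}"
    have ub: "x \<le> ?T M" if "x \<in> ?S M" for x M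
    proof -
      obtain f where f: "f \<in> Fock D" "normT D f \<le> 1" "x = normT D (?Z M f)" using \<open>x \<in> ?S M\<close> by blast
      have "?T M * normT D f \<le> ?T M * 1" by (rule mult_left_mono[OF f(2) T0])
      then show ?thesis using diff[OF f(1), of M] f(3) by simp
    qed
    \<comment> \<open>The zero vector makes the set under the supremum nonempty and provides a
      nonnegative member.\<close>
    have z: "normT D (?Z M (\<lambda>w. 0)) \<in> ?S M" for M by (intro CollectI exI[of _ "\<lambda>w. 0"]) simp
    have z0: "0 \<le> normT D (?Z M (\<lambda>w. 0))" for M
      unfolding shift
      by (rule normT_nonneg[OF Fock_diff[OF Fock_sum[OF Fock_scale[OF WF]] XF]])
    have "opnorm D (?Z M) \<le> ?T M" for M
      unfolding opnorm_def by (rule cSup_least) (use z ub in blast)+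
    then show "\<forall>\<^sub>F M in sequentially. opnorm D (?Z M) \<le> ?T M" by simp
    have "0 \<le> opnorm D (?Z M)" for M
      unfolding opnorm_def using ub by (intro order_trans[OF z0 cSup_upper[OF z]] bdd_aboveI)
    then show "\<forall>\<^sub>F M in sequentially. 0 \<le> opnorm D (?Z M)" by simp
  qed
  show ?thesis using first second lim1 cv by auto
qed

end

theorem corollary3p5:
  fixes D :: "('a::euclidean_space, 'i) aw_data" and \<alpha> :: nat
  assumes "aw_setup D"
    and "\<alpha> \<in> {1..DIM('a)}"
  shows "((\<lambda>M. normT D (\<lambda>w. (\<Sum>m=1..M. (-1) ^ (m - 1) * xi D m \<alpha> w) - conj_var D \<alpha> w))
            \<longlonglongrightarrow> 0)
    \<and> (\<exists>X\<in>MT D. ((\<lambda>M. opnorm D (\<lambda>f w.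
            (\<Sum>m=1..M. (-1) ^ (m - 1) * Wick D (xi D m \<alpha>) f w) - X f w)) \<longlonglongrightarrow> 0)
          \<and> X (vac D) = conj_var D \<alpha>)"
proof -
  interpret aw D by unfold_locales (rule assms(1))
  show ?thesis by (rule conjugate_variable_series[OF assms(2)])
qed

end
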